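(* Let $\lambda:\mathbb N\to\mathbb N$ be any function with $\lambda(n)\to\infty$. For every $\rho>0$ there exists $\gamma>0$ such that for every $\lambda$-well-behaved feasible degree sequence $\mathcal D$ of length $n$, the probability that $G(\mathcal D)$ has no component of order at least $\gamma n$ and $H(\mathcal D)$ has a component of size at least $\rho M_{\mathcal D}$ is $o(1)$ (as $n\to\infty$, uniformly in such $\mathcal D$).
   Context: A degree sequence $\mathcal D=(d_1,\dots,d_n)$ consists of positive integers (no zero entries) and is feasible if some simple graph on $\{1,\dots,n\}$ has vertex $i$ of degree $d_i$; $G(\mathcal D)$ is a uniformly random simple graph on $\{1,\dots,n\}$ with vertex $i$ of degree $d_i$. $M_{\mathcal D}=\sum_{i:d_i\ne 2}d_i$, and $\mathcal D$ is $\lambda$-well-behaved if $M_{\mathcal D}\ge\lambda(n)$. A component is cyclic if it is a cycle. $H(\mathcal D)$ is the multigraph obtained from $G(\mathcal D)$ by deleting all cyclic components and then suppressing every vertex of degree 2 (deleting it and joining its two neighbours by an edge, possibly creating loops and multiple edges). Order = number of vertices; size = number of edges. *)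

theory Defs
  imports "HOL-Library.Multiset" "HOL-Library.Uprod" "HOL-Probability.Probability_Mass_Function"
begin

text \<open>
  Multigraphs are undirected; an edge is an unordered pair, and a pair of the form
  \<open>Upair v v\<close> is a loop. Simple graphs are multigraphs without loops and repeated edges, so
  degrees and components are defined only once.
\<close>

datatype 'a multigraph = Multigraph (verts: "'a set") (edges: "'a uprod multiset")

definition wf_multigraph :: "'a multigraph \<Rightarrow> bool" where
  "wf_multigraph G \<longleftrightarrow> finite (verts G) \<and> (\<forall>e\<in>#edges G. set_uprod e \<subseteq> verts G)"

definition simple_graph :: "'a multigraph \<Rightarrow> bool" where
  "simple_graph G \<longleftrightarrow>
     wf_multigraph G \<and> (\<forall>e\<in>#edges G. proper_uprod e \<and> count (edges G) e = 1)"

definition incident_edges :: "'a multigraph \<Rightarrow> 'a \<Rightarrow> 'a uprod multiset" where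
  "incident_edges G v = {#e \<in># edges G. v \<in> set_uprod e#}"

text \<open>A loop contributes 2 to the degree of its vertex.\<close>

definition graph_degree :: "'a multigraph \<Rightarrow> 'a \<Rightarrow> nat" where
  "graph_degree G v = size (incident_edges G v) + count (edges G) (Upair v v)"

definition adjacent :: "'a multigraph \<Rightarrow> 'a \<Rightarrow> 'a \<Rightarrow> bool" where
  "adjacent G u v \<longleftrightarrow> Upair u v \<in># edges G"

definition induced_subgraph :: "'a multigraph \<Rightarrow> 'a set \<Rightarrow> 'a multigraph" where
  "induced_subgraph G S = Multigraph (verts G \<inter> S) {#e \<in># edges G. set_uprod e \<subseteq> S#}"

definition graph_components :: "'a multigraph \<Rightarrow> 'a multigraph set" where
  "graph_components G = (\<lambda>v. induced_subgraph G {u. (adjacent G)\<^sup>*\<^sup>* v u}) ` verts G"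

abbreviation graph_order :: "'a multigraph \<Rightarrow> nat" where
  "graph_order G \<equiv> card (verts G)"

abbreviation graph_size :: "'a multigraph \<Rightarrow> nat" where
  "graph_size G \<equiv> size (edges G)"

definition is_cycle :: "'a multigraph \<Rightarrow> bool" where
  "is_cycle K \<longleftrightarrow> (\<exists>vs. distinct vs \<and> length vs \<ge> 3 \<and> verts K = set vs \<and>
     edges K = {#Upair (vs ! i) (vs ! (Suc i mod length vs)). i \<in># mset_set {..<length vs}#})"

definition delete_cyclic_components :: "'a multigraph \<Rightarrow> 'a multigraph" where
  "delete_cyclic_components G = induced_subgraph G (\<Union>K\<in>{K \<in> graph_components G. \<not> is_cycle K}. verts K)"

text \<open>
  Only meaningful for a vertex \<open>v\<close> of degree 2 that carries no loop. Its neighbours \<open>a\<close> and \<open>b\<close>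
  may coincide, in which case the new edge is a loop.
\<close>

definition suppress :: "'a \<Rightarrow> 'a multigraph \<Rightarrow> 'a multigraph" where
  "suppress v G = Multigraph (verts G - {v})
     (add_mset (THE e. \<exists>a b. incident_edges G v = {#Upair v a, Upair v b#} \<and> e = Upair a b)
        (edges G - incident_edges G v))"

lemma suppress_eq:
  assumes "incident_edges G v = {#Upair v a, Upair v b#}"
  shows "suppress v G = Multigraph (verts G - {v})
           (add_mset (Upair a b) (edges G - {#Upair v a, Upair v b#}))"
proof -
  have "(THE e. \<exists>a b. incident_edges G v = {#Upair v a, Upair v b#} \<and> e = Upair a b) = Upair a b"
    using assms by (intro the_equality) (auto simp: add_eq_conv_ex)
  then show ?thesis
    using assms by (simp add: suppress_def)
qed

text \<open>
  Suppressing a vertex changes no other degree, and a loop at a vertex of degree 2 can only arise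
  from a cyclic component. So, once the cyclic components are deleted, the vertices to suppress
  are fixed at the start; they are processed in increasing order, which does not affect the result.
\<close>

definition suppressed_graph :: "'a::linorder multigraph \<Rightarrow> 'a multigraph" where
  "suppressed_graph G =
     (let G' = delete_cyclic_components G
      in fold suppress (sorted_list_of_set {v \<in> verts G'. graph_degree G' v = 2}) G')"

text \<open>The sequence \<open>(d\<^sub>1, \<dots>, d\<^sub>n)\<close> is a list, with \<open>d\<^sub>i\<close> stored at position \<open>i - 1\<close>.\<close>

definition graphs_with_degrees :: "nat list \<Rightarrow> nat multigraph set" where
  "graphs_with_degrees D = {G. simple_graph G \<and> verts G = {1..length D} \<and>
     (\<forall>i\<in>{1..length D}. graph_degree G i = D ! (i - 1))}"

definition feasible :: "nat list \<Rightarrow> bool" where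
  "feasible D \<longleftrightarrow> (\<forall>d\<in>set D. d > 0) \<and> graphs_with_degrees D \<noteq> {}"

lemma finite_graphs_with_degrees: "finite (graphs_with_degrees D)"
proof (rule finite_subset)
  let ?V = "{1..length D}"
  let ?E = "(\<lambda>(a, b). Upair a b) ` (?V \<times> ?V)"
  show "graphs_with_degrees D \<subseteq> (\<lambda>E. Multigraph ?V (mset_set E)) ` Pow ?E"
  proof
    fix G assume G: "G \<in> graphs_with_degrees D"
    have V: "verts G = ?V" and S: "simple_graph G"
      using G by (auto simp: graphs_with_degrees_def)
    have "edges G = mset_set (set_mset (edges G))"
    proof (rule multiset_eqI)
      fix e
      show "count (edges G) e = count (mset_set (set_mset (edges G))) e"
        using S by (cases "e \<in># edges G") (auto simp: simple_graph_def not_in_iff)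
    qed
    moreover have "set_mset (edges G) \<subseteq> ?E"
    proof
      fix e assume e: "e \<in># edges G"
      obtain a b where ab: "e = Upair a b" by (cases e)
      have "set_uprod e \<subseteq> ?V"
        using S e V by (auto simp: simple_graph_def wf_multigraph_def)
      then have "(a, b) \<in> ?V \<times> ?V" using ab by simp
      then show "e \<in> ?E" using ab by force
    qed
    ultimately show "G \<in> (\<lambda>E. Multigraph ?V (mset_set E)) ` Pow ?E"
      using V by (metis (no_types, lifting) Pow_iff image_eqI multigraph.collapse)
  qed
qed simp

definition random_graph :: "nat list \<Rightarrow> nat multigraph pmf" where
  "random_graph D = pmf_of_set (graphs_with_degrees D)"

definition M_deg :: "nat list \<Rightarrow> nat" where
  "M_deg D = (\<Sum>d\<leftarrow>filter (\<lambda>d. d \<noteq> 2) D. d)"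

definition well_behaved :: "(nat \<Rightarrow> nat) \<Rightarrow> nat list \<Rightarrow> bool" where
  "well_behaved lam D \<longleftrightarrow> M_deg D \<ge> lam (length D)"

end

theory Submission
  imports Defs "HOL-Combinatorics.Multiset_Permutations"
begin

text \<open>
  A component of \<open>H\<close> with at least \<open>\<rho>M\<close> edges lies in a component \<open>U\<close> of \<open>G\<close> whose vertices of
  degree other than 2 have total degree at least \<open>2\<rho>M\<close>. Suppose \<open>U\<close> has fewer than \<open>\<gamma>n\<close> vertices.
  Choose \<open>r\<close> edges \<open>xy\<close> inside \<open>U\<close> and \<open>r\<close> edges \<open>uv\<close> outside \<open>U\<close>, and replace each pair
  \<open>xy\<close>, \<open>uv\<close> by \<open>xu\<close>, \<open>yv\<close>. In the resulting graph the boundary of \<open>U\<close> consists exactly of the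
  new edges, so undoing the switching amounts to finding \<open>U\<close>. A vertex set that is connected from a
  given start, has at most \<open>k\<close> further vertices and at most \<open>b\<close> boundary edges can be chosen in at
  most \<open>(k + b) choose b\<close> ways, however many edges it contains, and \<open>k \<le> \<gamma>n\<close> is small compared
  with the number of edges outside \<open>U\<close> that were available.

  If \<open>M \<ge> \<delta>n\<close>, take \<open>r\<close> constant and \<open>xy\<close> off a spanning tree of \<open>U\<close>; each switching gains a
  factor 2. If \<open>M \<le> \<delta>n\<close>, take \<open>r\<close> proportional to \<open>M\<close> and \<open>y\<close> of degree other than 2: guessing
  these vertices of \<open>U\<close> and the edges \<open>yv\<close> costs at most \<open>4\<^sup>M\<close>, only the edges \<open>xu\<close> need
  exploration, and they gain a factor \<open>(\<gamma> + \<delta>)\<^sup>r\<close> up to a constant to the power \<open>r\<close>.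
\<close>

section \<open>Exploration\<close>

text \<open>A switching never creates an edge that is already present, because no edge leaves the
  component \<open>U\<close>; the only thing to arrange is that the new edges differ from one
  another. Undoing \<open>r\<close> switchings by exploring all \<open>2 * r\<close> boundary edges
  leaves about \<open>(\<gamma> * n) ^ (2 * r)\<close> possibilities, against about
  \<open>(M * n) ^ r\<close> choices forward. This wins if \<open>M\<close> is at least
  \<open>\<delta> * n\<close> and fails if \<open>M\<close> is much smaller than \<open>n\<close>.
  In that range half of the boundary must be identified without exploration. Hence \<open>y\<close>
  is taken of degree other than 2: at most \<open>M\<close> edges meet such vertices, so a set of
  them is cheap to guess. The price \<open>4 ^ M\<close> in turn forces \<open>r\<close> to grow
  with \<open>M\<close>. Exploring from all of these vertices of \<open>U\<close> at once, rather
  than from one, is what allows a constant fraction of the edges at them to be removed without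
  losing \<open>U\<close>: a stretch of vertices of degree 2 needs only one link. The constants
  depend on each other in this order: \<open>q\<close> on \<rho>, then \<delta> on \<open>q\<close>,
  then \<gamma> on \<rho> and \<delta>; in the dense case \<open>r\<close> comes last and depends on
  \<epsilon>.\<close>

definition boundary :: "'a uprod set \<Rightarrow> 'a set \<Rightarrow> 'a uprod set" where
  "boundary E U = {e \<in> E. \<exists>a b. a \<in> U \<and> b \<notin> U \<and> e = Upair a b}"

definition joined :: "'a uprod set \<Rightarrow> 'a set \<Rightarrow> 'a \<Rightarrow> 'a \<Rightarrow> bool" where
  "joined E U a b \<longleftrightarrow> a \<in> U \<and> b \<in> U \<and> Upair a b \<in> E"

definition spanned_from :: "'a uprod set \<Rightarrow> 'a set \<Rightarrow> 'a set \<Rightarrow> bool" where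
  "spanned_from E W U \<longleftrightarrow> (\<forall>u\<in>U. \<exists>w\<in>W. (joined E U)\<^sup>*\<^sup>* w u)"

text \<open>The vertices of \<open>W\<close> are free: \<open>k\<close> counts only those beyond
  \<open>W\<close>. The start is a single vertex in the dense case and all of
  \<open>U \<inter> N\<close> in the sparse case.\<close>

definition explored_sets :: "'a uprod set \<Rightarrow> 'a set \<Rightarrow> nat \<Rightarrow> nat \<Rightarrow> 'a set set" where
  "explored_sets E W k b = {U. W \<subseteq> U \<and> finite (U - W) \<and> card (U - W) \<le> k \<and>
     card (boundary E U) \<le> b \<and> spanned_from E W U}"

lemma joined_sym: "joined E U a b \<Longrightarrow> joined E U b a"
  by (metis Upair_inject joined_def)

lemma joined_rtranclp_sym: "(joined E U)\<^sup>*\<^sup>* a b \<Longrightarrow> (joined E U)\<^sup>*\<^sup>* b a"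
  by (metis joined_sym sympD sympI symp_rtranclp)

lemma joined_rtranclp_mono:
  assumes "(joined E U)\<^sup>*\<^sup>* a b" "U \<subseteq> U'" "\<And>x y. x \<in> U \<Longrightarrow> y \<in> U \<Longrightarrow> Upair x y \<in> E \<Longrightarrow> Upair x y \<in> E'"
  shows "(joined E' U')\<^sup>*\<^sup>* a b"
proof (rule rtranclp_mono[THEN predicate2D, OF _ assms(1)])
  show "joined E U \<le> joined E' U'"
    using assms(2,3) by (auto simp: joined_def)
qed

lemma explored_sets_no_boundary:
  assumes "boundary E W = {}" "U \<in> explored_sets E W k b"
  shows "U = W"
proof
  show "U \<subseteq> W"
  proof
    fix u assume "u \<in> U"
    then obtain w where w: "w \<in> W" "(joined E U)\<^sup>*\<^sup>* w u"
      using assms(2) by (auto simp: explored_sets_def spanned_from_def)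
    from w(2,1) show "u \<in> W"
    proof (induction rule: rtranclp_induct)
      case (step a b)
      then show ?case using assms(1) by (auto simp: boundary_def joined_def)
    qed
  qed
qed (use assms in \<open>auto simp: explored_sets_def\<close>)

text \<open>
  Pascal's rule: pick an edge leaving \<open>W\<close>. Either its other end is in the set, which costs a
  vertex, or the edge is on the boundary, which costs a boundary edge; edges inside the set are
  never charged.
\<close>

lemma card_explored_sets:
  assumes "finite E"
  shows "finite (explored_sets E W k b) \<and> card (explored_sets E W k b) \<le> (k + b) choose b"
  using assms
proof (induction "k + b" arbitrary: E W k b rule: less_induct)
  case less
  show ?case
  proof (cases "boundary E W = {}")
    case True
    then have "explored_sets E W k b \<subseteq> {W}" using explored_sets_no_boundary by blast
    then have "card (explored_sets E W k b) \<le> card {W}" "finite (explored_sets E W k b)"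
      by (metis card_mono finite.emptyI finite.insertI, metis finite.emptyI finite.insertI finite_subset)
    moreover have "(k + b) choose b \<ge> 1" by (simp add: Suc_leI)
    ultimately show ?thesis by auto
  next
    case False
    then obtain w t where wt: "w \<in> W" "t \<notin> W" "Upair w t \<in> E" by (auto simp: boundary_def)
    define S1 where "S1 = {U \<in> explored_sets E W k b. t \<in> U}"
    define S2 where "S2 = {U \<in> explored_sets E W k b. t \<notin> U}"
    have S: "explored_sets E W k b = S1 \<union> S2" by (auto simp: S1_def S2_def)
    \<comment> \<open>Moving \<open>t\<close> into the start uses up one of the \<open>k\<close>
      further vertices. If \<open>k = 0\<close> the subtraction is truncated, but then
      \<open>k0\<close> makes \<open>S1\<close> empty.\<close>
    have sub1: "S1 \<subseteq> explored_sets E (insert t W) (k - 1) b" and k0: "S1 \<noteq> {} \<Longrightarrow> k > 0"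
    proof -
      show "S1 \<subseteq> explored_sets E (insert t W) (k - 1) b"
      proof
        fix U assume U: "U \<in> S1"
        have "U - insert t W = (U - W) - {t}" by auto
        then have "card (U - insert t W) \<le> k - 1"
          using U wt by (auto simp: S1_def explored_sets_def card_Diff_singleton_if)
        then show "U \<in> explored_sets E (insert t W) (k - 1) b"
          using U by (auto simp: S1_def explored_sets_def spanned_from_def finite_Diff_insert)
      qed
      show "k > 0" if ne: "S1 \<noteq> {}"
      proof -
        obtain U where U: "U \<in> S1" using ne by auto
        then have "t \<in> U - W" "finite (U - W)" "card (U - W) \<le> k"
          using wt by (auto simp: S1_def explored_sets_def)
        then show ?thesis by (metis card_gt_0_iff emptyE less_le_trans)
      qed
    qed
    \<comment> \<open>With \<open>t\<close> left out, deleting the edge from \<open>E\<close>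
      disconnects nothing inside \<open>U\<close> and lowers the boundary by one. This is why the
      induction has to vary \<open>E\<close>.\<close>
    have sub2: "S2 \<subseteq> explored_sets (E - {Upair w t}) W k (b - 1)" and b0: "S2 \<noteq> {} \<Longrightarrow> b > 0"
    proof -
      have *: "boundary (E - {Upair w t}) U = boundary E U - {Upair w t}" for U
        by (auto simp: boundary_def)
      have **: "Upair w t \<in> boundary E U" "finite (boundary E U)" if "U \<in> S2" for U
        using that wt less.prems by (auto simp: boundary_def S2_def explored_sets_def)
      show "S2 \<subseteq> explored_sets (E - {Upair w t}) W k (b - 1)"
      proof
        fix U assume U: "U \<in> S2"
        have "card (boundary (E - {Upair w t}) U) \<le> b - 1"
          using U **[OF U] by (auto simp: * S2_def explored_sets_def)
        moreover have "spanned_from (E - {Upair w t}) W U"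
          unfolding spanned_from_def
        proof
          fix u assume "u \<in> U"
          then obtain w' where "w' \<in> W" "(joined E U)\<^sup>*\<^sup>* w' u"
            using U by (auto simp: S2_def explored_sets_def spanned_from_def)
          moreover have "(joined (E - {Upair w t}) U)\<^sup>*\<^sup>* w' u"
            by (rule joined_rtranclp_mono[OF calculation(2)]) (use U in \<open>auto simp: S2_def\<close>)
          ultimately show "\<exists>w'\<in>W. (joined (E - {Upair w t}) U)\<^sup>*\<^sup>* w' u" by auto
        qed
        ultimately show "U \<in> explored_sets (E - {Upair w t}) W k (b - 1)"
          using U by (auto simp: S2_def explored_sets_def)
      qed
      show "b > 0" if ne: "S2 \<noteq> {}"
      proof -
        obtain U where U: "U \<in> S2" using ne by auto
        have "card (boundary E U) > 0" using **[OF U] by (metis card_gt_0_iff emptyE)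
        then show ?thesis using U by (auto simp: S2_def explored_sets_def)
      qed
    qed
    have c1: "finite S1 \<and> card S1 \<le> (if k = 0 then 0 else (k - 1 + b) choose b)"
    proof (cases "k = 0")
      case False
      then have "k - 1 + b < k + b" by simp
      from less.hyps[OF this less.prems, of "insert t W"] False sub1
      show ?thesis by simp (meson card_mono finite_subset le_trans)
    qed (use k0 in \<open>cases "S1 = {}"; simp\<close>)
    have c2: "finite S2 \<and> card S2 \<le> (if b = 0 then 0 else (k + (b - 1)) choose (b - 1))"
    proof (cases "b = 0")
      case False
      then have "k + (b - 1) < k + b" by simp
      from less.hyps[OF this, of "E - {Upair w t}" W] less.prems False sub2
      show ?thesis by simp (meson card_mono finite_subset le_trans)
    qed (use b0 in \<open>cases "S2 = {}"; simp\<close>)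
    have "card (S1 \<union> S2) \<le> card S1 + card S2" by (rule card_Un_le)
    also have "\<dots> \<le> (k + b) choose b"
    proof (cases k)
      case 0
      have "card S1 = 0" using c1 0 by simp
      moreover have "card S2 \<le> 1" using c2 0 by (simp split: if_splits)
      ultimately show ?thesis using 0 by simp
    next
      case (Suc k')
      note k = this
      show ?thesis
      proof (cases b)
        case 0
        then show ?thesis using c1 c2 k by simp
      next
        case (Suc b')
        have "card S1 \<le> (k' + b) choose b" using c1 k by simp
        moreover have "card S2 \<le> (k + b') choose b'" using c2 Suc by simp
        ultimately show ?thesis unfolding k Suc by simp
      qed
    qed
    finally show ?thesis using S c1 c2 by simp
  qed
qed

text \<open>Greedy choice: the list grows at its front, and each entry \<open>a\<close> already
  chosen excludes at most \<open>c\<close> candidates. \<open>sorted_wrt\<close> compares the head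
  with the later entries, so the new element is the first argument of \<open>conf\<close>.
  Subtraction is truncated: for positive \<open>r\<close> the bound becomes 0 once
  \<open>r * c\<close> reaches \<open>card \<Omega>\<close>.\<close>

lemma card_pairwise_lists:
  fixes conf :: "'a \<Rightarrow> 'a \<Rightarrow> bool"
  assumes fin: "finite \<Omega>" and c: "\<And>a. a \<in> \<Omega> \<Longrightarrow> card {b \<in> \<Omega>. conf b a} \<le> c"
  shows "(card \<Omega> - r * c) ^ r \<le>
    card {xs. length xs = r \<and> set xs \<subseteq> \<Omega> \<and> sorted_wrt (\<lambda>a b. \<not> conf a b) xs}"
proof (induction r)
  case 0
  have "{xs. length xs = 0 \<and> set xs \<subseteq> \<Omega> \<and> sorted_wrt (\<lambda>a b. \<not> conf a b) xs} = {[]}" by auto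
  then show ?case by simp
next
  case (Suc r)
  let ?L = "\<lambda>r. {xs. length xs = r \<and> set xs \<subseteq> \<Omega> \<and> sorted_wrt (\<lambda>a b. \<not> conf a b) xs}"
  let ?N = "\<lambda>xs. \<Omega> - (\<Union>a\<in>set xs. {b \<in> \<Omega>. conf b a})"
  have finL: "finite (?L r)" for r
    by (rule finite_subset[OF _ finite_lists_length_eq[OF fin, of r]]) auto
  have N: "card \<Omega> - r * c \<le> card (?N xs)" if "xs \<in> ?L r" for xs
  proof -
    have "card (\<Union>a\<in>set xs. {b \<in> \<Omega>. conf b a}) \<le> (\<Sum>a\<in>set xs. card {b \<in> \<Omega>. conf b a})"
      by (rule card_UN_le) simp
    also have "\<dots> \<le> (\<Sum>a\<in>set xs. c)" using that c by (intro sum_mono) auto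
    also have "\<dots> \<le> r * c" using that card_length[of xs] by auto
    finally have "card (\<Union>a\<in>set xs. {b \<in> \<Omega>. conf b a}) \<le> r * c" .
    moreover have "finite (\<Union>a\<in>set xs. {b \<in> \<Omega>. conf b a})" using fin by auto
    ultimately show ?thesis by (meson diff_card_le_card_Diff diff_le_mono2 le_trans)
  qed
  have "(card \<Omega> - Suc r * c) ^ Suc r \<le> (card \<Omega> - r * c) ^ Suc r"
    by (intro power_mono) auto
  also have "\<dots> \<le> card (?L r) * (card \<Omega> - r * c)" using Suc.IH by (simp add: mult.commute)
  also have "\<dots> \<le> (\<Sum>xs\<in>?L r. card (?N xs))"
    using sum_mono[of "?L r" "\<lambda>_. card \<Omega> - r * c" "\<lambda>xs. card (?N xs)"] N by simp
  also have "\<dots> = card (Sigma (?L r) ?N)"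
    using finL fin by (intro card_SigmaI[symmetric]) auto
  also have "\<dots> = card ((\<lambda>(xs, b). b # xs) ` Sigma (?L r) ?N)"
    by (intro card_image[symmetric]) (auto simp: inj_on_def)
  also have "\<dots> \<le> card (?L (Suc r))"
    by (intro card_mono finL) auto
  finally show ?case .
qed

text \<open>Double counting of pairs \<open>(E, t)\<close>. The image \<open>(f E t, t)\<close>
  retains \<open>t\<close>, so it suffices that the result and \<open>t\<close> together determine
  \<open>E\<close>. The difficulty of undoing a switching is thereby shifted to \<open>C\<close>,
  which collects the candidates for \<open>t\<close> that a given graph leaves open.\<close>

lemma switching_count:
  assumes fin: "finite A" "finite G"
    and T: "\<And>E. E \<in> A \<Longrightarrow> finite (T E) \<and> F \<le> card (T E)"
    and f: "\<And>E t. E \<in> A \<Longrightarrow> t \<in> T E \<Longrightarrow> f E t \<in> G \<and> t \<in> C (f E t)"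
    and inj: "\<And>E E' t. E \<in> A \<Longrightarrow> E' \<in> A \<Longrightarrow> t \<in> T E \<Longrightarrow> t \<in> T E' \<Longrightarrow> f E t = f E' t \<Longrightarrow> E = E'"
    and C: "\<And>E. E \<in> G \<Longrightarrow> finite (C E) \<and> card (C E) \<le> B"
  shows "card A * F \<le> card G * B"
proof -
  have "card A * F \<le> (\<Sum>E\<in>A. card (T E))"
    using sum_mono[of A "\<lambda>_. F" "\<lambda>E. card (T E)"] T by simp
  also have "\<dots> = card (Sigma A T)" using fin T by (intro card_SigmaI[symmetric]) auto
  also have "\<dots> \<le> card (Sigma G C)"
  proof (rule card_inj_on_le[where f = "\<lambda>(E, t). (f E t, t)"])
    show "inj_on (\<lambda>(E, t). (f E t, t)) (Sigma A T)" using inj by (auto simp: inj_on_def)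
    show "(\<lambda>(E, t). (f E t, t)) ` Sigma A T \<subseteq> Sigma G C" using f by auto
    show "finite (Sigma G C)" using fin C by auto
  qed
  also have "\<dots> = (\<Sum>E\<in>G. card (C E))" using fin C by (intro card_SigmaI) auto
  also have "\<dots> \<le> card G * B"
    using sum_mono[of G "\<lambda>E. card (C E)" "\<lambda>_. B"] C by simp
  finally show ?thesis .
qed

section \<open>Switchings\<close>

definition edge_degree :: "'a uprod set \<Rightarrow> 'a \<Rightarrow> nat" where
  "edge_degree E v = card {e \<in> E. v \<in> set_uprod e}"

text \<open>Simple graphs on \<open>V\<close> are identified with their edge sets, so repeated edges
  are excluded by the representation. \<open>edge_set_bij\<close> leads back to the multigraphs of
  the theorem.\<close>

definition degree_graphs :: "'a set \<Rightarrow> ('a \<Rightarrow> nat) \<Rightarrow> 'a uprod set set" where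
  "degree_graphs V d = {E. (\<forall>e\<in>E. proper_uprod e \<and> set_uprod e \<subseteq> V) \<and> (\<forall>v\<in>V. edge_degree E v = d v)}"

definition edge_closed :: "'a uprod set \<Rightarrow> 'a set \<Rightarrow> bool" where
  "edge_closed E U \<longleftrightarrow> (\<forall>a b. Upair a b \<in> E \<longrightarrow> a \<in> U \<longrightarrow> b \<in> U)"

text \<open>Both edges of a pair are oriented, because the orientation decides which ends are
  joined.\<close>

type_synonym 'a edge_pair = "('a \<times> 'a) \<times> ('a \<times> 'a)"

fun old1 :: "'a edge_pair \<Rightarrow> 'a uprod" where "old1 ((x, y), (u, v)) = Upair x y"
fun old2 :: "'a edge_pair \<Rightarrow> 'a uprod" where "old2 ((x, y), (u, v)) = Upair u v"
fun new1 :: "'a edge_pair \<Rightarrow> 'a uprod" where "new1 ((x, y), (u, v)) = Upair x u"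
fun new2 :: "'a edge_pair \<Rightarrow> 'a uprod" where "new2 ((x, y), (u, v)) = Upair y v"

definition straddles :: "'a set \<Rightarrow> 'a edge_pair list \<Rightarrow> bool" where
  "straddles U ts \<longleftrightarrow> (\<forall>((x, y), (u, v))\<in>set ts. x \<in> U \<and> y \<in> U \<and> u \<notin> U \<and> v \<notin> U)"

text \<open>That inner and outer old edges differ follows from \<open>straddles\<close>, and that
  new edges lie outside \<open>E\<close> follows once \<open>U\<close> is closed. What is left to
  demand is distinctness within each kind, without which the degrees would not balance.\<close>

definition switchable :: "'a uprod set \<Rightarrow> 'a set \<Rightarrow> 'a edge_pair list \<Rightarrow> bool" where
  "switchable E U ts \<longleftrightarrow> straddles U ts \<and> set (map old1 ts) \<subseteq> E \<and> set (map old2 ts) \<subseteq> E \<and>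
     distinct (map old1 ts) \<and> distinct (map old2 ts) \<and> distinct (map new1 ts @ map new2 ts)"

definition switch :: "'a uprod set \<Rightarrow> 'a edge_pair list \<Rightarrow> 'a uprod set" where
  "switch E ts = (E - (set (map old1 ts) \<union> set (map old2 ts))) \<union> (set (map new1 ts) \<union> set (map new2 ts))"

lemma degree_graph_subset:
  assumes "E \<in> degree_graphs V d"
  shows "E \<subseteq> (\<lambda>(a, b). Upair a b) ` (V \<times> V)"
proof
  fix e assume e: "e \<in> E"
  obtain a b where ab: "e = Upair a b" by (cases e)
  then have "(a, b) \<in> V \<times> V" using e assms by (force simp: degree_graphs_def)
  then show "e \<in> (\<lambda>(a, b). Upair a b) ` (V \<times> V)"
    using ab by (metis (no_types, lifting) case_prod_conv image_eqI)
qed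

lemma finite_degree_graph: "finite V \<Longrightarrow> E \<in> degree_graphs V d \<Longrightarrow> finite E"
  by (rule finite_subset[OF degree_graph_subset]) auto

lemma finite_degree_graphs:
  assumes "finite V" shows "finite (degree_graphs V d)"
proof (rule finite_subset)
  show "degree_graphs V d \<subseteq> Pow ((\<lambda>(a, b). Upair a b) ` (V \<times> V))"
  proof
    fix E assume E: "E \<in> degree_graphs V d"
    show "E \<in> Pow ((\<lambda>(a, b). Upair a b) ` (V \<times> V))"
      using degree_graph_subset[OF E] by simp
  qed
qed (use assms in simp)

lemma straddlesD:
  assumes "straddles U ts" "((x, y), (u, v)) \<in> set ts"
  shows "x \<in> U" "y \<in> U" "u \<notin> U" "v \<notin> U"
  using assms by (auto simp: straddles_def)

text \<open>A new edge runs between \<open>U\<close> and its complement, where a closed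
  \<open>U\<close> admits no edge of \<open>E\<close>. So no switching yields a repeated
  edge.\<close>

lemma new_not_in:
  assumes "edge_closed E U" "straddles U ts"
  shows "(set (map new1 ts) \<union> set (map new2 ts)) \<inter> E = {}"
  using assms(1) straddlesD[OF assms(2)] unfolding edge_closed_def by fastforce

lemma switch_inverse:
  assumes "edge_closed E U" "switchable E U ts"
  shows "E = (switch E ts - (set (map new1 ts) \<union> set (map new2 ts))) \<union> (set (map old1 ts) \<union> set (map old2 ts))"
  using new_not_in[OF assms(1)] assms(2) unfolding switch_def switchable_def by blast

text \<open>\<open>U\<close> and \<open>U'\<close> may differ: the list \<open>ts\<close> alone
  tells which edges to delete and which to restore.\<close>

lemma switch_inj:
  assumes "edge_closed E U" "switchable E U ts" "edge_closed E' U'" "switchable E' U' ts"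
    "switch E ts = switch E' ts"
  shows "E = E'"
  using switch_inverse[OF assms(1,2)] switch_inverse[OF assms(3,4)] assms(5) by simp

lemma boundary_switch:
  assumes "edge_closed E U" "switchable E U ts"
  shows "boundary (switch E ts) U = set (map new1 ts) \<union> set (map new2 ts)"
proof
  show "boundary (switch E ts) U \<subseteq> set (map new1 ts) \<union> set (map new2 ts)"
    using assms(1) unfolding boundary_def switch_def edge_closed_def by blast
  have s: "straddles U ts" using assms(2) by (simp add: switchable_def)
  have "new1 q \<in> boundary (switch E ts) U \<and> new2 q \<in> boundary (switch E ts) U" if "q \<in> set ts" for q
  proof -
    obtain x y u v where q: "q = ((x, y), (u, v))" by (metis surj_pair)
    have "x \<in> U" "y \<in> U" "u \<notin> U" "v \<notin> U" using straddlesD[OF s] that q by blast+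
    moreover have "new1 q \<in> switch E ts" "new2 q \<in> switch E ts" using that by (auto simp: switch_def)
    ultimately show ?thesis unfolding q boundary_def by auto
  qed
  then show "set (map new1 ts) \<union> set (map new2 ts) \<subseteq> boundary (switch E ts) U" by auto
qed

text \<open>Turns a degree into a sum along a list, so that old and new edges can be compared pair
  by pair.\<close>

lemma edge_degree_distinct_list:
  assumes "distinct L"
  shows "edge_degree (set L) v = (\<Sum>e\<leftarrow>L. of_bool (v \<in> set_uprod e))"
proof -
  have "{e \<in> set L. v \<in> set_uprod e} = set (filter (\<lambda>e. v \<in> set_uprod e) L)" by auto
  then have "edge_degree (set L) v = length (filter (\<lambda>e. v \<in> set_uprod e) L)"
    unfolding edge_degree_def using assms by (metis distinct_card distinct_filter)
  also have "\<dots> = (\<Sum>e\<leftarrow>L. of_bool (v \<in> set_uprod e))" by (induction L) auto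
  finally show ?thesis .
qed

lemma switch_degree_graphs:
  assumes E: "E \<in> degree_graphs V d" and V: "finite V" and cl: "edge_closed E U"
    and s: "switchable E U ts"
  shows "switch E ts \<in> degree_graphs V d"
proof -
  let ?O = "set (map old1 ts @ map old2 ts)" and ?N = "set (map new1 ts @ map new2 ts)"
  have st: "straddles U ts" using s by (simp add: switchable_def)
  have pr: "proper_uprod e" "set_uprod e \<subseteq> V" if "e \<in> E" for e
    using E that by (auto simp: degree_graphs_def)
  have ends: "x \<in> U \<and> y \<in> U \<and> u \<notin> U \<and> v \<notin> U \<and> x \<in> V \<and> y \<in> V \<and> u \<in> V \<and> v \<in> V \<and> x \<noteq> y \<and> u \<noteq> v"
    if "((x, y), (u, v)) \<in> set ts" for x y u v
  proof -
    have "old1 ((x, y), (u, v)) \<in> E" "old2 ((x, y), (u, v)) \<in> E"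
      using s imageI[OF that, of old1] imageI[OF that, of old2] unfolding switchable_def set_map by blast+
    then have "Upair x y \<in> E" "Upair u v \<in> E" by simp_all
    then show ?thesis using straddlesD[OF st that] pr[of "Upair x y"] pr[of "Upair u v"] by auto
  qed
  have dO: "distinct (map old1 ts @ map old2 ts)"
  proof -
    have "old1 q \<noteq> old2 q'" if "q \<in> set ts" "q' \<in> set ts" for q q'
    proof -
      obtain x y u v x' y' u' v' where "q = ((x, y), (u, v))" "q' = ((x', y'), (u', v'))"
        by (metis surj_pair)
      then show ?thesis using ends[of x y u v] ends[of x' y' u' v'] that by auto
    qed
    then have "set (map old1 ts) \<inter> set (map old2 ts) = {}" unfolding set_map by blast
    then show ?thesis using s unfolding switchable_def distinct_append by blast
  qed
  have dN: "distinct (map new1 ts @ map new2 ts)" using s by (simp add: switchable_def)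
  have fin: "finite E" by (rule finite_degree_graph[OF V E])
  have NE: "?N \<inter> E = {}" using new_not_in[OF cl st] by simp
  have OE: "?O \<subseteq> E" using s by (auto simp: switchable_def)
  have sw: "switch E ts = (E - ?O) \<union> ?N" by (simp add: switch_def)
  have "edge_degree (switch E ts) w = edge_degree E w" if "w \<in> V" for w
  proof -
    have "{e \<in> switch E ts. w \<in> set_uprod e} =
        ({e \<in> E. w \<in> set_uprod e} - {e \<in> ?O. w \<in> set_uprod e}) \<union> {e \<in> ?N. w \<in> set_uprod e}"
      unfolding sw by blast
    moreover have "({e \<in> E. w \<in> set_uprod e} - {e \<in> ?O. w \<in> set_uprod e}) \<inter> {e \<in> ?N. w \<in> set_uprod e} = {}"
      using NE by blast
    ultimately have "edge_degree (switch E ts) w =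
        card ({e \<in> E. w \<in> set_uprod e} - {e \<in> ?O. w \<in> set_uprod e}) + edge_degree ?N w"
      unfolding edge_degree_def using fin by (simp only:) (rule card_Un_disjoint; simp)
    also have "card ({e \<in> E. w \<in> set_uprod e} - {e \<in> ?O. w \<in> set_uprod e}) = edge_degree E w - edge_degree ?O w"
      unfolding edge_degree_def using OE fin by (intro card_Diff_subset) (auto intro: finite_subset)
    also have "edge_degree ?N w = edge_degree ?O w"
    proof -
      \<comment> \<open>The four ends of a pair are distinct, so both sides are 1 if
        \<open>w\<close> is one of them and 0 otherwise.\<close>
      have *: "of_bool (w \<in> set_uprod (new1 q)) + of_bool (w \<in> set_uprod (new2 q)) =
          (of_bool (w \<in> set_uprod (old1 q)) + of_bool (w \<in> set_uprod (old2 q)) :: nat)" if "q \<in> set ts" for q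
      proof -
        obtain x y u v where q: "q = ((x, y), (u, v))" by (metis surj_pair)
        then show ?thesis using ends[of x y u v] that by auto
      qed
      have "edge_degree ?N w = (\<Sum>q\<leftarrow>ts. of_bool (w \<in> set_uprod (new1 q)) + of_bool (w \<in> set_uprod (new2 q)))"
        unfolding edge_degree_distinct_list[OF dN] by (simp add: sum_list_addf o_def)
      also have "\<dots> = (\<Sum>q\<leftarrow>ts. of_bool (w \<in> set_uprod (old1 q)) + of_bool (w \<in> set_uprod (old2 q)))"
        using * by (intro arg_cong[of _ _ sum_list] map_cong refl)
      also have "\<dots> = edge_degree ?O w"
        unfolding edge_degree_distinct_list[OF dO] by (simp add: sum_list_addf o_def)
      finally show ?thesis .
    qed
    finally have "edge_degree (switch E ts) w = edge_degree E w - edge_degree ?O w + edge_degree ?O w" .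
    moreover have "edge_degree ?O w \<le> edge_degree E w"
      unfolding edge_degree_def using OE fin by (intro card_mono) auto
    ultimately show ?thesis by simp
  qed
  moreover have "proper_uprod e \<and> set_uprod e \<subseteq> V" if "e \<in> switch E ts" for e
  proof (cases "e \<in> E")
    case False
    then have "e \<in> ?N" using that unfolding sw by blast
    then obtain q where q: "q \<in> set ts" "e = new1 q \<or> e = new2 q" by auto
    obtain x y u v where "q = ((x, y), (u, v))" by (metis surj_pair)
    then show ?thesis using ends[of x y u v] q by auto
  qed (use pr in auto)
  ultimately show ?thesis using E by (auto simp: degree_graphs_def)
qed

lemma incident_count:
  assumes "finite S" "finite E"
  shows "(\<Sum>v\<in>S. edge_degree E v) = (\<Sum>e\<in>E. card (S \<inter> set_uprod e))"
proof -
  have "(\<Sum>v\<in>S. edge_degree E v) = (\<Sum>v\<in>S. \<Sum>e | e \<in> E \<and> v \<in> set_uprod e. 1)"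
    by (simp add: edge_degree_def)
  also have "\<dots> = (\<Sum>e\<in>E. \<Sum>v | v \<in> S \<and> v \<in> set_uprod e. 1)"
    by (rule sum.swap_restrict[OF assms])
  also have "\<dots> = (\<Sum>e\<in>E. card (S \<inter> set_uprod e))"
    by (simp add: Int_def)
  finally show ?thesis .
qed

section \<open>Components\<close>

definition component_of :: "'a uprod set \<Rightarrow> 'a \<Rightarrow> 'a set" where
  "component_of E z = {u. (joined E UNIV)\<^sup>*\<^sup>* z u}"

lemma edge_closed_component_of: "edge_closed E (component_of E z)"
  unfolding edge_closed_def component_of_def
  by (auto simp: joined_def intro: rtranclp.rtrancl_into_rtrancl)

lemma edge_closed_sym: "edge_closed E U \<Longrightarrow> Upair a b \<in> E \<Longrightarrow> a \<in> U \<longleftrightarrow> b \<in> U"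
  unfolding edge_closed_def by (metis Upair_inject)

lemma component_of_subset:
  assumes "\<forall>e\<in>E. set_uprod e \<subseteq> V" "z \<in> V" shows "component_of E z \<subseteq> V"
proof
  fix u assume "u \<in> component_of E z"
  then have "(joined E UNIV)\<^sup>*\<^sup>* z u" by (simp add: component_of_def)
  then show "u \<in> V" by induction (use assms in \<open>auto simp: joined_def\<close>)
qed

lemma component_of_joined:
  assumes "u \<in> component_of E z"
  shows "(joined E (component_of E z))\<^sup>*\<^sup>* z u"
proof -
  have "(joined E UNIV)\<^sup>*\<^sup>* z u" using assms by (simp add: component_of_def)
  then show ?thesis
  proof induction
    case (step a b)
    then have "joined E (component_of E z) a b"
      by (auto simp: joined_def component_of_def intro: rtranclp.rtrancl_into_rtrancl)
    with step.IH show ?case by (rule rtranclp.rtrancl_into_rtrancl)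
  qed simp
qed

lemma component_of_joined2:
  assumes "u \<in> component_of E z" "v \<in> component_of E z"
  shows "(joined E (component_of E z))\<^sup>*\<^sup>* u v"
  by (rule rtranclp_trans[OF joined_rtranclp_sym component_of_joined])
    (rule component_of_joined assms)+

text \<open>A breadth-first tree: \<open>f\<close> is the distance from \<open>z\<close> inside
  \<open>U\<close>, and every other vertex keeps one edge to a neighbour at smaller
  distance.\<close>

lemma spanning_edges:
  assumes "finite U" and U: "\<And>u. u \<in> U \<Longrightarrow> (joined E U)\<^sup>*\<^sup>* z u"
  obtains T where "T \<subseteq> E" "finite T" "card T \<le> card U" "\<And>u. u \<in> U \<Longrightarrow> (joined T U)\<^sup>*\<^sup>* z u"
proof -
  define f where "f u = (LEAST n. (joined E U ^^ n) z u)" for u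
  have f: "(joined E U ^^ f u) z u" if "u \<in> U" for u
    unfolding f_def by (rule LeastI_ex) (use U[OF that] in \<open>rule rtranclp_imp_relpowp\<close>)
  have "\<exists>p. joined E U p u \<and> f p < f u" if "u \<in> U" "u \<noteq> z" for u
  proof (cases "f u")
    case 0
    then show ?thesis using f[OF that(1)] that by simp
  next
    case (Suc n)
    then have "(joined E U ^^ Suc n) z u" using f[OF that(1)] by simp
    then obtain p where p: "(joined E U ^^ n) z p" "joined E U p u" by (rule relpowp_Suc_E)
    have "f p \<le> n" unfolding f_def by (rule Least_le) (rule p)
    then show ?thesis using p Suc by auto
  qed
  then obtain p where p: "\<And>u. u \<in> U \<Longrightarrow> u \<noteq> z \<Longrightarrow> joined E U (p u) u \<and> f (p u) < f u" by metis
  define T where "T = (\<lambda>u. Upair (p u) u) ` (U - {z})"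
  show thesis
  proof
    show "T \<subseteq> E" using p by (auto simp: T_def joined_def)
    show "finite T" using assms by (simp add: T_def)
    have "card T \<le> card (U - {z})" unfolding T_def using assms by (intro card_image_le) simp
    also have "\<dots> \<le> card U" using assms by (intro card_mono) auto
    finally show "card T \<le> card U" .
    show "(joined T U)\<^sup>*\<^sup>* z u" if "u \<in> U" for u
      using that
    proof (induction "f u" arbitrary: u rule: less_induct)
      case less
      show ?case
      proof (cases "u = z")
        case False
        then have "p u \<in> U" "f (p u) < f u" "u \<in> U" using p[of u] less.prems by (auto simp: joined_def)
        then have "(joined T U)\<^sup>*\<^sup>* z (p u)" "joined T U (p u) u"
          using less.hyps False by (auto simp: joined_def T_def)
        then show ?thesis by (rule rtranclp.rtrancl_into_rtrancl)
      qed simp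
    qed
  qed
qed

text \<open>Supplies the edges \<open>uv\<close> outside the component. The first ends lie in
  \<open>U0\<close> and the second ends avoid it, so no vertex serves as \<open>u\<close> in one
  pair and as \<open>v\<close> in another. A maximal independent set \<open>I\<close> works, or else
  its complement: independence sends the edges of \<open>I\<close> out of \<open>I\<close>,
  maximality gives every other vertex a neighbour in \<open>I\<close>, and one of the two sets is at
  least half of \<open>O'\<close>.\<close>

lemma half_with_outside_neighbour:
  assumes "finite O'" and nb: "\<And>u. u \<in> O' \<Longrightarrow> \<exists>v\<in>O'. Upair u v \<in> E"
    and pr: "\<And>u. Upair u u \<notin> E"
  obtains U0 f where "U0 \<subseteq> O'" "card O' \<le> 2 * card U0"
    "\<And>u. u \<in> U0 \<Longrightarrow> f u \<in> O' - U0 \<and> Upair u (f u) \<in> E"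
proof -
  \<comment> \<open>a maximal independent set or its complement\<close>
  define \<I> where "\<I> = {I. I \<subseteq> O' \<and> (\<forall>a\<in>I. \<forall>b\<in>I. Upair a b \<notin> E)}"
  have "finite \<I>" unfolding \<I>_def using assms(1) by simp
  moreover have "{} \<in> \<I>" by (simp add: \<I>_def)
  ultimately obtain I where I: "I \<in> \<I>" "\<And>J. J \<in> \<I> \<Longrightarrow> I \<subseteq> J \<Longrightarrow> I = J"
    using finite_has_maximal2[of \<I> "{}"] by blast
  have IO: "I \<subseteq> O'" using I by (simp add: \<I>_def)
  have 1: "\<exists>v\<in>O' - I. Upair u v \<in> E" if "u \<in> I" for u
    using nb[of u] that I(1) unfolding \<I>_def by blast
  have 2: "\<exists>v\<in>I. Upair u v \<in> E" if "u \<in> O' - I" for u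
  proof (rule ccontr)
    assume c: "\<not> ?thesis"
    have "Upair v u \<notin> E" if "v \<in> I" for v using c that by (metis Upair_inject)
    then have "insert u I \<in> \<I>" using c that I(1) pr unfolding \<I>_def by blast
    then show False using I(2)[of "insert u I"] that by blast
  qed
  have c: "card O' = card I + card (O' - I)"
    using IO assms(1) by (metis add_diff_inverse_nat card_Diff_subset card_mono finite_subset not_less)
  show thesis
  proof (cases "card O' \<le> 2 * card I")
    case True
    obtain f where "\<And>u. u \<in> I \<Longrightarrow> f u \<in> O' - I \<and> Upair u (f u) \<in> E" using 1 by metis
    then show ?thesis using that[of I f] True IO by blast
  next
    case False
    obtain f where "\<And>u. u \<in> O' - I \<Longrightarrow> f u \<in> I \<and> Upair u (f u) \<in> E" using 2 by metis
    then show ?thesis using that[of "O' - I" f] False c IO by fastforce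
  qed
qed

lemma card_neighbour_pairs_le:
  assumes "finite E"
  shows "finite {(x, y'). y' = y \<and> Upair x y' \<in> E} \<and> card {(x, y'). y' = y \<and> Upair x y' \<in> E} \<le> edge_degree E y"
proof -
  have inj: "inj_on (\<lambda>(x, y). Upair x y) {(x, y'). y' = y \<and> Upair x y' \<in> E}"
    by (auto simp: inj_on_def)
  have sub: "(\<lambda>(x, y). Upair x y) ` {(x, y'). y' = y \<and> Upair x y' \<in> E} \<subseteq> {e \<in> E. y \<in> set_uprod e}"
    by auto
  have fin: "finite {e \<in> E. y \<in> set_uprod e}" using assms by simp
  show ?thesis unfolding edge_degree_def
    using inj_on_finite[OF inj sub fin] card_inj_on_le[OF inj sub fin] by blast
qed

lemma finite_oriented: "finite E \<Longrightarrow> finite {(x, y). Upair x y \<in> E}"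
proof (rule finite_subset)
  assume "finite E"
  have "a \<in> (\<Union>e\<in>E. set_uprod e)" "b \<in> (\<Union>e\<in>E. set_uprod e)" if "Upair a b \<in> E" for a b
    using that by (auto intro: bexI[of _ "Upair a b"])
  then show "{(x, y). Upair x y \<in> E} \<subseteq> (\<Union>e\<in>E. set_uprod e) \<times> (\<Union>e\<in>E. set_uprod e)"
    by blast
  show "finite ((\<Union>e\<in>E. set_uprod e) \<times> (\<Union>e\<in>E. set_uprod e))" using \<open>finite E\<close> by simp
qed

text \<open>
  Distinct tails \<open>y\<close> make the new edges \<open>yv\<close> distinct even if all \<open>v\<close> coincide, so no vertex may
  be the tail of too many edges.
\<close>

lemma light_orientation:
  fixes E0 :: "'a uprod set"
  assumes fin: "finite E0" and pr: "\<And>e. e \<in> E0 \<Longrightarrow> proper_uprod e" and Db: "2 * card E0 \<le> D * b"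
  defines "\<Omega> \<equiv> {(x, y). Upair x y \<in> E0 \<and> edge_degree E0 y \<le> D}"
  shows "card E0 - b ^ 2 \<le> card \<Omega>"
    and "a \<in> \<Omega> \<Longrightarrow> card {c \<in> \<Omega>. snd c = snd a \<or> Upair (fst c) (snd c) = Upair (fst a) (snd a)} \<le> D + 1"
proof -
  define S where "S = (\<Union>e\<in>E0. set_uprod e)"
  \<comment> \<open>The heavy vertices. The degrees add up to at most \<open>2 * card E0\<close>,
    which leaves room for at most \<open>b\<close> of them.\<close>
  define B where "B = {v \<in> S. edge_degree E0 v > D}"
  have finS: "finite S" using fin by (simp add: S_def)
  then have finB: "finite B" by (simp add: B_def)
  have fin\<Omega>: "finite \<Omega>" by (rule finite_subset[OF _ finite_oriented[OF fin]]) (auto simp: \<Omega>_def)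
  have "card B * (D + 1) \<le> (\<Sum>v\<in>B. edge_degree E0 v)"
    using sum_bounded_below[of B "D + 1" "edge_degree E0"] by (simp add: B_def)
  also have "\<dots> = (\<Sum>e\<in>E0. card (B \<inter> set_uprod e))" by (rule incident_count[OF finB fin])
  also have "\<dots> \<le> (\<Sum>e\<in>E0. 2)"
  proof (rule sum_mono)
    fix e assume "e \<in> E0"
    have "card (B \<inter> set_uprod e) \<le> card (set_uprod e)" by (intro card_mono) auto
    also have "\<dots> \<le> 2" by (cases e) (auto simp: card_insert_if)
    finally show "card (B \<inter> set_uprod e) \<le> 2" .
  qed
  also have "\<dots> \<le> D * b" using Db by simp
  finally have *: "card B * (D + 1) \<le> D * b" .
  have Bb: "card B \<le> b"
  proof (rule ccontr)
    assume "\<not> card B \<le> b"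
    then have "D * b \<le> D * card B" "0 < card B" by simp_all
    moreover have "card B * (D + 1) = D * card B + card B" by simp
    ultimately show False using * by linarith
  qed
  \<comment> \<open>Only an edge with two heavy ends cannot be oriented towards a light one. These
    edges are pairs from \<open>B\<close>, so there are at most \<open>b ^ 2\<close>.\<close>
  define EB where "EB = {e \<in> E0. set_uprod e \<subseteq> B}"
  have "EB \<subseteq> (\<lambda>(x, y). Upair x y) ` (B \<times> B)"
  proof
    fix e assume "e \<in> EB"
    moreover obtain x y where "e = Upair x y" by (cases e)
    ultimately have "(x, y) \<in> B \<times> B" "e = (\<lambda>(x, y). Upair x y) (x, y)" by (auto simp: EB_def)
    then show "e \<in> (\<lambda>(x, y). Upair x y) ` (B \<times> B)" by (rule rev_image_eqI)
  qed
  then have "card EB \<le> card (B \<times> B)"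
    using finB by (meson card_image_le card_mono finite_SigmaI finite_imageI le_trans)
  also have "\<dots> \<le> b ^ 2" using Bb by (simp add: card_cartesian_product power2_eq_square mult_le_mono)
  finally have EB: "card EB \<le> b ^ 2" .
  have "E0 - EB \<subseteq> (\<lambda>(x, y). Upair x y) ` \<Omega>"
  proof
    fix e assume e: "e \<in> E0 - EB"
    obtain x y where xy: "e = Upair x y" by (cases e)
    have "x \<in> S" "y \<in> S" using e xy by (auto simp: S_def intro: bexI[of _ e])
    then consider "edge_degree E0 x \<le> D" | "edge_degree E0 y \<le> D"
      using e xy by (force simp: EB_def B_def not_less)
    then show "e \<in> (\<lambda>(x, y). Upair x y) ` \<Omega>"
    proof cases
      case 1
      have "e = Upair y x" using xy by simp
      then have "(y, x) \<in> \<Omega>" using 1 e by (auto simp: \<Omega>_def)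
      then show ?thesis using \<open>e = Upair y x\<close> by (auto intro: rev_image_eqI)
    next
      case 2
      then have "(x, y) \<in> \<Omega>" using xy e by (auto simp: \<Omega>_def)
      then show ?thesis using xy by (auto intro: rev_image_eqI)
    qed
  qed
  then have "card (E0 - EB) \<le> card \<Omega>"
    using fin\<Omega> by (meson card_image_le card_mono finite_imageI le_trans)
  moreover have "card E0 - card EB \<le> card (E0 - EB)"
    using fin by (intro diff_card_le_card_Diff) (simp add: EB_def)
  ultimately show "card E0 - b ^ 2 \<le> card \<Omega>" using EB by linarith
  assume a: "a \<in> \<Omega>"
  let ?P = "{(x, y'). y' = snd a \<and> Upair x y' \<in> E0}"
  \<comment> \<open>A conflict is either a pair with the same light tail, of which there are at most
    \<open>D\<close>, or the reversal of \<open>a\<close> itself.\<close>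
  have "{c \<in> \<Omega>. snd c = snd a \<or> Upair (fst c) (snd c) = Upair (fst a) (snd a)} \<subseteq> insert (snd a, fst a) ?P"
    by (auto simp: \<Omega>_def prod_eq_iff)
  then have "card {c \<in> \<Omega>. snd c = snd a \<or> Upair (fst c) (snd c) = Upair (fst a) (snd a)} \<le>
      card (insert (snd a, fst a) ?P)"
    using card_neighbour_pairs_le[OF fin, of "snd a"] by (intro card_mono) simp_all
  also have "\<dots> \<le> card ?P + 1" using card_neighbour_pairs_le[OF fin, of "snd a"] by (simp add: card_insert_if)
  also have "card ?P \<le> D" using card_neighbour_pairs_le[OF fin, of "snd a"] a
    by (auto simp: \<Omega>_def split_beta)
  finally show "card {c \<in> \<Omega>. snd c = snd a \<or> Upair (fst c) (snd c) = Upair (fst a) (snd a)} \<le> D + 1" by simp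
qed

section \<open>Many vertices of degree other than 2\<close>

lemma distinct_map_sorted_wrt:
  assumes "sorted_wrt P xs" "\<And>a b. a \<in> set xs \<Longrightarrow> b \<in> set xs \<Longrightarrow> P a b \<Longrightarrow> f a \<noteq> f b"
  shows "distinct (map f xs)"
  using assms by (induction xs) auto

lemma distinct_map_refine:
  assumes "distinct (map g xs)" "\<And>a b. a \<in> set xs \<Longrightarrow> b \<in> set xs \<Longrightarrow> f a = f b \<Longrightarrow> g a = g b"
  shows "distinct (map f xs)"
  using assms unfolding distinct_map inj_on_def by blast

lemma card_zip_lists:
  assumes "finite A" "finite B" "\<And>xs. xs \<in> A \<Longrightarrow> length xs = r" "\<And>xs. xs \<in> B \<Longrightarrow> length xs = r"
  shows "card ((\<lambda>(xs, ys). zip xs ys) ` (A \<times> B)) = card A * card B"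
proof -
  have "inj_on (\<lambda>(xs, ys). zip xs ys) (A \<times> B)"
  proof (rule inj_on_inverseI)
    show "(\<lambda>zs. (map fst zs, map snd zs)) ((\<lambda>(xs, ys). zip xs ys) p) = p" if "p \<in> A \<times> B" for p
      using that assms(3)[of "fst p"] assms(4)[of "snd p"] by (cases p) simp
  qed
  then show ?thesis by (simp add: card_image card_cartesian_product)
qed

text \<open>Reduces a switching to separate conditions on the two lists. The edges \<open>xu\<close>
  are told apart by their ends \<open>u\<close>. The edges \<open>yv\<close> are told apart either
  by \<open>y\<close>, as in the dense case, or by \<open>v\<close>, as in the sparse case. An edge
  \<open>xu\<close> differs from every \<open>yv'\<close> because \<open>u\<close> never equals
  \<open>v'\<close>.\<close>

lemma zip_switchable:
  assumes len: "length ks = r" "length os = r"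
    and ks: "\<And>x y. (x, y) \<in> set ks \<Longrightarrow> x \<in> U \<and> y \<in> U \<and> Upair x y \<in> E"
    and os: "\<And>u v. (u, v) \<in> set os \<Longrightarrow> u \<notin> U \<and> v \<notin> U \<and> Upair u v \<in> E"
    and dk: "distinct (map (\<lambda>(x, y). Upair x y) ks)" and do: "distinct (map fst os)"
    and dkv: "distinct (map snd ks) \<or> distinct (map snd os)"
    and uv: "\<And>u v u' v'. (u, v) \<in> set os \<Longrightarrow> (u', v') \<in> set os \<Longrightarrow> u \<noteq> v'"
  shows "switchable E U (zip ks os)"
proof -
  let ?ts = "zip ks os"
  have mem: "(x, y) \<in> set ks" "(u, v) \<in> set os" if "((x, y), (u, v)) \<in> set ?ts" for x y u v
    using that by (auto dest: set_zip_leftD set_zip_rightD)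
  have st: "straddles U ?ts" unfolding straddles_def using mem ks os by fast
  have 1: "map old1 ?ts = map (\<lambda>(x, y). Upair x y) ks"
  proof -
    have "map old1 ?ts = map (\<lambda>(x, y). Upair x y) (map fst ?ts)" by auto
    then show ?thesis using len by simp
  qed
  have 2: "map old2 ?ts = map (\<lambda>(u, v). Upair u v) os"
  proof -
    have "map old2 ?ts = map (\<lambda>(u, v). Upair u v) (map snd ?ts)" by auto
    then show ?thesis using len by simp
  qed
  have dfo: "distinct (map (\<lambda>q. fst (snd q)) ?ts)"
  proof -
    have "map (\<lambda>q. fst (snd q)) ?ts = map fst (map snd ?ts)" by simp
    then show ?thesis using len do by simp
  qed
  have n1: "distinct (map new1 ?ts)"
  proof (rule distinct_map_refine[OF dfo])
    fix q q' assume q: "q \<in> set ?ts" "q' \<in> set ?ts" "new1 q = new1 q'"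
    obtain x y u v x' y' u' v' where "q = ((x, y), (u, v))" "q' = ((x', y'), (u', v'))" by (metis surj_pair)
    with q straddlesD[OF st, of x y u v] straddlesD[OF st, of x' y' u' v'] show "fst (snd q) = fst (snd q')" by auto
  qed
  have new2: "snd (fst q) = snd (fst q') \<and> snd (snd q) = snd (snd q')"
    if q: "q \<in> set ?ts" "q' \<in> set ?ts" "new2 q = new2 q'" for q q'
  proof -
    obtain x y u v x' y' u' v' where "q = ((x, y), (u, v))" "q' = ((x', y'), (u', v'))" by (metis surj_pair)
    with q straddlesD[OF st, of x y u v] straddlesD[OF st, of x' y' u' v'] show ?thesis by auto
  qed
  have n2: "distinct (map new2 ?ts)"
    using dkv
  proof
    assume d: "distinct (map snd ks)"
    have "map (\<lambda>q. snd (fst q)) ?ts = map snd (map fst ?ts)" by simp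
    then have "distinct (map (\<lambda>q. snd (fst q)) ?ts)" using d len by simp
    then show ?thesis by (rule distinct_map_refine) (use new2 in blast)
  next
    assume d: "distinct (map snd os)"
    have "map (\<lambda>q. snd (snd q)) ?ts = map snd (map snd ?ts)" by simp
    then have "distinct (map (\<lambda>q. snd (snd q)) ?ts)" using d len by simp
    then show ?thesis by (rule distinct_map_refine) (use new2 in blast)
  qed
  have n12: "new1 q \<noteq> new2 q'" if q: "q \<in> set ?ts" "q' \<in> set ?ts" for q q'
  proof -
    obtain x y u v x' y' u' v' where e: "q = ((x, y), (u, v))" "q' = ((x', y'), (u', v'))" by (metis surj_pair)
    have "u \<noteq> v'" using uv mem(2) q e by blast
    with e q straddlesD[OF st, of x y u v] straddlesD[OF st, of x' y' u' v'] show ?thesis by auto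
  qed
  have dO: "distinct (map (\<lambda>(u, v). Upair u v) os)"
    by (rule distinct_map_refine[OF do]) (use uv in auto)
  have "set (map new1 ?ts) \<inter> set (map new2 ?ts) = {}" using n12 unfolding set_map by blast
  moreover have "set (map (\<lambda>(x, y). Upair x y) ks) \<subseteq> E" "set (map (\<lambda>(u, v). Upair u v) os) \<subseteq> E"
    using ks os by auto
  ultimately show ?thesis unfolding switchable_def 1 2 distinct_append
    using st dk dO n1 n2 by blast
qed

text \<open>Half the degree sum of \<open>U\<close> is its number of edges, at least
  \<open>e0 + k\<close>; a tree of at most \<open>k\<close> edges is set aside and \<open>e0\<close>
  edges remain for switching. Since the tree survives, \<open>U\<close> can be explored from any of
  its vertices \<open>z'\<close>, which the later count over all half-edges of \<open>U\<close>
  exploits.\<close>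

lemma dense_lists:
  assumes V: "finite V" and E: "E \<in> degree_graphs V d" and pos: "\<And>v. v \<in> V \<Longrightarrow> 0 < d v"
    and z: "z \<in> V" and U: "U = component_of E z" and k: "card U \<le> k"
    and s: "2 * (e0 + k) \<le> (\<Sum>v\<in>U. d v)"
    and Db: "2 * e0 \<le> D * b" and o: "k + 2 * o' \<le> card V"
  obtains L where "finite L" "(e0 - b\<^sup>2 - r * (D + 1)) ^ r * (o' - r) ^ r \<le> card L"
    "\<And>ts. ts \<in> L \<Longrightarrow> length ts = r \<and> switchable E U ts"
    "\<And>ts z'. ts \<in> L \<Longrightarrow> z' \<in> U \<Longrightarrow> U \<in> explored_sets (switch E ts) {z'} k (2 * r)"
proof -
  have finE: "finite E" by (rule finite_degree_graph[OF V E])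
  have pr: "proper_uprod e" "set_uprod e \<subseteq> V" if "e \<in> E" for e
    using E that by (auto simp: degree_graphs_def)
  have deg: "edge_degree E v = d v" if "v \<in> V" for v using E that by (simp add: degree_graphs_def)
  have cl: "edge_closed E U" unfolding U by (rule edge_closed_component_of)
  have UV: "U \<subseteq> V" unfolding U using pr z by (intro component_of_subset) auto
  have finU: "finite U" by (rule finite_subset[OF UV V])
  obtain T where T: "T \<subseteq> E" "finite T" "card T \<le> card U" "\<And>u. u \<in> U \<Longrightarrow> (joined T U)\<^sup>*\<^sup>* z u"
    using spanning_edges[OF finU, of E z] component_of_joined unfolding U by metis
  define EU where "EU = {e \<in> E. set_uprod e \<subseteq> U}"
  have "(\<Sum>v\<in>U. d v) = (\<Sum>v\<in>U. edge_degree E v)" using UV deg by (intro sum.cong) auto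
  also have "\<dots> = (\<Sum>e\<in>E. card (U \<inter> set_uprod e))" by (rule incident_count[OF finU finE])
  also have "\<dots> = (\<Sum>e\<in>EU. card (U \<inter> set_uprod e))"
  proof (rule sum.mono_neutral_right)
    show "\<forall>e\<in>E - EU. card (U \<inter> set_uprod e) = 0"
    proof
      fix e assume e: "e \<in> E - EU"
      obtain a b where ab: "e = Upair a b" by (cases e)
      then have "a \<in> U \<longleftrightarrow> b \<in> U" using edge_closed_sym[OF cl] e by auto
      then show "card (U \<inter> set_uprod e) = 0" using e ab by (auto simp: EU_def)
    qed
  qed (use finE in \<open>auto simp: EU_def\<close>)
  also have "\<dots> \<le> (\<Sum>e\<in>EU. 2)"
  proof (rule sum_mono)
    fix e assume "e \<in> EU"
    have "card (U \<inter> set_uprod e) \<le> card (set_uprod e)" by (intro card_mono) auto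
    also have "\<dots> \<le> 2" by (cases e) (auto simp: card_insert_if)
    finally show "card (U \<inter> set_uprod e) \<le> 2" .
  qed
  finally have "e0 + k \<le> card EU" using s by simp
  moreover have "card EU - card T \<le> card (EU - T)" by (rule diff_card_le_card_Diff[OF T(2)])
  ultimately have "e0 \<le> card (EU - T)" using T(3) k by linarith
  \<comment> \<open>The number of edges is trimmed to exactly \<open>e0\<close>, because
    \<open>Db\<close> fixes \<open>D\<close> and \<open>b\<close> relative to
    \<open>e0\<close>.\<close>
  then obtain E0 where E0: "E0 \<subseteq> EU - T" "card E0 = e0" "finite E0" by (rule obtain_subset_with_card_n)
  define \<Omega>K where "\<Omega>K = {(x, y). Upair x y \<in> E0 \<and> edge_degree E0 y \<le> D}"
  define cK where "cK c a \<longleftrightarrow> snd c = snd a \<or> Upair (fst c) (snd c) = Upair (fst a) (snd a)" for c a :: "'a \<times> 'a"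
  have prE0: "\<And>e. e \<in> E0 \<Longrightarrow> proper_uprod e" using E0 pr by (auto simp: EU_def)
  have \<Omega>K: "e0 - b\<^sup>2 \<le> card \<Omega>K" "\<And>a. a \<in> \<Omega>K \<Longrightarrow> card {c \<in> \<Omega>K. cK c a} \<le> D + 1"
    using light_orientation[OF E0(3) prE0, of D b] Db E0(2) unfolding \<Omega>K_def cK_def by auto
  have fin\<Omega>K: "finite \<Omega>K" by (rule finite_subset[OF _ finite_oriented[OF E0(3)]]) (auto simp: \<Omega>K_def)
  obtain U0 f where U0: "U0 \<subseteq> V - U" "card (V - U) \<le> 2 * card U0"
    "\<And>u. u \<in> U0 \<Longrightarrow> f u \<in> (V - U) - U0 \<and> Upair u (f u) \<in> E"
  proof (rule half_with_outside_neighbour[of "V - U" E])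
    show "\<exists>v\<in>V - U. Upair u v \<in> E" if u: "u \<in> V - U" for u
    proof -
      have "card {e \<in> E. u \<in> set_uprod e} \<noteq> 0" using pos[of u] deg[of u] u by (simp add: edge_degree_def)
      then obtain e where e: "e \<in> E" "u \<in> set_uprod e" by (metis (mono_tags, lifting) card.empty empty_Collect_eq)
      obtain a b where "e = Upair a b" by (cases e)
      then obtain v where v: "e = Upair u v" using e by auto
      then have "v \<in> V" "v \<notin> U" using pr(2)[OF e(1)] edge_closed_sym[OF cl, of u v] e(1) u by auto
      then show ?thesis using v e(1) by auto
    qed
    show "Upair u u \<notin> E" for u using pr(1)[of "Upair u u"] by auto
  qed (use V in auto)
  have finU0: "finite U0" using U0(1) V by (meson finite_Diff finite_subset)
  have oU0: "o' \<le> card U0"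
  proof -
    have "card V - card U \<le> card (V - U)" by (rule diff_card_le_card_Diff[OF finU])
    then show ?thesis using U0(2) o k by linarith
  qed
  define \<Omega>O where "\<Omega>O = (\<lambda>u. (u, f u)) ` U0"
  have card\<Omega>O: "card \<Omega>O = card U0" unfolding \<Omega>O_def by (rule card_image) (auto simp: inj_on_def)
  have fin\<Omega>O: "finite \<Omega>O" using finU0 by (simp add: \<Omega>O_def)
  have cO: "card {c \<in> \<Omega>O. fst c = fst a} \<le> 1" for a
  proof -
    have "{c \<in> \<Omega>O. fst c = fst a} \<subseteq> {(fst a, f (fst a))}" by (auto simp: \<Omega>O_def)
    then have "card {c \<in> \<Omega>O. fst c = fst a} \<le> card {(fst a, f (fst a))}" by (rule card_mono[rotated]) simp
    then show ?thesis by simp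
  qed
  define LK where "LK = {xs. length xs = r \<and> set xs \<subseteq> \<Omega>K \<and> sorted_wrt (\<lambda>a b. \<not> cK a b) xs}"
  define LO where "LO = {xs. length xs = r \<and> set xs \<subseteq> \<Omega>O \<and> sorted_wrt (\<lambda>a b. \<not> fst a = fst b) xs}"
  have finL: "finite LK" "finite LO"
    unfolding LK_def LO_def
    by (rule finite_subset[OF _ finite_lists_length_eq[OF fin\<Omega>K, of r]], blast)
      (rule finite_subset[OF _ finite_lists_length_eq[OF fin\<Omega>O, of r]], blast)
  have LK: "(e0 - b\<^sup>2 - r * (D + 1)) ^ r \<le> card LK"
  proof -
    have "(e0 - b\<^sup>2 - r * (D + 1)) ^ r \<le> (card \<Omega>K - r * (D + 1)) ^ r"
      using \<Omega>K(1) by (intro power_mono diff_le_mono) auto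
    also have "\<dots> \<le> card LK" unfolding LK_def by (rule card_pairwise_lists[OF fin\<Omega>K \<Omega>K(2)])
    finally show ?thesis .
  qed
  have LO: "(o' - r) ^ r \<le> card LO"
  proof -
    have "(o' - r) ^ r \<le> (card \<Omega>O - r * 1) ^ r" using oU0 card\<Omega>O by (intro power_mono) auto
    also have "\<dots> \<le> card LO" unfolding LO_def by (rule card_pairwise_lists[OF fin\<Omega>O cO])
    finally show ?thesis .
  qed
  define L where "L = (\<lambda>(xs, ys). zip xs ys) ` (LK \<times> LO)"
  have sw: "length ts = r \<and> switchable E U ts \<and> set (map old1 ts) \<subseteq> E0" if "ts \<in> L" for ts
  proof -
    obtain ks os where t: "ts = zip ks os" "ks \<in> LK" "os \<in> LO" using \<open>ts \<in> L\<close> by (auto simp: L_def)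
    have len: "length ks = r" "length os = r" using t by (auto simp: LK_def LO_def)
    have ks: "Upair x y \<in> E0" if "(x, y) \<in> set ks" for x y
      using that t by (auto simp: LK_def \<Omega>K_def)
    have os: "u \<in> U0 \<and> v = f u" if "(u, v) \<in> set os" for u v
      using that t by (auto simp: LO_def \<Omega>O_def)
    have "switchable E U (zip ks os)"
    proof (rule zip_switchable[OF len])
      show "x \<in> U \<and> y \<in> U \<and> Upair x y \<in> E" if "(x, y) \<in> set ks" for x y
      proof -
        have "Upair x y \<in> EU" using ks[OF that] E0 by auto
        then show ?thesis by (auto simp: EU_def)
      qed
      show "u \<notin> U \<and> v \<notin> U \<and> Upair u v \<in> E" if "(u, v) \<in> set os" for u v
        using os[OF that] U0(1,3) by auto
      show "distinct (map (\<lambda>(x, y). Upair x y) ks)"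
        by (rule distinct_map_sorted_wrt[of "\<lambda>a b. \<not> cK a b"])
          (use t in \<open>auto simp: LK_def cK_def split_beta\<close>)
      show "distinct (map fst os)"
        by (rule distinct_map_sorted_wrt[of "\<lambda>a b. \<not> fst a = fst b"]) (use t in \<open>auto simp: LO_def\<close>)
      have "distinct (map snd ks)"
        by (rule distinct_map_sorted_wrt[of "\<lambda>a b. \<not> cK a b"]) (use t in \<open>auto simp: LK_def cK_def\<close>)
      then show "distinct (map snd ks) \<or> distinct (map snd os)" by simp
      show "u \<noteq> v'" if "(u, v) \<in> set os" "(u', v') \<in> set os" for u v u' v'
        using os[OF that(1)] os[OF that(2)] U0(3) by auto
    qed
    moreover have "set (map old1 (zip ks os)) \<subseteq> E0"
    proof
      fix e assume "e \<in> set (map old1 (zip ks os))"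
      then obtain x y u v where "((x, y), (u, v)) \<in> set (zip ks os)" "e = Upair x y" by force
      then show "e \<in> E0" using ks set_zip_leftD by metis
    qed
    ultimately show ?thesis using t(1) len by simp
  qed
  show thesis
  proof
    show "finite L" using finL by (simp add: L_def)
    have "card L = card LK * card LO"
      unfolding L_def by (rule card_zip_lists[OF finL, of r]) (auto simp: LK_def LO_def)
    then show "(e0 - b\<^sup>2 - r * (D + 1)) ^ r * (o' - r) ^ r \<le> card L" using LK LO by (simp add: mult_le_mono)
    show "length ts = r \<and> switchable E U ts" if "ts \<in> L" for ts using sw[OF that] by simp
    fix ts z' assume ts: "ts \<in> L" and z': "z' \<in> U"
    have s: "switchable E U ts" and len: "length ts = r" and o1: "set (map old1 ts) \<subseteq> E0" using sw[OF ts] by auto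
    have "card (boundary (switch E ts) U) \<le> 2 * r"
    proof -
      have "card (boundary (switch E ts) U) = card (set (map new1 ts @ map new2 ts))"
        unfolding boundary_switch[OF cl s] by simp
      also have "\<dots> \<le> 2 * r" using card_length[of "map new1 ts @ map new2 ts"] len by simp
      finally show ?thesis .
    qed
    moreover have "spanned_from (switch E ts) {z'} U"
      unfolding spanned_from_def
    proof
      fix u assume u: "u \<in> U"
      have "(joined T U)\<^sup>*\<^sup>* z' u"
        by (rule rtranclp_trans[OF joined_rtranclp_sym]) (rule T(4) z' u)+
      then have "(joined (switch E ts) U)\<^sup>*\<^sup>* z' u"
      proof (rule joined_rtranclp_mono)
        fix x y assume xy: "x \<in> U" "y \<in> U" "Upair x y \<in> T"
        \<comment> \<open>A tree edge is not removed: the removed outer edges have their ends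
          outside \<open>U\<close>, and the removed inner edges lie in \<open>E0\<close>, which
          avoids \<open>T\<close>.\<close>
        have "Upair x y \<notin> set (map old2 ts)"
        proof
          assume "Upair x y \<in> set (map old2 ts)"
          then obtain x' y' u' v' where q: "((x', y'), (u', v')) \<in> set ts" "Upair x y = Upair u' v'" by force
          then show False using straddlesD[of U ts x' y' u' v'] s xy by (auto simp: switchable_def)
        qed
        moreover have "Upair x y \<notin> set (map old1 ts)" using o1 E0(1) xy(3) by blast
        ultimately show "Upair x y \<in> switch E ts" using T(1) xy(3) unfolding switch_def by blast
      qed simp
      then show "\<exists>w\<in>{z'}. (joined (switch E ts) U)\<^sup>*\<^sup>* w u" by simp
    qed
    moreover have "card (U - {z'}) \<le> k" using k finU by (meson Diff_subset card_mono le_trans)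
    ultimately show "U \<in> explored_sets (switch E ts) {z'} k (2 * r)"
      using z' finU by (simp add: explored_sets_def)
  qed
qed

text \<open>Once \<open>U\<close> is known, the end of a new edge inside \<open>U\<close> is told
  from the one outside, so the two lists of unordered edges give back all four vertices of every
  pair.\<close>

lemma new_lists_inj:
  "inj_on (\<lambda>ts. map new1 ts @ map new2 ts) {ts. length ts = r \<and> straddles U ts}"
proof (rule inj_onI)
  fix ts ts' assume a: "ts \<in> {ts. length ts = r \<and> straddles U ts}" "ts' \<in> {ts. length ts = r \<and> straddles U ts}"
    "map new1 ts @ map new2 ts = map new1 ts' @ map new2 ts'"
  then have 1: "map new1 ts = map new1 ts'" "map new2 ts = map new2 ts'" by auto
  show "ts = ts'"
  proof (rule nth_equalityI)
    show "length ts = length ts'" using a by simp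
    fix i assume i: "i < length ts"
    then have e: "new1 (ts ! i) = new1 (ts' ! i)" "new2 (ts ! i) = new2 (ts' ! i)"
      using 1 a by (metis (mono_tags, lifting) length_map nth_map)+
    obtain x y u v x' y' u' v' where q: "ts ! i = ((x, y), (u, v))" "ts' ! i = ((x', y'), (u', v'))" by (metis surj_pair)
    moreover have "ts ! i \<in> set ts" "ts' ! i \<in> set ts'" using i a by auto
    ultimately show "ts ! i = ts' ! i"
      using e a straddlesD[of U ts x y u v] straddlesD[of U ts' x' y' u' v'] by auto
  qed
qed

text \<open>
  A switching is counted once for every half-edge of its component. Hence guessing the start of the
  exploration among all half-edges costs only a constant factor.
\<close>

lemma dense_switching:
  assumes V: "finite V" and pos: "\<And>v. v \<in> V \<Longrightarrow> 0 < d v" and A: "A \<subseteq> degree_graphs V d"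
    and comp: "\<And>E. E \<in> A \<Longrightarrow> \<exists>z\<in>V. card (component_of E z) \<le> k \<and> s \<le> (\<Sum>v\<in>component_of E z. d v)"
    and s: "2 * (e0 + k) \<le> s" and Db: "2 * e0 \<le> D * b" and o: "k + 2 * o' \<le> card V"
  shows "card A * (s * ((e0 - b\<^sup>2 - r * (D + 1)) ^ r * (o' - r) ^ r)) \<le>
    card (degree_graphs V d) * ((\<Sum>v\<in>V. d v) * (((k + 2 * r) choose (2 * r)) * fact (2 * r)))"
proof -
  let ?F = "(e0 - b\<^sup>2 - r * (D + 1)) ^ r * (o' - r) ^ r"
  define Q where "Q E z L \<longleftrightarrow> z \<in> V \<and> s \<le> (\<Sum>v\<in>component_of E z. d v) \<and> finite L \<and> ?F \<le> card L \<and>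
     (\<forall>ts\<in>L. length ts = r \<and> switchable E (component_of E z) ts \<and>
        (\<forall>z'\<in>component_of E z. component_of E z \<in> explored_sets (switch E ts) {z'} k (2 * r)))" for E z L
  have "\<exists>z L. Q E z L" if E: "E \<in> A" for E
  proof -
    obtain z where z: "z \<in> V" "card (component_of E z) \<le> k" "s \<le> (\<Sum>v\<in>component_of E z. d v)"
      using comp[OF E] by auto
    have sum: "2 * (e0 + k) \<le> (\<Sum>v\<in>component_of E z. d v)" using s z by simp
    have EG: "E \<in> degree_graphs V d" using A E by blast
    show ?thesis
    proof (rule dense_lists[OF V EG pos z(1) refl z(2) sum Db o, of r])
      fix L assume L: "finite L" "?F \<le> card L"
        "\<And>ts. ts \<in> L \<Longrightarrow> length ts = r \<and> switchable E (component_of E z) ts"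
        "\<And>ts z'. ts \<in> L \<Longrightarrow> z' \<in> component_of E z \<Longrightarrow> component_of E z \<in> explored_sets (switch E ts) {z'} k (2 * r)"
      have "Q E z L" unfolding Q_def using z(1,3) L by (intro conjI ballI) blast+
      then show "\<exists>z L. Q E z L" by (intro exI)
    qed
  qed
  then obtain z L where Q: "\<And>E. E \<in> A \<Longrightarrow> Q E (z E) (L E)"
    by metis
  define U where "U E = component_of E (z E)" for E
  have cl: "edge_closed E (U E)" for E unfolding U_def by (rule edge_closed_component_of)
  have UV: "U E \<subseteq> V" if "E \<in> A" for E
    unfolding U_def using A that Q[OF that] by (intro component_of_subset) (auto simp: degree_graphs_def Q_def)
  have U: "s \<le> (\<Sum>v\<in>U E. d v)" "finite (L E)" "?F \<le> card (L E)"
    "\<And>ts. ts \<in> L E \<Longrightarrow> length ts = r \<and> switchable E (U E) ts"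
    "\<And>ts z'. ts \<in> L E \<Longrightarrow> z' \<in> U E \<Longrightarrow> U E \<in> explored_sets (switch E ts) {z'} k (2 * r)" if "E \<in> A" for E
    using Q[OF that] unfolding U_def Q_def by blast+
  \<comment> \<open>Half-edges rather than vertices: \<open>U\<close> may contain only a small share
    of the vertices, but it has at least \<open>s\<close> half-edges, to be compared with the total
    \<open>(\<Sum>v\<in>V. d v)\<close>.\<close>
  define R where "R S = Sigma S (\<lambda>v. {..<d v})" for S
  have cardR: "finite S \<Longrightarrow> card (R S) = (\<Sum>v\<in>S. d v)" "finite S \<Longrightarrow> finite (R S)" for S
    by (simp_all add: R_def)
  \<comment> \<open>An order of the boundary of \<open>W\<close> determines the list: its first half
    is read as the edges \<open>xu\<close>, its second half as the edges \<open>yv\<close> in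
    matching order. This gives the factor \<open>fact (2 * r)\<close>.\<close>
  define code where "code E' W = {ts. length ts = r \<and> straddles W ts \<and>
     map new1 ts @ map new2 ts \<in> permutations_of_set (boundary E' W) \<and> card (boundary E' W) = 2 * r}" for E' and W :: "'a set"
  have code: "finite (code E' W) \<and> card (code E' W) \<le> fact (2 * r)" for E' W
  proof (cases "finite (boundary E' W) \<and> card (boundary E' W) = 2 * r")
    case True
    have inj: "inj_on (\<lambda>ts. map new1 ts @ map new2 ts) (code E' W)"
      by (rule inj_on_subset[OF new_lists_inj[of r W]]) (auto simp: code_def)
    have im: "(\<lambda>ts. map new1 ts @ map new2 ts) ` code E' W \<subseteq> permutations_of_set (boundary E' W)"
      by (auto simp: code_def)
    show ?thesis
      using inj_on_finite[OF inj im] card_inj_on_le[OF inj im] True by simp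
  next
    case False
    \<comment> \<open>What is left is an infinite boundary. It has \<open>card\<close> 0, which
      equals \<open>2 * r\<close> only if \<open>r = 0\<close>, and then the list is empty.\<close>
    have "code E' W \<subseteq> {[]}"
    proof
      fix ts assume "ts \<in> code E' W"
      then have "card (boundary E' W) = 2 * r" "length ts = r" by (simp_all add: code_def)
      moreover from this have "r = 0" using False card_ge_0_finite[of "boundary E' W"] by (cases r) auto
      ultimately show "ts \<in> {[]}" by simp
    qed
    then have "finite (code E' W)" "card (code E' W) \<le> card {[] :: 'a edge_pair list}"
      by (simp_all only: finite_subset card_mono finite.emptyI finite.insertI)
    moreover have "card {[] :: 'a edge_pair list} \<le> fact (2 * r)" using fact_ge_1[of "2 * r", where 'a = nat] by simp
    ultimately show ?thesis by (blast intro: le_trans)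
  qed
  \<comment> \<open>A candidate consists of a half-edge of the whole graph, a set explored from its
    vertex, and an order of the boundary of that set.\<close>
  define C where "C E' = Sigma (R V) (\<lambda>q. \<Union>W\<in>explored_sets E' {fst q} k (2 * r). code E' W)" for E'
  show ?thesis
  proof (rule switching_count[where T = "\<lambda>E. R (U E) \<times> L E" and f = "\<lambda>E t. switch E (snd t)" and C = C])
    show "finite A" using A finite_degree_graphs[OF V] finite_subset by blast
    show "finite (degree_graphs V d)" by (rule finite_degree_graphs[OF V])
    show "finite (R (U E) \<times> L E) \<and> s * ?F \<le> card (R (U E) \<times> L E)" if "E \<in> A" for E
    proof -
      have "finite (U E)" using UV[OF that] V finite_subset by blast
      then show ?thesis using U[OF that] cardR by (simp add: card_cartesian_product mult_le_mono)
    qed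
    show "switch E (snd t) \<in> degree_graphs V d \<and> t \<in> C (switch E (snd t))"
      if E: "E \<in> A" and t: "t \<in> R (U E) \<times> L E" for E t
    proof
      obtain q ts where q: "t = (q, ts)" "q \<in> R (U E)" "ts \<in> L E" using t by auto
      have sw: "switchable E (U E) ts" "length ts = r" using U(4)[OF E q(3)] by auto
      show "switch E (snd t) \<in> degree_graphs V d"
        using switch_degree_graphs[OF _ V cl sw(1)] A E q by auto
      have qU: "fst q \<in> U E" and qR: "q \<in> R V" using q(2) UV[OF E] by (auto simp: R_def)
      have ex: "U E \<in> explored_sets (switch E ts) {fst q} k (2 * r)" by (rule U(5)[OF E q(3) qU])
      have cd: "ts \<in> code (switch E ts) (U E)"
      proof -
        have b: "boundary (switch E ts) (U E) = set (map new1 ts @ map new2 ts)"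
          using boundary_switch[OF cl sw(1)] by simp
        have dist: "distinct (map new1 ts @ map new2 ts)" using sw(1) unfolding switchable_def by blast
        have "straddles (U E) ts" using sw(1) unfolding switchable_def by blast
        moreover have "map new1 ts @ map new2 ts \<in> permutations_of_set (set (map new1 ts @ map new2 ts))"
          by (rule permutations_of_setI[OF refl dist])
        moreover have "card (set (map new1 ts @ map new2 ts)) = 2 * r"
          using distinct_card[OF dist] sw(2) by simp
        ultimately show ?thesis unfolding code_def b using sw(2) by blast
      qed
      show "t \<in> C (switch E (snd t))" unfolding C_def q(1) snd_conv by (rule SigmaI[OF qR], rule UN_I[OF ex], rule cd)
    qed
    show "E = E'" if "E \<in> A" "E' \<in> A" "t \<in> R (U E) \<times> L E" "t \<in> R (U E') \<times> L E'" "switch E (snd t) = switch E' (snd t)" for E E' t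
    proof -
      have "snd t \<in> L E" "snd t \<in> L E'" using that(3,4) by auto
      then have "switchable E (U E) (snd t)" "switchable E' (U E') (snd t)" using U(4) that(1,2) by blast+
      then show ?thesis using switch_inj[OF cl _ cl _ that(5)] by blast
    qed
    fix E' assume "E' \<in> degree_graphs V d"
    then have finE': "finite E'" by (rule finite_degree_graph[OF V])
    have bound: "finite (\<Union>W\<in>explored_sets E' {v} k (2 * r). code E' W) \<and>
        card (\<Union>W\<in>explored_sets E' {v} k (2 * r). code E' W) \<le> ((k + 2 * r) choose (2 * r)) * fact (2 * r)" for v
    proof -
      have ex: "finite (explored_sets E' {v} k (2 * r))" "card (explored_sets E' {v} k (2 * r)) \<le> (k + 2 * r) choose (2 * r)"
        using card_explored_sets[OF finE'] by auto
      have "card (\<Union>W\<in>explored_sets E' {v} k (2 * r). code E' W) \<le> (\<Sum>W\<in>explored_sets E' {v} k (2 * r). card (code E' W))"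
        by (rule card_UN_le[OF ex(1)])
      also have "\<dots> \<le> (\<Sum>W\<in>explored_sets E' {v} k (2 * r). fact (2 * r))"
        by (intro sum_mono code[THEN conjunct2])
      also have "\<dots> \<le> ((k + 2 * r) choose (2 * r)) * fact (2 * r)" 
        unfolding sum_constant of_nat_id by (rule mult_le_mono1[OF ex(2)])
      finally show ?thesis by (intro conjI finite_UN_I ex(1) code[THEN conjunct1])
    qed
    have "card (C E') = (\<Sum>q\<in>R V. card (\<Union>W\<in>explored_sets E' {fst q} k (2 * r). code E' W))"
      unfolding C_def by (intro card_SigmaI cardR(2)[OF V] ballI bound[THEN conjunct1])
    also have "\<dots> \<le> (\<Sum>q\<in>R V. ((k + 2 * r) choose (2 * r)) * fact (2 * r))"
      by (intro sum_mono bound[THEN conjunct2])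
    also have "\<dots> = (\<Sum>v\<in>V. d v) * (((k + 2 * r) choose (2 * r)) * fact (2 * r))"
      by (simp only: sum_constant cardR(1)[OF V] of_nat_id)
    finally have "card (C E') \<le> (\<Sum>v\<in>V. d v) * (((k + 2 * r) choose (2 * r)) * fact (2 * r))" .
    moreover have "finite (C E')"
      unfolding C_def by (intro finite_SigmaI cardR(2)[OF V] bound[THEN conjunct1])
    ultimately show "finite (C E') \<and> card (C E') \<le> (\<Sum>v\<in>V. d v) * (((k + 2 * r) choose (2 * r)) * fact (2 * r))" by (rule conjI[rotated])
  qed
qed

section \<open>Few vertices of degree other than 2\<close>

text \<open>
  By parity every component of \<open>U - W\<close> sends at least two edges to \<open>W\<close>, so all but one of them,
  and hence at least half, may be removed.
\<close>

lemma removable_edges: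
  assumes V: "finite V" and E: "E \<in> degree_graphs V d" and z: "z \<in> V" and U: "U = component_of E z"
    and W: "W = {v \<in> U. d v \<noteq> 2}" and ne: "W \<noteq> {}"
  obtains X where "X \<subseteq> E" "\<forall>e\<in>X. set_uprod e \<subseteq> U \<and> set_uprod e \<inter> W \<noteq> {}"
    "(\<Sum>w\<in>W. d w) \<le> 4 * card X" "spanned_from (E - X) W U"
proof -
  have finE: "finite E" by (rule finite_degree_graph[OF V E])
  have pr: "proper_uprod e" "set_uprod e \<subseteq> V" if "e \<in> E" for e
    using E that by (auto simp: degree_graphs_def)
  have deg: "edge_degree E v = d v" if "v \<in> V" for v using E that by (simp add: degree_graphs_def)
  have cl: "edge_closed E U" unfolding U by (rule edge_closed_component_of)
  have UV: "U \<subseteq> V" unfolding U using pr z by (intro component_of_subset) auto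
  have finU: "finite U" by (rule finite_subset[OF UV V])
  have WU: "W \<subseteq> U" by (auto simp: W)
  define P where "P = U - W"
  define cp where "cp p = {q. (joined E P)\<^sup>*\<^sup>* p q}" for p
  have cpP: "cp p \<subseteq> P" if "p \<in> P" for p
  proof
    fix q assume "q \<in> cp p"
    then have "(joined E P)\<^sup>*\<^sup>* p q" by (simp add: cp_def)
    then show "q \<in> P" by induction (use that in \<open>auto simp: joined_def\<close>)
  qed
  have cp_eq: "cp p = cp q" if "q \<in> cp p" for p q
    using that joined_rtranclp_sym[of E P p q] unfolding cp_def by (auto intro: rtranclp_trans)
  define B where "B C = {e \<in> E. \<exists>c\<in>C. \<exists>w\<in>W. e = Upair c w}" for C
  have finB: "finite (B C)" for C using finE by (simp add: B_def)
  have B_ne: "B (cp p) \<noteq> {}" if "p \<in> P" for p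
  proof -
    obtain w where w: "w \<in> W" using ne by blast
    \<comment> \<open>A path from \<open>p\<close> to \<open>W\<close> stays in the component of
      \<open>p\<close> until it first enters \<open>W\<close>; the edge by which it enters belongs
      to \<open>B (cp p)\<close>.\<close>
    have "(joined E U)\<^sup>*\<^sup>* p w"
      using component_of_joined2[of p E z w] that w WU unfolding U P_def by blast
    then have "p \<in> P \<longrightarrow> (\<exists>c\<in>cp p. \<exists>w'\<in>W. Upair c w' \<in> E)"
    proof (induction rule: converse_rtranclp_induct)
      case base
      then show ?case using w by (simp add: P_def)
    next
      case (step p q)
      show ?case
      proof (cases "q \<in> W")
        case True
        then show ?thesis using step.hyps(1) by (auto simp: joined_def cp_def)
      next
        case False
        have "q \<in> cp p" if "p \<in> P" using that False step.hyps(1) by (auto simp: cp_def joined_def P_def)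
        moreover have "q \<in> P" using False step.hyps(1) by (auto simp: joined_def P_def)
        ultimately show ?thesis using step.IH cp_eq by metis
      qed
    qed
    then show ?thesis using that by (auto simp: B_def)
  qed
  \<comment> \<open>All vertices of \<open>cp p\<close> have degree 2, so twice their number equals
    twice the number of edges inside plus the number of edges to \<open>W\<close>.\<close>
  have B_even: "even (card (B (cp p)))" if p: "p \<in> P" for p
  proof -
    let ?C = "cp p"
    have CP: "?C \<subseteq> P" by (rule cpP[OF p])
    have finC: "finite ?C" using CP finU by (auto simp: P_def intro: finite_subset)
    define E2 where "E2 = {e \<in> E. set_uprod e \<subseteq> ?C}"
    have cnt: "card (?C \<inter> set_uprod e) = 2 * of_bool (e \<in> E2) + of_bool (e \<in> B ?C)" if e: "e \<in> E" for e
    proof -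
      obtain a b where ab: "e = Upair a b" "a \<noteq> b" using pr(1)[OF e] by (cases e) auto
      have step: "b' \<in> W \<or> b' \<in> ?C" if "Upair a' b' \<in> E" "a' \<in> ?C" for a' b'
      proof -
        have "a' \<in> P" using that CP by blast
        then have "b' \<in> U" using that(1) cl by (auto simp: edge_closed_def P_def)
        moreover have "b' \<in> ?C" if "b' \<in> P"
        proof -
          have "joined E P a' b'" using \<open>a' \<in> P\<close> that \<open>Upair a' b' \<in> E\<close> by (simp add: joined_def)
          then show ?thesis using \<open>a' \<in> ?C\<close> unfolding cp_def by (auto intro: rtranclp.rtrancl_into_rtrancl)
        qed
        ultimately show ?thesis by (auto simp: P_def)
      qed
      have disj: "c \<notin> W" if "c \<in> ?C" for c using that CP by (auto simp: P_def)
      have eB: "e \<in> B ?C \<longleftrightarrow> (a \<in> ?C \<and> b \<in> W) \<or> (b \<in> ?C \<and> a \<in> W)" using e ab by (auto simp: B_def)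
      have eE2: "e \<in> E2 \<longleftrightarrow> a \<in> ?C \<and> b \<in> ?C" using e ab by (auto simp: E2_def)
      have s: "a \<in> ?C \<Longrightarrow> b \<in> W \<or> b \<in> ?C" "b \<in> ?C \<Longrightarrow> a \<in> W \<or> a \<in> ?C"
      proof -
        have "Upair b a = e" "Upair a b = e" using ab by auto
        then show "a \<in> ?C \<Longrightarrow> b \<in> W \<or> b \<in> ?C" "b \<in> ?C \<Longrightarrow> a \<in> W \<or> a \<in> ?C"
          using step[of a b] step[of b a] e by simp_all
      qed
      have "?C \<inter> set_uprod e = (if a \<in> ?C then {a} else {}) \<union> (if b \<in> ?C then {b} else {})" using ab by auto
      then have "card (?C \<inter> set_uprod e) = of_bool (a \<in> ?C) + of_bool (b \<in> ?C)" using ab by auto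
      then show ?thesis unfolding eB eE2 using s disj by (cases "a \<in> ?C"; cases "b \<in> ?C") auto
    qed
    have "2 * card ?C = (\<Sum>v\<in>?C. edge_degree E v)"
    proof -
      have "(\<Sum>v\<in>?C. edge_degree E v) = (\<Sum>v\<in>?C. 2)"
      proof (rule sum.cong)
        fix v assume "v \<in> ?C"
        then have "v \<in> U" "v \<notin> W" using CP by (auto simp: P_def)
        then show "edge_degree E v = 2" using deg UV by (auto simp: W)
      qed simp
      then show ?thesis by simp
    qed
    also have "\<dots> = (\<Sum>e\<in>E. card (?C \<inter> set_uprod e))" by (rule incident_count[OF finC finE])
    also have "\<dots> = (\<Sum>e\<in>E. 2 * of_bool (e \<in> E2) + of_bool (e \<in> B ?C))" by (rule sum.cong) (simp_all only: cnt)
    also have "\<dots> = 2 * card E2 + card (B ?C)"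
    proof -
      have "(\<Sum>e\<in>E. of_bool (e \<in> B ?C)) = card (B ?C)"
        using finE by (simp add: B_def of_bool_def sum.If_cases Int_def)
      moreover have "(\<Sum>e\<in>E. of_bool (e \<in> E2)) = card E2"
        using finE by (simp add: E2_def of_bool_def sum.If_cases Int_def)
      ultimately show ?thesis by (simp only: sum.distrib flip: sum_distrib_left)
    qed
    finally show ?thesis by presburger
  qed
  define Cs where "Cs = cp ` P"
  have finCs: "finite Cs" using finU by (simp add: Cs_def P_def)
  have B2: "2 \<le> card (B C)" if C: "C \<in> Cs" for C
  proof -
    obtain p where "p \<in> P" "C = cp p" using C by (auto simp: Cs_def)
    then have "even (card (B C))" "card (B C) \<noteq> 0" using B_ne B_even finB by auto
    then show ?thesis by presburger
  qed
  define F where "F = {e \<in> E. set_uprod e \<subseteq> U \<and> set_uprod e \<inter> W \<noteq> {}}"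
  have finF: "finite F" using finE by (simp add: F_def)
  have BF: "B C \<subseteq> F" if "C \<in> Cs" for C
  proof -
    have "C \<subseteq> U" using that cpP by (auto simp: Cs_def P_def)
    then show ?thesis using WU by (auto simp: B_def F_def)
  qed
  have disj: "B C \<inter> B C' = {}" if C: "C \<in> Cs" "C' \<in> Cs" "C \<noteq> C'" for C C'
  proof (rule ccontr)
    assume "\<not> ?thesis"
    then obtain e where e: "e \<in> B C" "e \<in> B C'" by blast
    obtain c w where cw: "c \<in> C" "w \<in> W" "e = Upair c w" using e(1) unfolding B_def by blast
    obtain c' w' where cw': "c' \<in> C'" "w' \<in> W" "e = Upair c' w'" using e(2) unfolding B_def by blast
    obtain p p' where p: "p \<in> P" "C = cp p" "p' \<in> P" "C' = cp p'" using C by (auto simp: Cs_def)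
    have "c \<notin> W" "c' \<notin> W" using cw(1) cw'(1) p cpP by (auto simp: P_def)
    then have "c = c'" using cw cw' by auto
    then have "cp p = cp p'" using cw(1) cw'(1) p cp_eq[of c p] cp_eq[of c p'] by simp
    then show False using p C(3) by simp
  qed
  have CsF: "2 * card Cs \<le> card F"
  proof -
    have "2 * card Cs = (\<Sum>C\<in>Cs. 2)" by simp
    also have "\<dots> \<le> (\<Sum>C\<in>Cs. card (B C))" using B2 by (intro sum_mono) auto
    also have "\<dots> = card (\<Union>C\<in>Cs. B C)" using finCs finB disj by (intro card_UN_disjoint[symmetric]) auto
    also have "\<dots> \<le> card F" using BF by (intro card_mono finF) auto
    finally show ?thesis .
  qed
  have "\<exists>f. \<forall>C\<in>Cs. f C \<in> B C"
  proof (rule bchoice, rule ballI)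
    fix C assume "C \<in> Cs"
    then have "card (B C) \<noteq> 0" using B2[of C] by auto
    then show "\<exists>e. e \<in> B C" by (metis card.empty ex_in_conv)
  qed
  then obtain f where f: "\<And>C. C \<in> Cs \<Longrightarrow> f C \<in> B C" by blast
  \<comment> \<open>Each component of \<open>P\<close> keeps one link to \<open>W\<close>. Edges
    with both ends in \<open>W\<close> are all removed, since exploration starts from the whole of
    \<open>W\<close>. By \<open>CsF\<close> at least half of \<open>F\<close> remains in
    \<open>X\<close>, and the degree sum over \<open>W\<close> is at most \<open>2 * card F\<close>;
    hence the factor 4.\<close>
  define X where "X = F - f ` Cs"
  show thesis
  proof
    show "X \<subseteq> E" by (auto simp: X_def F_def)
    show "\<forall>e\<in>X. set_uprod e \<subseteq> U \<and> set_uprod e \<inter> W \<noteq> {}" by (auto simp: X_def F_def)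
    show "(\<Sum>w\<in>W. d w) \<le> 4 * card X"
    proof -
      have finW: "finite W" using finU WU by (rule finite_subset[rotated])
      have "(\<Sum>w\<in>W. d w) = (\<Sum>w\<in>W. edge_degree E w)" using WU UV deg by (intro sum.cong) auto
      also have "\<dots> = (\<Sum>e\<in>E. card (W \<inter> set_uprod e))" by (rule incident_count[OF finW finE])
      also have "\<dots> = (\<Sum>e\<in>F. card (W \<inter> set_uprod e))"
      proof (rule sum.mono_neutral_right)
        show "\<forall>e\<in>E - F. card (W \<inter> set_uprod e) = 0"
        proof
          fix e assume e: "e \<in> E - F"
          obtain a b where ab: "e = Upair a b" by (cases e)
          have "a \<in> U \<longleftrightarrow> b \<in> U" using edge_closed_sym[OF cl] e ab by auto
          then show "card (W \<inter> set_uprod e) = 0" using e ab WU by (auto simp: F_def)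
        qed
      qed (use finE in \<open>auto simp: F_def\<close>)
      also have "\<dots> \<le> (\<Sum>e\<in>F. 2)"
      proof (rule sum_mono)
        fix e
        have "card (W \<inter> set_uprod e) \<le> card (set_uprod e)" by (intro card_mono) auto
        also have "\<dots> \<le> 2" by (cases e) (auto simp: card_insert_if)
        finally show "card (W \<inter> set_uprod e) \<le> 2" .
      qed
      finally have "(\<Sum>w\<in>W. d w) \<le> 2 * card F" by simp
      moreover have "card F - card (f ` Cs) \<le> card X"
        unfolding X_def using finCs by (intro diff_card_le_card_Diff) auto
      moreover have "card (f ` Cs) \<le> card Cs" by (rule card_image_le[OF finCs])
      ultimately show ?thesis using CsF by linarith
    qed
    show "spanned_from (E - X) W U"
      unfolding spanned_from_def
    proof
      fix u assume u: "u \<in> U"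
      show "\<exists>w\<in>W. (joined (E - X) U)\<^sup>*\<^sup>* w u"
      proof (cases "u \<in> W")
        case False
        then have uP: "u \<in> P" using u by (simp add: P_def)
        then have "f (cp u) \<in> B (cp u)" using f by (simp add: Cs_def)
        then obtain c w where cw: "f (cp u) = Upair c w" "c \<in> cp u" "w \<in> W" "Upair c w \<in> E"
          unfolding B_def by (smt (verit) mem_Collect_eq)
        have "(joined E P)\<^sup>*\<^sup>* u c" using cw(2) by (simp add: cp_def)
        then have "(joined (E - X) U)\<^sup>*\<^sup>* u c"
          by (rule joined_rtranclp_mono) (auto simp: P_def X_def F_def)
        moreover have "joined (E - X) U c w"
        proof -
          have "Upair c w \<in> f ` Cs" using cw(1) uP unfolding Cs_def by (metis imageI)
          then show ?thesis using cw cpP[OF uP] WU by (auto simp: joined_def X_def P_def)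
        qed
        ultimately have "(joined (E - X) U)\<^sup>*\<^sup>* u w" by (rule rtranclp.rtrancl_into_rtrancl)
        then show ?thesis using cw(3) joined_rtranclp_sym by metis
      qed auto
    qed
  qed
qed

section \<open>Choosing and undoing the sparse switchings\<close>

lemma sorted_wrt_pairwise:
  assumes "sorted_wrt P xs" "a \<in> set xs" "b \<in> set xs" shows "a = b \<or> P a b \<or> P b a"
  using assms by (induction xs) auto

lemma edge_degree_le_pairs:
  assumes "finite E"
  shows "edge_degree E u \<le> card {(u', v). u' = u \<and> Upair u' v \<in> E}"
proof -
  have fin: "finite {(u', v). u' = u \<and> Upair u' v \<in> E}"
    by (rule finite_subset[OF _ finite_oriented[OF assms]]) auto
  have "{e \<in> E. u \<in> set_uprod e} \<subseteq> (\<lambda>(x, y). Upair x y) ` {(u', v). u' = u \<and> Upair u' v \<in> E}"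
  proof
    fix e assume e: "e \<in> {e \<in> E. u \<in> set_uprod e}"
    obtain a b where "e = Upair a b" by (cases e)
    then obtain v where "e = Upair u v" using e by auto
    then show "e \<in> (\<lambda>(x, y). Upair x y) ` {(u', v). u' = u \<and> Upair u' v \<in> E}" using e by force
  qed
  then show ?thesis unfolding edge_degree_def
    using fin by (meson card_image_le card_mono finite_imageI le_trans)
qed

lemma card_pairs_fst_le:
  assumes "finite E"
  shows "finite {(u', v). u' = u \<and> Upair u' v \<in> E} \<and> card {(u', v). u' = u \<and> Upair u' v \<in> E} \<le> edge_degree E u"
proof -
  have eq: "{(u', v). u' = u \<and> Upair u' v \<in> E} = prod.swap ` {(x, y'). y' = u \<and> Upair x y' \<in> E}"
  proof -
    have "Upair u v = Upair v u" for v by simp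
    then have "Upair u v \<in> E \<longleftrightarrow> Upair v u \<in> E" for v by metis
    then show ?thesis by (auto simp: image_iff)
  qed
  have le: "card (prod.swap ` {(x, y'). y' = u \<and> Upair x y' \<in> E}) \<le> card {(x, y'). y' = u \<and> Upair x y' \<in> E}"
    using card_neighbour_pairs_le[OF assms] by (intro card_image_le) blast
  note nb = card_neighbour_pairs_le[OF assms, of u]
  show ?thesis unfolding eq by (intro conjI finite_imageI nb[THEN conjunct1] le_trans[OF le nb[THEN conjunct2]])
qed

text \<open>The inner edges come from the removable set and are oriented towards \<open>W\<close>,
  so that every \<open>yv\<close> meets \<open>N\<close>. Many of them may share the same
  \<open>y\<close>; hence it is the outer edges that must make the \<open>yv\<close> distinct. These
  are taken with both ends of degree 2, so that each excludes only boundedly many others.\<close>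

lemma sparse_lists:
  assumes V: "finite V" and E: "E \<in> degree_graphs V d"
    and z: "z \<in> V" and U: "U = component_of E z" and k: "card U \<le> k"
    and N: "N = {v \<in> V. d v \<noteq> 2}" and s: "4 * h \<le> (\<Sum>v\<in>U \<inter> N. d v)" and ne: "U \<inter> N \<noteq> {}"
    and o: "o' + (\<Sum>v\<in>N. d v) + 2 * k + 2 * card N \<le> 2 * card V"
  obtains L where "finite L" "(h - r * 2) ^ r * (o' - r * 8) ^ r \<le> card L"
    "\<And>ts. ts \<in> L \<Longrightarrow> length ts = r \<and> switchable E U ts \<and> (\<forall>q\<in>set ts. set_uprod (new2 q) \<inter> N \<noteq> {}) \<and>
       U \<in> explored_sets (switch E ts - set (map new2 ts)) (U \<inter> N) k r"
proof -
  have finE: "finite E" by (rule finite_degree_graph[OF V E])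
  have pr: "proper_uprod e" "set_uprod e \<subseteq> V" if "e \<in> E" for e
    using E that by (auto simp: degree_graphs_def)
  have deg: "edge_degree E v = d v" if "v \<in> V" for v using E that by (simp add: degree_graphs_def)
  have cl: "edge_closed E U" unfolding U by (rule edge_closed_component_of)
  have UV: "U \<subseteq> V" unfolding U using pr z by (intro component_of_subset) auto
  have finU: "finite U" by (rule finite_subset[OF UV V])
  have finN: "finite N" using V by (simp add: N)
  define W where "W = U \<inter> N"
  have W: "W = {v \<in> U. d v \<noteq> 2}" using UV by (auto simp: W_def N)
  have Wne: "W \<noteq> {}" using ne by (simp add: W_def)
  obtain X where X: "X \<subseteq> E" "\<forall>e\<in>X. set_uprod e \<subseteq> U \<and> set_uprod e \<inter> W \<noteq> {}"
    "(\<Sum>w\<in>W. d w) \<le> 4 * card X" "spanned_from (E - X) W U"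
    by (rule removable_edges[OF V E z U W Wne])
  have finX: "finite X" by (rule finite_subset[OF X(1) finE])
  have hX: "h \<le> card X" using X(3) s by (simp add: W_def)
  define \<Omega>K where "\<Omega>K = {(x, y). Upair x y \<in> X \<and> y \<in> W}"
  define cK where "cK c a \<longleftrightarrow> Upair (fst c) (snd c) = Upair (fst a) (snd a)" for c a :: "'a \<times> 'a"
  have fin\<Omega>K: "finite \<Omega>K" by (rule finite_subset[OF _ finite_oriented[OF finX]]) (auto simp: \<Omega>K_def)
  have "X \<subseteq> (\<lambda>(x, y). Upair x y) ` \<Omega>K"
  proof
    fix e assume e: "e \<in> X"
    obtain a b where ab: "e = Upair a b" by (cases e)
    then have "a \<in> W \<or> b \<in> W" using bspec[OF X(2) e] by auto
    then obtain x y where xy: "e = Upair x y" "y \<in> W" using ab by (metis Upair_inject)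
    then have "(x, y) \<in> \<Omega>K" using e by (simp add: \<Omega>K_def)
    then show "e \<in> (\<lambda>(x, y). Upair x y) ` \<Omega>K" using xy(1) by (auto intro: rev_image_eqI)
  qed
  then have "card X \<le> card \<Omega>K" using fin\<Omega>K by (meson card_image_le card_mono finite_imageI le_trans)
  then have h\<Omega>: "h \<le> card \<Omega>K" using hX by simp
  \<comment> \<open>The two orientations of one edge.\<close>
  have cK: "card {c \<in> \<Omega>K. cK c a} \<le> 2" for a
  proof -
    have "{c \<in> \<Omega>K. cK c a} \<subseteq> {a, (snd a, fst a)}" by (auto simp: cK_def prod_eq_iff)
    then have "card {c \<in> \<Omega>K. cK c a} \<le> card {a, (snd a, fst a)}" by (rule card_mono[rotated]) simp
    also have "\<dots> \<le> 2" by (simp add: card_insert_if)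
    finally show ?thesis .
  qed
  define O2 where "O2 = (V - U) - N"
  have finO2: "finite O2" using V by (simp add: O2_def)
  define \<Omega>O where "\<Omega>O = {(u, v). u \<in> O2 \<and> v \<in> O2 \<and> Upair u v \<in> E}"
  have fin\<Omega>O: "finite \<Omega>O" by (rule finite_subset[OF _ finite_oriented[OF finE]]) (auto simp: \<Omega>O_def)
  have deg2: "edge_degree E v = 2" if "v \<in> O2" for v using that deg by (auto simp: O2_def N)
  have o\<Omega>: "o' \<le> card \<Omega>O"
  proof -
    \<comment> \<open>Every vertex of \<open>O2\<close> contributes two oriented edges. None of them
      leads into \<open>U\<close>, and those leading into \<open>N\<close> are at most the degree
      sum over \<open>N\<close>; the rest lie in \<open>\<Omega>O\<close>.\<close>
    define I where "I = (\<Union>u\<in>O2. {(u', v). u' = u \<and> Upair u' v \<in> E})"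
    define J where "J = (\<Union>y\<in>N. {(x, y'). y' = y \<and> Upair x y' \<in> E})"
    have finI: "finite {(u', v). u' = u \<and> Upair u' v \<in> E}" for u using card_pairs_fst_le[OF finE] by blast
    have "2 * card O2 = (\<Sum>u\<in>O2. 2)" by simp
    also have "\<dots> \<le> (\<Sum>u\<in>O2. card {(u', v). u' = u \<and> Upair u' v \<in> E})"
    proof (rule sum_mono)
      fix u assume "u \<in> O2"
      then show "2 \<le> card {(u', v). u' = u \<and> Upair u' v \<in> E}"
        using deg2[of u] edge_degree_le_pairs[OF finE, of u] by simp
    qed
    also have "\<dots> = card I"
      unfolding I_def using finI by (intro card_UN_disjoint[symmetric] finO2) auto
    finally have I: "2 * card O2 \<le> card I" .
    have finJ: "finite J" using finN card_neighbour_pairs_le[OF finE] by (auto simp: J_def)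
    have "card J \<le> (\<Sum>y\<in>N. card {(x, y'). y' = y \<and> Upair x y' \<in> E})"
      unfolding J_def by (rule card_UN_le[OF finN])
    also have "\<dots> \<le> (\<Sum>y\<in>N. d y)"
    proof (rule sum_mono)
      fix y assume "y \<in> N"
      then show "card {(x, y'). y' = y \<and> Upair x y' \<in> E} \<le> d y"
        using deg[of y] card_neighbour_pairs_le[OF finE, of y] by (simp add: N)
    qed
    finally have J: "card J \<le> (\<Sum>y\<in>N. d y)" .
    have "I \<subseteq> \<Omega>O \<union> J"
    proof
      fix p assume "p \<in> I"
      then obtain u v where p: "p = (u, v)" "u \<in> O2" "Upair u v \<in> E" by (auto simp: I_def)
      have "v \<in> V" "v \<notin> U" using p pr(2)[OF p(3)] edge_closed_sym[OF cl p(3)] by (auto simp: O2_def)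
      then show "p \<in> \<Omega>O \<union> J" using p by (auto simp: \<Omega>O_def J_def O2_def)
    qed
    then have "card I \<le> card (\<Omega>O \<union> J)" using fin\<Omega>O finJ by (intro card_mono) auto
    also have "\<dots> \<le> card \<Omega>O + card J" by (rule card_Un_le)
    finally have "2 * card O2 \<le> card \<Omega>O + (\<Sum>y\<in>N. d y)" using I J by linarith
    moreover have "card V - card U - card N \<le> card O2"
    proof -
      have "card V - card U \<le> card (V - U)" by (rule diff_card_le_card_Diff[OF finU])
      moreover have "card (V - U) - card N \<le> card O2" unfolding O2_def by (rule diff_card_le_card_Diff[OF finN])
      ultimately show ?thesis by linarith
    qed
    ultimately show ?thesis using o k by linarith
  qed
  define cO where "cO c a \<longleftrightarrow> fst c = fst a \<or> fst c = snd a \<or> snd c = fst a \<or> snd c = snd a" for c a :: "'a \<times> 'a"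
  \<comment> \<open>An oriented edge has two ends of degree 2. Each of them starts at most two
    oriented edges and ends at most two, which makes 8.\<close>
  have cO: "card {c \<in> \<Omega>O. cO c a} \<le> 8" if a: "a \<in> \<Omega>O" for a
  proof -
    let ?f = "\<lambda>u. {(u', v). u' = u \<and> Upair u' v \<in> E}" and ?g = "\<lambda>u. {(x, y'). y' = u \<and> Upair x y' \<in> E}"
    have f: "finite (?f u) \<and> card (?f u) \<le> 2" "finite (?g u) \<and> card (?g u) \<le> 2" if "u \<in> O2" for u
      using card_pairs_fst_le[OF finE, of u] card_neighbour_pairs_le[OF finE, of u] deg2[OF that] by auto
    have aO: "fst a \<in> O2" "snd a \<in> O2" using a by (auto simp: \<Omega>O_def)
    let ?S = "(?f (fst a) \<union> ?f (snd a)) \<union> (?g (fst a) \<union> ?g (snd a))"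
    have "{c \<in> \<Omega>O. cO c a} \<subseteq> ?S" by (auto simp: \<Omega>O_def cO_def)
    then have "card {c \<in> \<Omega>O. cO c a} \<le> card ?S" using f aO by (intro card_mono finite_UnI) blast+
    also have "\<dots> \<le> card (?f (fst a) \<union> ?f (snd a)) + card (?g (fst a) \<union> ?g (snd a))" by (rule card_Un_le)
    also have "\<dots> \<le> (card (?f (fst a)) + card (?f (snd a))) + (card (?g (fst a)) + card (?g (snd a)))"
      by (intro add_mono card_Un_le)
    also have "\<dots> \<le> (2 + 2) + (2 + 2)" using f aO by (intro add_mono) blast+
    finally show ?thesis by simp
  qed
  define LK where "LK = {xs. length xs = r \<and> set xs \<subseteq> \<Omega>K \<and> sorted_wrt (\<lambda>a b. \<not> cK a b) xs}"
  define LO where "LO = {xs. length xs = r \<and> set xs \<subseteq> \<Omega>O \<and> sorted_wrt (\<lambda>a b. \<not> cO a b) xs}"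
  have finL: "finite LK" "finite LO"
    unfolding LK_def LO_def
    by (rule finite_subset[OF _ finite_lists_length_eq[OF fin\<Omega>K, of r]], blast)
      (rule finite_subset[OF _ finite_lists_length_eq[OF fin\<Omega>O, of r]], blast)
  have LK: "(h - r * 2) ^ r \<le> card LK"
  proof -
    have "(h - r * 2) ^ r \<le> (card \<Omega>K - r * 2) ^ r"
      using h\<Omega> by (intro power_mono diff_le_mono) auto
    also have "\<dots> \<le> card LK" unfolding LK_def by (rule card_pairwise_lists[OF fin\<Omega>K cK])
    finally show ?thesis .
  qed
  have LO: "(o' - r * 8) ^ r \<le> card LO"
  proof -
    have "(o' - r * 8) ^ r \<le> (card \<Omega>O - r * 8) ^ r" using o\<Omega> by (intro power_mono) auto
    also have "\<dots> \<le> card LO" unfolding LO_def by (rule card_pairwise_lists[OF fin\<Omega>O cO])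
    finally show ?thesis .
  qed
  define L where "L = (\<lambda>(xs, ys). zip xs ys) ` (LK \<times> LO)"
  have sw: "length ts = r \<and> switchable E U ts \<and> set (map old1 ts) \<subseteq> X \<and> (\<forall>q\<in>set ts. snd (fst q) \<in> W)" if "ts \<in> L" for ts
  proof -
    obtain ks os where t: "ts = zip ks os" "ks \<in> LK" "os \<in> LO" using \<open>ts \<in> L\<close> by (auto simp: L_def)
    have len: "length ks = r" "length os = r" using t by (auto simp: LK_def LO_def)
    have ks: "Upair x y \<in> X \<and> y \<in> W" if "(x, y) \<in> set ks" for x y
      using that t by (auto simp: LK_def \<Omega>K_def)
    have os: "u \<in> O2 \<and> v \<in> O2 \<and> Upair u v \<in> E" if "(u, v) \<in> set os" for u v
      using that t by (auto simp: LO_def \<Omega>O_def)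
    have so: "sorted_wrt (\<lambda>a b. \<not> cO a b) os" and sk: "sorted_wrt (\<lambda>a b. \<not> cK a b) ks"
      using t by (auto simp: LO_def LK_def)
    have "switchable E U (zip ks os)"
    proof (rule zip_switchable[OF len])
      show "x \<in> U \<and> y \<in> U \<and> Upair x y \<in> E" if "(x, y) \<in> set ks" for x y
        using ks[OF that] X(1) bspec[OF X(2), of "Upair x y"] by auto
      show "u \<notin> U \<and> v \<notin> U \<and> Upair u v \<in> E" if "(u, v) \<in> set os" for u v
        using os[OF that] by (auto simp: O2_def)
      show "distinct (map (\<lambda>(x, y). Upair x y) ks)"
        by (rule distinct_map_sorted_wrt[OF sk]) (auto simp: cK_def split_beta)
      show "distinct (map fst os)"
        by (rule distinct_map_sorted_wrt[OF so]) (auto simp: cO_def)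
      have "distinct (map snd os)"
        by (rule distinct_map_sorted_wrt[OF so]) (auto simp: cO_def)
      then show "distinct (map snd ks) \<or> distinct (map snd os)" by simp
      show "u \<noteq> v'" if "(u, v) \<in> set os" "(u', v') \<in> set os" for u v u' v'
      proof (cases "(u, v) = (u', v')")
        case True
        then show ?thesis using os[OF that(1)] pr(1)[of "Upair u v"] by auto
      next
        case False
        then show ?thesis using sorted_wrt_pairwise[OF so that] by (auto simp: cO_def)
      qed
    qed
    moreover have "old1 q \<in> X \<and> snd (fst q) \<in> W" if "q \<in> set ts" for q
    proof -
      obtain x y u v where q: "q = ((x, y), (u, v))" by (metis surj_pair)
      then have "(x, y) \<in> set ks" using that t(1) set_zip_leftD by metis
      then show ?thesis using ks q by simp
    qed
    ultimately show ?thesis using t(1) len by auto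
  qed
  show thesis
  proof
    show "finite L" using finL by (simp add: L_def)
    have "card L = card LK * card LO"
      unfolding L_def by (rule card_zip_lists[OF finL, of r]) (auto simp: LK_def LO_def)
    then show "(h - r * 2) ^ r * (o' - r * 8) ^ r \<le> card L" using LK LO by (simp add: mult_le_mono)
    fix ts assume ts: "ts \<in> L"
    have s: "switchable E U ts" and len: "length ts = r" and o1: "set (map old1 ts) \<subseteq> X"
      and yW: "\<And>q. q \<in> set ts \<Longrightarrow> snd (fst q) \<in> W" using sw[OF ts] by auto
    let ?E = "switch E ts - set (map new2 ts)"
    have st: "straddles U ts" using s by (simp add: switchable_def)
    have "card (boundary ?E U) \<le> r"
    proof -
      \<comment> \<open>Deleting the edges \<open>yv\<close> leaves only the edges \<open>xu\<close>
        on the boundary: \<open>r\<close> edges to be explored instead of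
        \<open>2 * r\<close>.\<close>
      have "boundary ?E U \<subseteq> boundary (switch E ts) U - set (map new2 ts)" by (auto simp: boundary_def)
      then have "boundary ?E U \<subseteq> set (map new1 ts)" unfolding boundary_switch[OF cl s] by blast
      then have "card (boundary ?E U) \<le> card (set (map new1 ts))" by (rule card_mono[rotated]) simp
      also have "\<dots> \<le> r" using card_length[of "map new1 ts"] len by simp
      finally show ?thesis .
    qed
    moreover have "spanned_from ?E W U"
      unfolding spanned_from_def
    proof
      fix u assume "u \<in> U"
      then obtain w where w: "w \<in> W" "(joined (E - X) U)\<^sup>*\<^sup>* w u" using X(4) by (auto simp: spanned_from_def)
      from w(2) have "(joined ?E U)\<^sup>*\<^sup>* w u"
      proof (rule joined_rtranclp_mono)
        fix x y assume xy: "x \<in> U" "y \<in> U" "Upair x y \<in> E - X"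
        \<comment> \<open>The links from \<open>W\<close> that span \<open>U\<close> survive: the
          removed inner edges lie in \<open>X\<close>, while the removed outer edges and the edges
          \<open>yv\<close> are not contained in \<open>U\<close>.\<close>
        have "Upair x y \<noteq> old2 q \<and> Upair x y \<noteq> new2 q" if q: "q \<in> set ts" for q
        proof -
          obtain x' y' u' v' where e: "q = ((x', y'), (u', v'))" by (metis surj_pair)
          then show ?thesis using straddlesD[OF st, of x' y' u' v'] q xy by auto
        qed
        then have "Upair x y \<notin> set (map old2 ts)" "Upair x y \<notin> set (map new2 ts)" by auto
        moreover have "Upair x y \<notin> set (map old1 ts)" using o1 xy(3) by blast
        ultimately show "Upair x y \<in> ?E" using xy(3) unfolding switch_def by blast
      qed simp
      then show "\<exists>w\<in>W. (joined ?E U)\<^sup>*\<^sup>* w u" using w(1) by blast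
    qed
    moreover have "card (U - W) \<le> k" using k finU by (meson Diff_subset card_mono le_trans)
    ultimately have "U \<in> explored_sets ?E (U \<inter> N) k r"
      using finU unfolding explored_sets_def W_def by blast
    moreover have "set_uprod (new2 q) \<inter> N \<noteq> {}" if q: "q \<in> set ts" for q
    proof -
      obtain x y u v where e: "q = ((x, y), (u, v))" by (metis surj_pair)
      then show ?thesis using yW[OF q] by (auto simp: W_def)
    qed
    ultimately show "length ts = r \<and> switchable E U ts \<and> (\<forall>q\<in>set ts. set_uprod (new2 q) \<inter> N \<noteq> {}) \<and>
       U \<in> explored_sets ?E (U \<inter> N) k r" using s len by blast
  qed
qed

lemma card_UN_bound:
  fixes n m :: nat
  assumes "finite I \<and> card I \<le> n" "\<And>i. i \<in> I \<Longrightarrow> finite (f i) \<and> card (f i) \<le> m"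
  shows "finite (\<Union>i\<in>I. f i) \<and> card (\<Union>i\<in>I. f i) \<le> n * m"
proof
  show "finite (\<Union>i\<in>I. f i)" using assms by blast
  have "card (\<Union>i\<in>I. f i) \<le> (\<Sum>i\<in>I. card (f i))" using assms(1) by (intro card_UN_le) blast
  also have "\<dots> \<le> (\<Sum>i\<in>I. m)" using assms(2) by (intro sum_mono) blast
  also have "\<dots> = card I * m" by simp
  also have "\<dots> \<le> n * m" by (rule mult_le_mono1) (use assms(1) in blast)
  finally show "card (\<Union>i\<in>I. f i) \<le> n * m" .
qed

text \<open>The factors on the right are, in order, the choices of \<open>U \<inter> N\<close>, of
  the set of edges \<open>yv\<close> among the edges meeting \<open>N\<close>, of \<open>U\<close>
  by exploration, and of the orders in which the edges \<open>xu\<close> and \<open>yv\<close> are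
  listed. The set \<open>U \<inter> N\<close> is guessed outright, so no start has to be
  chosen.\<close>

lemma sparse_switching:
  assumes V: "finite V" and N: "N = {v \<in> V. d v \<noteq> 2}" and A: "A \<subseteq> degree_graphs V d"
    and comp: "\<And>E. E \<in> A \<Longrightarrow> \<exists>z\<in>V. card (component_of E z) \<le> k \<and> 4 * h \<le> (\<Sum>v\<in>component_of E z \<inter> N. d v)"
    and h: "0 < h" and o: "o' + (\<Sum>v\<in>N. d v) + 2 * k + 2 * card N \<le> 2 * card V"
  shows "card A * ((h - r * 2) ^ r * (o' - r * 8) ^ r) \<le>
    card (degree_graphs V d) * (2 ^ card N * (2 ^ (\<Sum>v\<in>N. d v) * (((k + r) choose r) * (fact r * fact r))))"
proof -
  let ?F = "(h - r * 2) ^ r * (o' - r * 8) ^ r"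
  have finN: "finite N" using V by (simp add: N)
  define Q where "Q E z L \<longleftrightarrow> z \<in> V \<and> finite L \<and> ?F \<le> card L \<and>
     (\<forall>ts\<in>L. length ts = r \<and> switchable E (component_of E z) ts \<and> (\<forall>q\<in>set ts. set_uprod (new2 q) \<inter> N \<noteq> {}) \<and>
        component_of E z \<in> explored_sets (switch E ts - set (map new2 ts)) (component_of E z \<inter> N) k r)" for E z L
  have "\<exists>z L. Q E z L" if E: "E \<in> A" for E
  proof -
    obtain z where z: "z \<in> V" "card (component_of E z) \<le> k" "4 * h \<le> (\<Sum>v\<in>component_of E z \<inter> N. d v)"
      using comp[OF E] by auto
    have EG: "E \<in> degree_graphs V d" using A E by blast
    have ne: "component_of E z \<inter> N \<noteq> {}" using z(3) h by auto
    show ?thesis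
    proof (rule sparse_lists[OF V EG z(1) refl z(2) N z(3) ne o, of r])
      fix L assume L: "finite L" "?F \<le> card L"
        "\<And>ts. ts \<in> L \<Longrightarrow> length ts = r \<and> switchable E (component_of E z) ts \<and> (\<forall>q\<in>set ts. set_uprod (new2 q) \<inter> N \<noteq> {}) \<and>
          component_of E z \<in> explored_sets (switch E ts - set (map new2 ts)) (component_of E z \<inter> N) k r"
      have "Q E z L" unfolding Q_def using z(1) L by (intro conjI ballI) blast+
      then show "\<exists>z L. Q E z L" by (intro exI)
    qed
  qed
  then obtain z L where Q: "\<And>E. E \<in> A \<Longrightarrow> Q E (z E) (L E)"
    by metis
  define U where "U E = component_of E (z E)" for E
  have cl: "edge_closed E (U E)" for E unfolding U_def by (rule edge_closed_component_of)
  have U: "finite (L E)" "?F \<le> card (L E)"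
    "\<And>ts. ts \<in> L E \<Longrightarrow> length ts = r \<and> switchable E (U E) ts"
    "\<And>ts q. ts \<in> L E \<Longrightarrow> q \<in> set ts \<Longrightarrow> set_uprod (new2 q) \<inter> N \<noteq> {}"
    "\<And>ts. ts \<in> L E \<Longrightarrow> U E \<in> explored_sets (switch E ts - set (map new2 ts)) (U E \<inter> N) k r" if "E \<in> A" for E
    using Q[OF that] unfolding U_def Q_def by blast+
  define code where "code S Y W = {ts. length ts = r \<and> straddles W ts \<and>
     map new1 ts \<in> permutations_of_set S \<and> card S = r \<and> map new2 ts \<in> permutations_of_set Y \<and> card Y = r}" for S Y and W :: "'a set"
  have code: "finite (code S Y W) \<and> card (code S Y W) \<le> fact r * fact r" if fin: "finite S" "finite Y" for S Y W
  proof (cases "card S = r \<and> card Y = r")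
    case True
    have "inj_on (\<lambda>ts. (map new1 ts, map new2 ts)) {ts. length ts = r \<and> straddles W ts}"
      using new_lists_inj[of r W] unfolding inj_on_def by simp
    then have inj: "inj_on (\<lambda>ts. (map new1 ts, map new2 ts)) (code S Y W)"
      by (rule inj_on_subset) (auto simp: code_def)
    have im: "(\<lambda>ts. (map new1 ts, map new2 ts)) ` code S Y W \<subseteq> permutations_of_set S \<times> permutations_of_set Y"
      by (auto simp: code_def)
    have fp: "finite (permutations_of_set S \<times> permutations_of_set Y)" by simp
    have "card (permutations_of_set S \<times> permutations_of_set Y) = fact r * fact r"
      using True fin by (simp add: card_cartesian_product)
    then show ?thesis
      using inj_on_finite[OF inj im fp] card_inj_on_le[OF inj im fp] by simp
  next
    case False
    then have "code S Y W = {}" by (auto simp: code_def)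
    then show ?thesis by simp
  qed
  define T where "T E' = {e \<in> E'. set_uprod e \<inter> N \<noteq> {}}" for E' :: "'a uprod set"
  \<comment> \<open>Exploration takes place after the guessed edges \<open>Y\<close> have been
    deleted, so that \<open>r\<close> bounds the whole remaining boundary.\<close>
  define C where "C E' = (\<Union>W\<in>Pow N. \<Union>Y\<in>Pow (T E'). \<Union>D\<in>explored_sets (E' - Y) W k r. code (boundary (E' - Y) D) Y D)" for E'
  show ?thesis
  proof (rule switching_count[where T = L and f = switch and C = C])
    show "finite A" using A finite_degree_graphs[OF V] finite_subset by blast
    show "finite (degree_graphs V d)" by (rule finite_degree_graphs[OF V])
    show "finite (L E) \<and> ?F \<le> card (L E)" if "E \<in> A" for E using U[OF that] by blast
    show "switch E ts \<in> degree_graphs V d \<and> ts \<in> C (switch E ts)"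
      if E: "E \<in> A" and t: "ts \<in> L E" for E ts
    proof
      have sw: "switchable E (U E) ts" "length ts = r" using U(3)[OF E t] by auto
      show "switch E ts \<in> degree_graphs V d"
        using switch_degree_graphs[OF _ V cl sw(1)] A E by auto
      have dist: "distinct (map new1 ts)" "distinct (map new2 ts)" "set (map new1 ts) \<inter> set (map new2 ts) = {}"
        using sw(1) unfolding switchable_def distinct_append by blast+
      have Y: "set (map new2 ts) \<subseteq> T (switch E ts)"
        using U(4)[OF E t] by (auto simp: T_def switch_def)
      have b: "boundary (switch E ts - set (map new2 ts)) (U E) = set (map new1 ts)"
      proof -
        have "boundary (switch E ts - set (map new2 ts)) (U E) = boundary (switch E ts) (U E) - set (map new2 ts)"
          by (auto simp: boundary_def)
        then show ?thesis unfolding boundary_switch[OF cl sw(1)] using dist(3) by blast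
      qed
      have st: "straddles (U E) ts" using sw(1) unfolding switchable_def by blast
      have cd: "ts \<in> code (boundary (switch E ts - set (map new2 ts)) (U E)) (set (map new2 ts)) (U E)"
        unfolding code_def b
        using permutations_of_setI[OF refl dist(1)] permutations_of_setI[OF refl dist(2)]
          distinct_card[OF dist(1)] distinct_card[OF dist(2)] sw(2) st by simp
      have "U E \<inter> N \<in> Pow N" by blast
      moreover have "set (map new2 ts) \<in> Pow (T (switch E ts))" using Y by blast
      ultimately show "ts \<in> C (switch E ts)" unfolding C_def
        using U(5)[OF E t] cd by blast
    qed
    show "E = E'" if "E \<in> A" "E' \<in> A" "ts \<in> L E" "ts \<in> L E'" "switch E ts = switch E' ts" for E E' ts
    proof -
      have "switchable E (U E) ts" "switchable E' (U E') ts" using U(3) that by blast+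
      then show ?thesis using switch_inj[OF cl _ cl _ that(5)] by blast
    qed
    fix E' assume E': "E' \<in> degree_graphs V d"
    then have finE': "finite E'" by (rule finite_degree_graph[OF V])
    have deg: "edge_degree E' v = d v" if "v \<in> V" for v using E' that by (simp add: degree_graphs_def)
    have finT: "finite (T E')" using finE' by (simp add: T_def)
    have cardT: "card (T E') \<le> (\<Sum>v\<in>N. d v)"
    proof -
      have "T E' = (\<Union>v\<in>N. {e \<in> E'. v \<in> set_uprod e})" by (auto simp: T_def)
      then have "card (T E') \<le> (\<Sum>v\<in>N. edge_degree E' v)"
        unfolding edge_degree_def using card_UN_le[OF finN] by simp
      also have "\<dots> = (\<Sum>v\<in>N. d v)" using deg by (intro sum.cong) (auto simp: N)
      finally show ?thesis .
    qed
    show "finite (C E') \<and> card (C E') \<le> 2 ^ card N * (2 ^ (\<Sum>v\<in>N. d v) * (((k + r) choose r) * (fact r * fact r)))"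
      unfolding C_def
    proof (intro card_UN_bound)
      show "finite (Pow N) \<and> card (Pow N) \<le> 2 ^ card N" using finN by (simp add: card_Pow)
      show "finite (Pow (T E')) \<and> card (Pow (T E')) \<le> 2 ^ (\<Sum>v\<in>N. d v)"
        using finT cardT by (simp add: card_Pow)
      fix W Y assume "W \<in> Pow N" "Y \<in> Pow (T E')"
      then have finY: "finite Y" using finT by (auto intro: finite_subset)
      show "finite (explored_sets (E' - Y) W k r) \<and> card (explored_sets (E' - Y) W k r) \<le> (k + r) choose r"
        using card_explored_sets[of "E' - Y" W k r] finE' by simp
      fix D
      show "finite (code (boundary (E' - Y) D) Y D) \<and> card (code (boundary (E' - Y) D) Y D) \<le> fact r * fact r"
        using finY finE' by (intro code) (auto simp: boundary_def)
    qed
  qed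
qed

section \<open>Suppressing vertices of degree 2\<close>

abbreviation edge_set :: "'a multigraph \<Rightarrow> 'a uprod set" where
  "edge_set G \<equiv> set_mset (edges G)"

lemma adjacent_joined: "adjacent G = joined (edge_set G) UNIV"
  by (auto simp: fun_eq_iff adjacent_def joined_def)

lemma adjacent_sym: "adjacent G a b \<Longrightarrow> adjacent G b a"
  unfolding adjacent_joined by (rule joined_sym)

lemma adjacent_rtranclp_sym: "(adjacent G)\<^sup>*\<^sup>* a b \<Longrightarrow> (adjacent G)\<^sup>*\<^sup>* b a"
  unfolding adjacent_joined by (rule joined_rtranclp_sym)

lemma simple_edges_eq:
  assumes "simple_graph G"
  shows "edges G = mset_set (edge_set G)"
proof (rule multiset_eqI)
  fix e
  show "count (edges G) e = count (mset_set (edge_set G)) e"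
    using assms by (cases "e \<in># edges G") (auto simp: simple_graph_def not_in_iff)
qed

lemma simple_graph_degree:
  assumes "simple_graph G"
  shows "graph_degree G v = edge_degree (edge_set G) v"
proof -
  have "Upair v v \<notin># edges G" using assms by (auto simp: simple_graph_def)
  then have "graph_degree G v = size (incident_edges G v)" by (simp add: graph_degree_def not_in_iff)
  also have "\<dots> = size (filter_mset (\<lambda>e. v \<in> set_uprod e) (mset_set (edge_set G)))"
    unfolding incident_edges_def using simple_edges_eq[OF assms] by simp
  also have "\<dots> = edge_degree (edge_set G) v"
    by (simp add: edge_degree_def)
  finally show ?thesis .
qed

lemma card_neighbours:
  assumes "finite E"
  shows "card {w. Upair u w \<in> E} = edge_degree E u"
proof -
  have eq: "{(u', v). u' = u \<and> Upair u' v \<in> E} = Pair u ` {w. Upair u w \<in> E}" by auto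
  have "card {(u', v). u' = u \<and> Upair u' v \<in> E} = card {w. Upair u w \<in> E}"
    unfolding eq by (rule card_image) (auto simp: inj_on_def)
  then show ?thesis
    using card_pairs_fst_le[OF assms, of u] edge_degree_le_pairs[OF assms, of u] by linarith
qed

text \<open>Needed to see that deleting the cyclic components leaves a vertex of degree other than 2
  in each remaining one. Both neighbours of the last vertex of a longest path lie on the path, and
  the earlier of them can only be the first vertex. The resulting closed path is the entire
  component.\<close>

lemma two_regular_component_is_cycle:
  assumes G: "simple_graph G" and v: "v \<in> verts G" and C: "C = {u. (adjacent G)\<^sup>*\<^sup>* v u}"
    and d2: "\<And>u. u \<in> C \<Longrightarrow> graph_degree G u = 2"
  shows "is_cycle (induced_subgraph G C)"
proof -
  let ?E = "edge_set G"
  have fin: "finite ?E" by simp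
  have wf: "finite (verts G)" "\<And>e. e \<in> ?E \<Longrightarrow> set_uprod e \<subseteq> verts G" "\<And>e. e \<in> ?E \<Longrightarrow> proper_uprod e"
    using G by (auto simp: simple_graph_def wf_multigraph_def)
  have noloop: "\<not> adjacent G a a" for a using wf(3)[of "Upair a a"] by (auto simp: adjacent_def)
  have CV: "C \<subseteq> verts G"
  proof
    fix u assume "u \<in> C"
    then have "(adjacent G)\<^sup>*\<^sup>* v u" by (simp add: C)
    then show "u \<in> verts G"
    proof induction
      case (step y z)
      then show ?case using wf(2)[of "Upair y z"] by (simp add: adjacent_def)
    qed (rule v)
  qed
  have finC: "finite C" using CV wf(1) by (rule finite_subset)
  define nb where "nb u = {w. adjacent G u w}" for u
  have nb: "card (nb u) = 2" if "u \<in> C" for u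
    using card_neighbours[OF fin, of u] d2[OF that] simple_graph_degree[OF G, of u] by (simp add: nb_def adjacent_def)
  have nbC: "nb u \<subseteq> C" if "u \<in> C" for u
    using that by (auto simp: nb_def C intro: rtranclp.rtrancl_into_rtrancl)
  have nbE: "nb u = {a, b}" if "u \<in> C" "a \<in> nb u" "b \<in> nb u" "a \<noteq> b" for u a b
  proof -
    have "finite (nb u)" using nb[OF that(1)] by (metis card.infinite zero_neq_numeral)
    then show ?thesis using card_subset_eq[of "nb u" "{a, b}"] nb[OF that(1)] that by auto
  qed
  \<comment> \<open>a longest path closes up\<close>
  define Pt where "Pt = {vs. vs \<noteq> [] \<and> distinct vs \<and> set vs \<subseteq> C \<and> (\<forall>i. Suc i < length vs \<longrightarrow> adjacent G (vs ! i) (vs ! Suc i))}"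
  have vC: "v \<in> C" by (simp add: C)
  then have "[v] \<in> Pt" by (simp add: Pt_def)
  moreover have "\<forall>vs. vs \<in> Pt \<longrightarrow> length vs < Suc (card C)"
  proof (intro allI impI)
    fix vs assume "vs \<in> Pt"
    then have "length vs = card (set vs)" "set vs \<subseteq> C" by (auto simp: Pt_def distinct_card)
    then show "length vs < Suc (card C)" using card_mono[OF finC, of "set vs"] by simp
  qed
  ultimately obtain vs where vs: "vs \<in> Pt" and mx: "\<And>ws. ws \<in> Pt \<Longrightarrow> length ws \<le> length vs"
    using ex_has_greatest_nat[of "\<lambda>vs. vs \<in> Pt" "[v]" length "Suc (card C)"] by blast
  define m where "m = length vs"
  have dist: "distinct vs" and sub: "set vs \<subseteq> C" and m0: "0 < m"
    and adj: "\<And>i. Suc i < m \<Longrightarrow> adjacent G (vs ! i) (vs ! Suc i)"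
    using vs by (auto simp: Pt_def m_def)
  have inC: "vs ! i \<in> C" if "i < m" for i using sub that by (auto simp: m_def)
  have idx: "vs ! i = vs ! j \<longleftrightarrow> i = j" if "i < m" "j < m" for i j
    using dist that by (simp add: m_def nth_eq_iff_index_eq)
  let ?x = "vs ! (m - 1)"
  have nbx: "nb ?x \<subseteq> set vs"
  proof
    fix w assume w: "w \<in> nb ?x"
    show "w \<in> set vs"
    proof (rule ccontr)
      assume n: "w \<notin> set vs"
      have "w \<in> C" using nbC[OF inC[of "m - 1"]] w m0 by auto
      moreover have "adjacent G ((vs @ [w]) ! i) ((vs @ [w]) ! Suc i)" if "Suc i < length (vs @ [w])" for i
      proof (cases "Suc i = m")
        case True
        then have "m - 1 = i" by simp
        then have "adjacent G (vs ! i) w" using w by (simp add: nb_def)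
        then show ?thesis using True by (simp add: nth_append m_def)
      next
        case False
        then show ?thesis using adj[of i] that by (auto simp: nth_append m_def)
      qed
      ultimately have "vs @ [w] \<in> Pt" using n dist sub unfolding Pt_def by auto
      then show False using mx by fastforce
    qed
  qed
  have "card (nb ?x) = 2" using nb inC m0 by simp
  then obtain a b where ab: "nb ?x = {a, b}" "a \<noteq> b" by (auto simp: card_2_iff)
  \<comment> \<open>\<open>i\<close> is the earlier of the two neighbours. The other one, at
    \<open>j\<close>, guarantees that \<open>vs ! Suc i\<close> is not yet the last vertex, and
    gives \<open>3 \<le> m\<close>.\<close>
  have "\<exists>i j. i < j \<and> j < m - 1 \<and> vs ! i \<in> nb ?x"
  proof -
    obtain i j where ij: "i < m" "j < m" "a = vs ! i" "b = vs ! j"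
      using ab nbx unfolding m_def by (metis in_set_conv_nth insert_subset)
    have "?x \<notin> nb ?x" using noloop by (simp add: nb_def)
    moreover have "vs ! i \<in> nb ?x" "vs ! j \<in> nb ?x" unfolding ab(1) ij(3,4) by blast+
    ultimately have "i \<noteq> m - 1" "j \<noteq> m - 1" "i \<noteq> j" using ab(2) ij(3,4) by blast+
    then have "i < m - 1" "j < m - 1" "i < j \<or> j < i" using ij by auto
    then show ?thesis using \<open>vs ! i \<in> nb ?x\<close> \<open>vs ! j \<in> nb ?x\<close> by blast
  qed
  then obtain i j where ij: "i < j" "j < m - 1" "adjacent G ?x (vs ! i)" by (auto simp: nb_def)
  then have m3: "3 \<le> m" by linarith
  \<comment> \<open>An inner vertex already has its two neighbours on the path; the last vertex
    would be a third.\<close>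
  have "i = 0"
  proof (rule ccontr)
    assume "i \<noteq> 0"
    then obtain i' where i': "i = Suc i'" by (cases i) auto
    have "adjacent G (vs ! i) (vs ! i')" using adjacent_sym[OF adj[of i']] i' ij by simp
    moreover have "adjacent G (vs ! i) (vs ! Suc i)" using adj[of i] ij by auto
    moreover have "vs ! i' \<noteq> vs ! Suc i" using idx[of i' "Suc i"] i' ij by auto
    ultimately have "nb (vs ! i) = {vs ! i', vs ! Suc i}" using nbE[of "vs ! i" "vs ! i'" "vs ! Suc i"] inC[of i] ij by (auto simp: nb_def)
    moreover have "?x \<in> nb (vs ! i)" using ij(3) adjacent_sym by (simp add: nb_def)
    moreover have "?x \<noteq> vs ! i'" "?x \<noteq> vs ! Suc i" using idx[of "m - 1" i'] idx[of "m - 1" "Suc i"] i' ij by auto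
    ultimately show False by simp
  qed
  then have close: "adjacent G ?x (vs ! 0)" using ij by simp
  define s where "s i = Suc i mod m" for i
  define p where "p i = (if i = 0 then m - 1 else i - 1)" for i
  have s_eq: "s i = (if Suc i = m then 0 else Suc i)" if "i < m" for i using that by (auto simp: s_def)
  have sp: "s i < m" "p i < m" "s (p i) = i" "s i \<noteq> p i" if "i < m" for i
    using that m3 by (auto simp: s_eq p_def split: if_splits)
  have adjs: "adjacent G (vs ! i) (vs ! s i)" if "i < m" for i
  proof (cases "Suc i = m")
    case True
    then show ?thesis using close that by (auto simp: s_eq)
  next
    case False
    then show ?thesis using adj that by (auto simp: s_eq)
  qed
  have nbi: "nb (vs ! i) = {vs ! p i, vs ! s i}" if "i < m" for i
  proof (rule nbE[OF inC[OF that]])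
    show "vs ! p i \<in> nb (vs ! i)" using adjacent_sym[OF adjs[OF sp(2)[OF that]]] sp(3)[OF that] by (simp add: nb_def)
    show "vs ! s i \<in> nb (vs ! i)" using adjs[OF that] by (simp add: nb_def)
    show "vs ! p i \<noteq> vs ! s i" using idx sp[OF that] by metis
  qed
  \<comment> \<open>Every vertex of the closed path has both its neighbours on it, so nothing else
    can be reached.\<close>
  have setvs: "set vs = C"
  proof
    show "C \<subseteq> set vs"
    proof
      fix u assume "u \<in> C"
      have "(adjacent G)\<^sup>*\<^sup>* v (vs ! 0)" using inC[OF m0] by (simp add: C)
      then have "(adjacent G)\<^sup>*\<^sup>* (vs ! 0) u" using \<open>u \<in> C\<close> unfolding C
        by (metis adjacent_rtranclp_sym mem_Collect_eq rtranclp_trans)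
      then show "u \<in> set vs"
      proof induction
        case base
        then show ?case using m0 by (simp add: m_def)
      next
        case (step y w)
        then obtain i where i: "i < m" "y = vs ! i" by (auto simp: in_set_conv_nth m_def)
        then have "w \<in> {vs ! p i, vs ! s i}" using step(2) nbi[OF i(1)] by (auto simp: nb_def)
        then show ?case using sp[OF i(1)] by (auto simp: m_def)
      qed
    qed
  qed (rule sub)
  let ?f = "\<lambda>i. Upair (vs ! i) (vs ! s i)"
  have im: "{e \<in> ?E. set_uprod e \<subseteq> C} = ?f ` {..<m}"
  proof
    show "?f ` {..<m} \<subseteq> {e \<in> ?E. set_uprod e \<subseteq> C}"
      using adjs inC sp(1) by (auto simp: adjacent_def)
    show "{e \<in> ?E. set_uprod e \<subseteq> C} \<subseteq> ?f ` {..<m}"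
    proof
      fix e assume e: "e \<in> {e \<in> ?E. set_uprod e \<subseteq> C}"
      obtain a b where ab: "e = Upair a b" by (cases e)
      then have "a \<in> set vs" using e setvs by auto
      then obtain i where i: "i < m" "a = vs ! i" by (auto simp: in_set_conv_nth m_def)
      have "b \<in> nb a" using e ab by (simp add: nb_def adjacent_def)
      then consider "b = vs ! s i" | "b = vs ! p i" using nbi[OF i(1)] i by auto
      then show "e \<in> ?f ` {..<m}"
      proof cases
        case 1
        then show ?thesis using ab i by auto
      next
        case 2
        then have "e = ?f (p i)" using ab i sp(3)[OF i(1)] by simp
        then show ?thesis using sp(2)[OF i(1)] by blast
      qed
    qed
  qed
  \<comment> \<open>For \<open>m = 2\<close> the two indices would give the same edge;
    \<open>m3\<close> excludes this.\<close>
  have inj: "inj_on ?f {..<m}"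
  proof (rule inj_onI)
    fix i j assume ij: "i \<in> {..<m}" "j \<in> {..<m}" "?f i = ?f j"
    then consider "vs ! i = vs ! j" | "vs ! i = vs ! s j" "vs ! s i = vs ! j" by auto
    then show "i = j"
    proof cases
      case 1
      then show ?thesis using idx ij by simp
    next
      case 2
      then have "i = s j" "s i = j" using idx ij sp(1) by (metis lessThan_iff)+
      then show ?thesis using ij m3 by (auto simp: s_eq split: if_splits)
    qed
  qed
  have "edges (induced_subgraph G C) = filter_mset (\<lambda>e. set_uprod e \<subseteq> C) (mset_set ?E)"
    using simple_edges_eq[OF G] by (simp add: induced_subgraph_def)
  also have "\<dots> = mset_set (?f ` {..<m})" unfolding im[symmetric] by simp
  also have "\<dots> = image_mset ?f (mset_set {..<m})" by (rule image_mset_mset_set[OF inj, symmetric])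
  finally have ed: "edges (induced_subgraph G C) = {#Upair (vs ! i) (vs ! (Suc i mod length vs)). i \<in># mset_set {..<length vs}#}"
    by (simp add: m_def s_def)
  moreover have "verts (induced_subgraph G C) = set vs" using CV setvs by (auto simp: induced_subgraph_def)
  ultimately show ?thesis unfolding is_cycle_def using dist m3 by (intro exI[of _ vs]) (simp add: m_def)
qed

section \<open>Degrees and connectivity under suppression\<close>

definition mset_degree :: "'a uprod multiset \<Rightarrow> 'a \<Rightarrow> nat" where
  "mset_degree M v = size {#e \<in># M. v \<in> set_uprod e#} + count M (Upair v v)"

lemma graph_degree_mset: "graph_degree G v = mset_degree (edges G) v"
  by (simp add: graph_degree_def mset_degree_def incident_edges_def)

lemma mset_degree_add [simp]:
  "mset_degree (add_mset e M) v = of_bool (v \<in> set_uprod e) + of_bool (e = Upair v v) + mset_degree M v"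
  by (auto simp: mset_degree_def)

lemma mset_degree_empty [simp]: "mset_degree {#} v = 0"
  by (simp add: mset_degree_def)

lemma mset_degree_mono: "M \<subseteq># M' \<Longrightarrow> mset_degree M v \<le> mset_degree M' v"
  unfolding mset_degree_def
  by (intro add_mono size_mset_mono multiset_filter_mono mset_subset_eq_count)

text \<open>The handshake lemma. It stays an equality with loops, because a loop counts twice at its
  vertex.\<close>

lemma sum_mset_degree:
  assumes "finite C" "\<forall>e\<in>#M. set_uprod e \<subseteq> C"
  shows "(\<Sum>u\<in>C. mset_degree M u) = 2 * size M"
  using assms(2)
proof (induction M)
  case (add e M)
  obtain a b where ab: "e = Upair a b" by (cases e)
  have e: "a \<in> C" "b \<in> C" using add.prems ab by auto
  have "(\<Sum>u\<in>C. of_bool (u \<in> set_uprod e) + of_bool (e = Upair u u) :: nat) = (\<Sum>u\<in>C. of_bool (u = a) + of_bool (u = b))"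
    using ab by (intro sum.cong) auto
  also have "\<dots> = 2" using e assms(1) by (simp add: sum.distrib of_bool_def)
  finally have "(\<Sum>u\<in>C. of_bool (u \<in> set_uprod e) + of_bool (e = Upair u u) :: nat) = 2" .
  then show ?case using add by (simp add: sum.distrib)
qed simp

text \<open>
  The last clause rules out that suppression meets a vertex whose only edge is a loop.
\<close>

definition partly_suppressed :: "'a multigraph \<Rightarrow> 'a multigraph \<Rightarrow> bool" where
  "partly_suppressed G J \<longleftrightarrow> finite (verts J) \<and> verts J \<subseteq> verts G \<and> (\<forall>e\<in>#edges J. set_uprod e \<subseteq> verts J) \<and>
     (\<forall>v\<in>verts J. graph_degree J v = graph_degree G v) \<and>
     (\<forall>a b. adjacent J a b \<longrightarrow> (adjacent G)\<^sup>*\<^sup>* a b) \<and>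
     (\<forall>v\<in>verts J. \<exists>w\<in>verts J. graph_degree G w \<noteq> 2 \<and> (adjacent J)\<^sup>*\<^sup>* v w)"

text \<open>At a vertex \<open>v\<close> of degree 2 without a loop, \<open>suppress\<close>
  replaces exactly two edges by one. The degrees elsewhere and reachability between the remaining
  vertices are kept, hence so is the invariant, which lets the next suppression proceed.\<close>

lemma partly_suppressed_suppress:
  assumes J: "partly_suppressed G J" and v: "v \<in> verts J" and d: "graph_degree G v = 2"
  shows "partly_suppressed G (suppress v J) \<and> verts (suppress v J) = verts J - {v}"
proof -
  have J1: "finite (verts J)" "verts J \<subseteq> verts G" "\<And>e. e \<in># edges J \<Longrightarrow> set_uprod e \<subseteq> verts J"
    "\<And>v. v \<in> verts J \<Longrightarrow> graph_degree J v = graph_degree G v"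
    "\<And>a b. adjacent J a b \<Longrightarrow> (adjacent G)\<^sup>*\<^sup>* a b"
    "\<And>v. v \<in> verts J \<Longrightarrow> \<exists>w\<in>verts J. graph_degree G w \<noteq> 2 \<and> (adjacent J)\<^sup>*\<^sup>* v w"
    using J by (auto simp: partly_suppressed_def)
  have dJ: "size (incident_edges J v) + count (edges J) (Upair v v) = 2"
    using J1(4)[OF v] d by (simp add: graph_degree_def)
  \<comment> \<open>A loop would use up the degree of \<open>v\<close>, so \<open>v\<close> would
    reach only itself, against the last clause of \<open>partly_suppressed\<close>.\<close>
  have noloop: "Upair v v \<notin># edges J"
  proof
    assume l: "Upair v v \<in># edges J"
    then have "count (edges J) (Upair v v) \<ge> 1" by simp
    moreover have li: "Upair v v \<in># incident_edges J v" using l by (simp add: incident_edges_def)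
    ultimately have le1: "size (incident_edges J v) \<le> 1" using dJ by linarith
    obtain N where N: "incident_edges J v = add_mset (Upair v v) N"
      using li by (meson multi_member_split)
    then have "N = {#}" using le1 by simp
    then have inc: "incident_edges J v = {#Upair v v#}" using N by simp
    obtain w where w: "graph_degree G w \<noteq> 2" "(adjacent J)\<^sup>*\<^sup>* v w" using J1(6)[OF v] by blast
    from w(2) have "w = v"
    proof induction
      case (step y z)
      then have "Upair v z \<in># incident_edges J v" by (simp add: incident_edges_def adjacent_def)
      then show ?case using inc by simp
    qed simp
    then show False using w(1) d by simp
  qed
  then have "size (incident_edges J v) = 2" using dJ by (simp add: not_in_iff)
  then obtain e1 N where N: "incident_edges J v = add_mset e1 N" "size N = 1"
    using size_eq_Suc_imp_eq_union[of "incident_edges J v" 1] by auto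
  then obtain e2 where e12: "incident_edges J v = {#e1, e2#}" by (metis size_1_singleton_mset)
  have "e1 \<in># incident_edges J v" "e2 \<in># incident_edges J v" using e12 by auto
  then have e: "e1 \<in># edges J" "v \<in> set_uprod e1" "e2 \<in># edges J" "v \<in> set_uprod e2" by (auto simp: incident_edges_def)
  have other: "\<exists>a. e = Upair v a" if "v \<in> set_uprod e" for e using that by (cases e) auto
  obtain a b where ab: "e1 = Upair v a" "e2 = Upair v b" using other[OF e(2)] other[OF e(4)] by blast
  have anv: "a \<noteq> v" "b \<noteq> v" using noloop e ab by auto
  have inc: "incident_edges J v = {#Upair v a, Upair v b#}" using e12 ab by simp
  have inV: "a \<in> verts J" "b \<in> verts J" using J1(3)[OF e(1)] J1(3)[OF e(3)] ab by auto
  define R where "R = edges J - {#Upair v a, Upair v b#}"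
  have R: "edges J = {#Upair v a, Upair v b#} + R"
  proof -
    have "incident_edges J v \<subseteq># edges J" by (simp add: incident_edges_def)
    then show ?thesis unfolding R_def inc by (metis subset_mset.add_diff_inverse)
  qed
  let ?J = "suppress v J"
  have S: "verts ?J = verts J - {v}" "edges ?J = add_mset (Upair a b) R"
    unfolding suppress_eq[OF inc] R_def by simp_all
  have vR: "v \<notin> set_uprod e" if "e \<in># R" for e
  proof
    assume "v \<in> set_uprod e"
    then have "e \<in># {#e \<in># R. v \<in> set_uprod e#}" using that by simp
    moreover have "{#e \<in># R. v \<in> set_uprod e#} = {#}"
      using inc unfolding incident_edges_def R by simp
    ultimately show False by simp
  qed
  \<comment> \<open>If \<open>a = b\<close>, two parallel edges become a loop, whose double count
    preserves the degree of \<open>a\<close>.\<close>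
  have deg: "graph_degree ?J w = graph_degree J w" if "w \<noteq> v" for w
    unfolding graph_degree_mset S(2) R using that anv by auto
  have adj: "adjacent ?J x y \<longleftrightarrow> {x, y} = {a, b} \<or> (x \<noteq> v \<and> y \<noteq> v \<and> adjacent J x y)" for x y
  proof -
    have "adjacent J x y \<longleftrightarrow> Upair x y = Upair v a \<or> Upair x y = Upair v b \<or> Upair x y \<in># R"
      unfolding adjacent_def R by auto
    moreover have "Upair x y \<in># R \<Longrightarrow> x \<noteq> v \<and> y \<noteq> v" using vR[of "Upair x y"] by auto
    moreover have "adjacent ?J x y \<longleftrightarrow> Upair x y = Upair a b \<or> Upair x y \<in># R"
      unfolding adjacent_def S(2) by auto
    moreover have "Upair x y = Upair a b \<longleftrightarrow> {x, y} = {a, b}" by (auto simp: doubleton_eq_iff)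
    moreover have "x \<noteq> v \<Longrightarrow> y \<noteq> v \<Longrightarrow> Upair x y \<noteq> Upair v a \<and> Upair x y \<noteq> Upair v b" by auto
    ultimately show ?thesis by blast
  qed
  have vnb: "w = a \<or> w = b" if "adjacent J v w \<or> adjacent J w v" for w
  proof -
    have "adjacent J v w" using that adjacent_sym by metis
    then have "Upair v w \<in># incident_edges J v" by (simp add: adjacent_def incident_edges_def)
    then show ?thesis using inc by auto
  qed
  \<comment> \<open>Walks are rerouted around \<open>v\<close>. While a walk stands at
    \<open>v\<close>, both \<open>a\<close> and \<open>b\<close> are kept reachable, whichever of
    them comes next.\<close>
  have reach: "(q \<noteq> v \<longrightarrow> (adjacent ?J)\<^sup>*\<^sup>* p q) \<and> (q = v \<longrightarrow> (adjacent ?J)\<^sup>*\<^sup>* p a \<and> (adjacent ?J)\<^sup>*\<^sup>* p b)"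
    if "(adjacent J)\<^sup>*\<^sup>* p q" "p \<noteq> v" for p q
    using that(1)
  proof induction
    case base
    then show ?case using that(2) by simp
  next
    case (step q q')
    have aab: "adjacent ?J a b" "adjacent ?J b a" by (auto simp: adj)
    consider "q = v" | "q \<noteq> v" "q' = v" | "q \<noteq> v" "q' \<noteq> v" by blast
    then show ?case
    proof cases
      case 1
      then have "q' = a \<or> q' = b" using vnb step.hyps(2) by blast
      then show ?thesis using 1 step.IH anv by auto
    next
      case 2
      then have "q = a \<or> q = b" using vnb step.hyps(2) by blast
      then show ?thesis using 2 step.IH aab by (auto intro: rtranclp.rtrancl_into_rtrancl)
    next
      case 3
      then have "adjacent ?J q q'" using step.hyps(2) adj by simp
      then show ?thesis using 3 step.IH by (auto intro: rtranclp.rtrancl_into_rtrancl)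
    qed
  qed
  have "partly_suppressed G ?J"
    unfolding partly_suppressed_def
  proof (intro conjI ballI allI impI)
    show "finite (verts ?J)" "verts ?J \<subseteq> verts G" using J1 S by auto
    show "set_uprod e \<subseteq> verts ?J" if "e \<in># edges ?J" for e
    proof (cases "e = Upair a b")
      case True
      then show ?thesis using inV anv S(1) by simp
    next
      case False
      then have "e \<in># R" using that S(2) by simp
      then show ?thesis using vR J1(3)[of e] S(1) R by auto
    qed
    show "graph_degree ?J w = graph_degree G w" if "w \<in> verts ?J" for w
      using deg J1(4) that S(1) by auto
    show "(adjacent G)\<^sup>*\<^sup>* x y" if "adjacent ?J x y" for x y
    proof (cases "{x, y} = {a, b}")
      case True
      have "(adjacent G)\<^sup>*\<^sup>* v a" "(adjacent G)\<^sup>*\<^sup>* v b" using J1(5) e ab by (auto simp: adjacent_def)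
      then have "(adjacent G)\<^sup>*\<^sup>* v x" "(adjacent G)\<^sup>*\<^sup>* v y" using True by (auto simp: doubleton_eq_iff)
      then show ?thesis by (metis adjacent_rtranclp_sym rtranclp_trans)
    next
      case False
      then show ?thesis using that adj J1(5) by blast
    qed
    show "\<exists>w\<in>verts ?J. graph_degree G w \<noteq> 2 \<and> (adjacent ?J)\<^sup>*\<^sup>* x w" if "x \<in> verts ?J" for x
    proof -
      have x: "x \<in> verts J" "x \<noteq> v" using that S(1) by auto
      then obtain w where w: "w \<in> verts J" "graph_degree G w \<noteq> 2" "(adjacent J)\<^sup>*\<^sup>* x w" using J1(6) by blast
      then have "w \<noteq> v" using d by auto
      then show ?thesis using reach[OF w(3) x(2)] w S(1) by blast
    qed
  qed
  then show ?thesis using S(1) by simp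
qed

lemma partly_suppressed_fold:
  assumes "partly_suppressed G J" "distinct vs" "set vs \<subseteq> {v \<in> verts J. graph_degree G v = 2}"
  shows "partly_suppressed G (fold suppress vs J) \<and> verts (fold suppress vs J) = verts J - set vs"
  using assms
proof (induction vs arbitrary: J)
  case (Cons v vs)
  have 1: "partly_suppressed G (suppress v J) \<and> verts (suppress v J) = verts J - {v}"
    using Cons.prems by (intro partly_suppressed_suppress) auto
  then have "set vs \<subseteq> {w \<in> verts (suppress v J). graph_degree G w = 2}" using Cons.prems by auto
  then show ?case using Cons.IH[of "suppress v J"] 1 Cons.prems by auto
qed simp

text \<open>The last clause is where deleting cycles matters: a component with all degrees equal to
  2 is a cycle and is gone. The other clauses hold because \<open>Z\<close> is a union of
  components.\<close>

lemma partly_suppressed_delete_cyclic: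
  assumes G: "simple_graph G"
  shows "partly_suppressed G (delete_cyclic_components G)"
proof -
  let ?C = "\<lambda>v. {u. (adjacent G)\<^sup>*\<^sup>* v u}"
  define Z where "Z = (\<Union>K\<in>{K \<in> graph_components G. \<not> is_cycle K}. verts K)"
  let ?J = "delete_cyclic_components G"
  have J: "verts ?J = verts G \<inter> Z" "edges ?J = {#e \<in># edges G. set_uprod e \<subseteq> Z#}"
    by (simp_all add: delete_cyclic_components_def induced_subgraph_def Z_def)
  have wf: "finite (verts G)" "\<And>e. e \<in># edges G \<Longrightarrow> set_uprod e \<subseteq> verts G"
    using G by (auto simp: simple_graph_def wf_multigraph_def)
  have Zc: "\<exists>v0\<in>verts G. \<not> is_cycle (induced_subgraph G (?C v0)) \<and> v \<in> ?C v0 \<and> v \<in> verts G" if "v \<in> Z" for v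
    using that unfolding Z_def graph_components_def by (auto simp: induced_subgraph_def)
  have Zi: "v \<in> Z" if "v0 \<in> verts G" "\<not> is_cycle (induced_subgraph G (?C v0))" "v \<in> ?C v0" "v \<in> verts G" for v v0
    using that unfolding Z_def graph_components_def by (auto simp: induced_subgraph_def)
  have step: "b \<in> Z" if a: "a \<in> Z" "adjacent G a b" for a b
  proof -
    obtain v0 where v0: "v0 \<in> verts G" "\<not> is_cycle (induced_subgraph G (?C v0))" "a \<in> ?C v0" using Zc[OF a(1)] by blast
    have "b \<in> ?C v0" using v0(3) a(2) by (auto intro: rtranclp.rtrancl_into_rtrancl)
    moreover have "b \<in> verts G" using wf(2)[of "Upair a b"] a(2) by (simp add: adjacent_def)
    ultimately show ?thesis using Zi[OF v0(1,2)] by blast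
  qed
  have sub: "set_uprod e \<subseteq> Z" if ev: "e \<in># edges G" "v \<in> set_uprod e" "v \<in> Z" for e v
  proof -
    obtain b where "e = Upair v b" using ev(2) by (cases e) auto
    then show ?thesis using ev step[of v b] by (simp add: adjacent_def)
  qed
  have deg: "graph_degree ?J v = graph_degree G v" if "v \<in> Z" for v
  proof -
    have "{#e \<in># edges ?J. v \<in> set_uprod e#} = {#e \<in># edges G. v \<in> set_uprod e#}"
      unfolding J(2) filter_filter_mset using sub that by (intro filter_mset_cong) auto
    moreover have "count (edges ?J) (Upair v v) = count (edges G) (Upair v v)"
      using that by (simp add: J(2))
    ultimately show ?thesis by (simp add: graph_degree_def incident_edges_def)
  qed
  have reach: "(adjacent ?J)\<^sup>*\<^sup>* v w \<and> w \<in> Z" if "(adjacent G)\<^sup>*\<^sup>* v w" "v \<in> Z" for v w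
    using that(1)
  proof induction
    case (step y z)
    then have "z \<in> Z" using \<open>\<And>b a. a \<in> Z \<Longrightarrow> adjacent G a b \<Longrightarrow> b \<in> Z\<close> by blast
    then have "adjacent ?J y z" using step by (simp add: adjacent_def J(2))
    then show ?case using step.IH \<open>z \<in> Z\<close> by (auto intro: rtranclp.rtrancl_into_rtrancl)
  qed (simp add: that)
  show ?thesis
    unfolding partly_suppressed_def
  proof (intro conjI ballI allI impI)
    show "finite (verts ?J)" "verts ?J \<subseteq> verts G" using wf J by auto
    show "set_uprod e \<subseteq> verts ?J" if "e \<in># edges ?J" for e using that wf(2)[of e] J by auto
    show "graph_degree ?J v = graph_degree G v" if "v \<in> verts ?J" for v using deg that J by auto
    show "(adjacent G)\<^sup>*\<^sup>* a b" if "adjacent ?J a b" for a b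
      using that by (auto simp: adjacent_def J(2) intro!: r_into_rtranclp)
    show "\<exists>w\<in>verts ?J. graph_degree G w \<noteq> 2 \<and> (adjacent ?J)\<^sup>*\<^sup>* v w" if v: "v \<in> verts ?J" for v
    proof (rule ccontr)
      assume c: "\<not> ?thesis"
      have vZ: "v \<in> Z" "v \<in> verts G" using v J by auto
      have CV: "u \<in> verts G" if "u \<in> Z" for u using Zc[OF that] by blast
      have "graph_degree G u = 2" if "u \<in> ?C v" for u
        using c reach[of v u] vZ CV that J(1) by auto
      then have cyc: "is_cycle (induced_subgraph G (?C v))"
        by (intro two_regular_component_is_cycle[OF G vZ(2) refl])
      obtain v0 where v0: "\<not> is_cycle (induced_subgraph G (?C v0))" "(adjacent G)\<^sup>*\<^sup>* v0 v" using Zc[OF vZ(1)] by blast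
      have "?C v0 = ?C v"
        using v0(2) adjacent_rtranclp_sym[OF v0(2)] by (auto intro: rtranclp_trans)
      then show False using v0(1) cyc by simp
    qed
  qed
qed

text \<open>Suppression keeps the degrees of the surviving vertices, all different from 2, and joins
  only vertices connected in \<open>G\<close>. So twice the size of \<open>K\<close> is a sum of
  degrees of such vertices inside one component of \<open>G\<close>.\<close>

lemma suppressed_graph_component:
  assumes G: "simple_graph G" and K: "K \<in> graph_components (suppressed_graph G)"
  obtains z where "z \<in> verts G"
    "2 * graph_size K \<le> (\<Sum>u | u \<in> verts G \<and> (adjacent G)\<^sup>*\<^sup>* z u \<and> graph_degree G u \<noteq> 2. graph_degree G u)"
proof -
  define J0 where "J0 = delete_cyclic_components G"
  define vs where "vs = sorted_list_of_set {v \<in> verts J0. graph_degree J0 v = 2}"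
  define J where "J = fold suppress vs J0"
  have J: "suppressed_graph G = J" by (simp add: suppressed_graph_def J_def vs_def J0_def Let_def)
  have p0: "partly_suppressed G J0" unfolding J0_def by (rule partly_suppressed_delete_cyclic[OF G])
  have eq: "{v \<in> verts J0. graph_degree J0 v = 2} = {v \<in> verts J0. graph_degree G v = 2}"
    using p0 by (auto simp: partly_suppressed_def)
  have fin: "finite {v \<in> verts J0. graph_degree J0 v = 2}" using p0 by (simp add: partly_suppressed_def)
  have svs: "set vs = {v \<in> verts J0. graph_degree G v = 2}" using fin by (simp add: vs_def eq)
  have pJ: "partly_suppressed G J" and vJ: "verts J = verts J0 - set vs"
    using partly_suppressed_fold[OF p0, of vs] svs by (simp_all add: J_def vs_def)
  have d2: "graph_degree G u \<noteq> 2" if "u \<in> verts J" for u using that vJ svs by auto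
  obtain z where z: "z \<in> verts J" "K = induced_subgraph J {u. (adjacent J)\<^sup>*\<^sup>* z u}"
    using K unfolding J graph_components_def by blast
  let ?S = "{u. (adjacent J)\<^sup>*\<^sup>* z u}"
  have finJ: "finite (verts J)" "\<And>e. e \<in># edges J \<Longrightarrow> set_uprod e \<subseteq> verts J" "verts J \<subseteq> verts G"
    "\<And>u. u \<in> verts J \<Longrightarrow> graph_degree J u = graph_degree G u" "\<And>a b. adjacent J a b \<Longrightarrow> (adjacent G)\<^sup>*\<^sup>* a b"
    using pJ by (auto simp: partly_suppressed_def)
  have reach: "(adjacent G)\<^sup>*\<^sup>* z u" if "u \<in> ?S" for u
  proof -
    have "(adjacent J)\<^sup>*\<^sup>* z u" using that by simp
    then show ?thesis by induction (auto dest: finJ(5))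
  qed
  have "2 * graph_size K = (\<Sum>u\<in>verts J \<inter> ?S. mset_degree (edges K) u)"
    using finJ(1,2) z(2) by (intro sum_mset_degree[symmetric]) (auto simp: induced_subgraph_def)
  also have "\<dots> \<le> (\<Sum>u\<in>verts J \<inter> ?S. graph_degree G u)"
  proof (rule sum_mono)
    fix u assume "u \<in> verts J \<inter> ?S"
    then have "graph_degree G u = mset_degree (edges J) u" using finJ(4) graph_degree_mset by (metis IntD1)
    then show "mset_degree (edges K) u \<le> graph_degree G u"
      unfolding z(2) by (auto simp: induced_subgraph_def intro: mset_degree_mono)
  qed
  also have "\<dots> \<le> (\<Sum>u | u \<in> verts G \<and> (adjacent G)\<^sup>*\<^sup>* z u \<and> graph_degree G u \<noteq> 2. graph_degree G u)"
  proof (rule sum_mono2)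
    show "finite {u \<in> verts G. (adjacent G)\<^sup>*\<^sup>* z u \<and> graph_degree G u \<noteq> 2}"
      using G by (simp add: simple_graph_def wf_multigraph_def)
    show "verts J \<inter> ?S \<subseteq> {u \<in> verts G. (adjacent G)\<^sup>*\<^sup>* z u \<and> graph_degree G u \<noteq> 2}"
      using reach finJ(3) d2 by blast
  qed simp
  finally show thesis using that z(1) finJ(3) by blast
qed

section \<open>Probability bounds\<close>

text \<open>The factor before the power of 1/2 is the price of the start: the total degree is at
  most \<open>(1 + 2 / \<delta>) * M\<close>, as the vertices of degree 2 contribute at most
  \<open>2 * n\<close>, and the component owns at least \<open>2 * \<rho> * M\<close>
  half-edges.\<close>

lemma dense_case:
  fixes V :: "'a set" and d :: "'a \<Rightarrow> nat" and \<rho> \<delta> \<gamma> :: real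
  assumes V: "finite V" and pos: "\<And>v. v \<in> V \<Longrightarrow> 0 < d v" and A: "A \<subseteq> degree_graphs V d"
    and N: "N = {v \<in> V. d v \<noteq> 2}" and n: "n = card V" and M: "M = (\<Sum>v\<in>N. d v)"
    and \<rho>: "0 < \<rho>" "\<rho> \<le> 1" and \<delta>: "0 < \<delta>" "\<delta> \<le> 1" and \<gamma>: "\<gamma> = \<rho> * \<delta> / 512"
    and comp: "\<And>E. E \<in> A \<Longrightarrow> \<exists>z\<in>V. real (card (component_of E z)) \<le> \<gamma> * n \<and>
      2 * \<rho> * M \<le> real (\<Sum>v\<in>component_of E z \<inter> N. d v)"
    and r: "1 \<le> r" "2 * real r \<le> \<gamma> * n" and Mr: "4000 * (real r)\<^sup>2 \<le> \<rho> * M" and dM: "\<delta> * n \<le> M"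
  shows "real (card A) \<le> (1 + 2 / \<delta>) / (2 * \<rho>) * (1 / 2) ^ r * real (card (degree_graphs V d))"
proof -
  define k where "k = nat \<lfloor>\<gamma> * n\<rfloor>"
  define s where "s = nat \<lceil>2 * \<rho> * M\<rceil>"
  define e0 where "e0 = nat \<lfloor>\<rho> * M / 2\<rfloor>"
  \<comment> \<open>\<open>8 * r * D\<close> is at least \<open>e0\<close>, which together with
    \<open>b = 16 * r\<close> gives \<open>Db\<close>. The losses are \<open>256 * r ^ 2\<close> for
    heavy pairs and at most \<open>e0 / 8 + 2 * r\<close> for conflicts. Since \<open>e0\<close> is
    at least \<open>1000 * r ^ 2\<close>, half of \<open>e0\<close> survives; this is the origin of
    the constant 4000.\<close>
  define D where "D = e0 div (8 * r) + 1"
  define b where "b = 16 * r"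
  define o' where "o' = n div 4"
  have \<gamma>0: "0 < \<gamma>" "\<gamma> \<le> 1 / 512" using \<rho> \<delta> mult_mono[of \<rho> 1 \<delta> 1] by (auto simp: \<gamma>)
  have r1: "1 \<le> real r" using r by simp
  have r2: "real r \<le> (real r)\<^sup>2" using r1 by (simp add: power2_eq_square)
  have \<rho>M: "4000 \<le> \<rho> * M" using Mr r1 r2 by linarith
  have M0: "0 < real M" using \<rho>M \<rho> by (metis less_le_trans mult_pos_pos mult_zero_right of_nat_0_less_iff bot_nat_0.not_eq_extremum not_numeral_le_zero of_nat_0)
  have n_large: "1024 * real r \<le> n"
  proof -
    have "\<gamma> * n \<le> 1 / 512 * n" using \<gamma>0 by (intro mult_right_mono) auto
    then show ?thesis using r(2) by linarith
  qed
  have k_le: "real k \<le> \<gamma> * n" using \<gamma>0 by (simp add: k_def)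
  have kM: "real k \<le> \<rho> * M / 512"
  proof -
    have "\<gamma> * n = \<rho> / 512 * (\<delta> * n)" by (simp add: \<gamma>)
    also have "\<dots> \<le> \<rho> / 512 * M" using dM \<rho> by (intro mult_left_mono) auto
    finally show ?thesis using k_le by simp
  qed
  have e0_le: "real e0 \<le> \<rho> * M / 2" unfolding e0_def by (rule of_nat_floor) (use \<rho>M in simp)
  have e0_ge: "\<rho> * M / 4 \<le> real e0"
  proof -
    have "\<rho> * M / 2 - 1 \<le> real e0" unfolding e0_def by linarith
    then show ?thesis using \<rho>M by linarith
  qed
  have s_ge: "2 * \<rho> * M \<le> real s" unfolding s_def by linarith
  have h1: "2 * (e0 + k) \<le> s"
  proof -
    have "real (2 * (e0 + k)) \<le> real s" using e0_le kM s_ge \<rho>M by simp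
    then show ?thesis by (simp only: of_nat_le_iff)
  qed
  have h2: "2 * e0 \<le> D * b"
  proof -
    have "e0 \<le> (e0 div (8 * r) + 1) * (8 * r)"
      using r(1) by (metis Suc_eq_plus1 dividend_less_div_times less_imp_le mult_Suc mult_pos_pos zero_less_numeral less_le_trans zero_less_one add.commute)
    then show ?thesis by (simp add: D_def b_def algebra_simps)
  qed
  have h3: "k + 2 * o' \<le> card V"
  proof -
    have "real k \<le> real n / 2" using k_le \<gamma>0 mult_right_mono[of \<gamma> "1/512" "real n"] by linarith
    moreover have "real (2 * o') \<le> real n / 2" unfolding o'_def by linarith
    ultimately show ?thesis unfolding n[symmetric] by linarith
  qed
  have cmp: "\<exists>z\<in>V. card (component_of E z) \<le> k \<and> s \<le> (\<Sum>v\<in>component_of E z. d v)" if E: "E \<in> A" for E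
  proof -
    obtain z where z: "z \<in> V" "real (card (component_of E z)) \<le> \<gamma> * n"
      "2 * \<rho> * M \<le> real (\<Sum>v\<in>component_of E z \<inter> N. d v)" using comp[OF E] by blast
    have sub: "component_of E z \<subseteq> V" using A E z(1) by (intro component_of_subset) (auto simp: degree_graphs_def)
    have "(\<Sum>v\<in>component_of E z \<inter> N. d v) \<le> (\<Sum>v\<in>component_of E z. d v)"
      using finite_subset[OF sub V] by (intro sum_mono2) auto
    then have "2 * \<rho> * M \<le> real (\<Sum>v\<in>component_of E z. d v)" using z(3) by linarith
    then have "s \<le> (\<Sum>v\<in>component_of E z. d v)" unfolding s_def by linarith
    moreover have "card (component_of E z) \<le> k" using z(2) unfolding k_def by linarith
    ultimately show ?thesis using z(1) by blast
  qed
  have count: "card A * (s * ((e0 - b\<^sup>2 - r * (D + 1)) ^ r * (o' - r) ^ r)) \<le>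
    card (degree_graphs V d) * ((\<Sum>v\<in>V. d v) * (((k + 2 * r) choose (2 * r)) * fact (2 * r)))"
    by (rule dense_switching[OF V pos A cmp h1 h2 h3])
  have f1: "\<rho> * M / 8 \<le> real (e0 - b\<^sup>2 - r * (D + 1))"
  proof -
    have "real (e0 div (8 * r)) \<le> real e0 / real (8 * r)" by (rule of_nat_div_le_of_nat)
    then have "real r * real (e0 div (8 * r)) \<le> real r * (real e0 / real (8 * r))" by (intro mult_left_mono) auto
    also have "\<dots> = real e0 / 8" using r1 by simp
    finally have "real (r * (D + 1)) \<le> real e0 / 8 + 2 * real r" by (simp add: D_def algebra_simps)
    moreover have "real (b\<^sup>2) = 256 * (real r)\<^sup>2" by (simp add: b_def power_mult_distrib)
    ultimately have "real e0 / 2 \<le> real e0 - real (b\<^sup>2) - real (r * (D + 1))" using e0_ge Mr r2 by linarith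
    also have "\<dots> \<le> real (e0 - b\<^sup>2 - r * (D + 1))" by linarith
    finally show ?thesis using e0_ge by linarith
  qed
  have f2: "real n / 8 \<le> real (o' - r)"
  proof -
    have "real n / 4 - 1 \<le> real o'" unfolding o'_def by linarith
    then show ?thesis using n_large r1 by linarith
  qed
  have f3: "real ((\<Sum>v\<in>V. d v)) \<le> (1 + 2 / \<delta>) * M"
  proof -
    have "(\<Sum>v\<in>V. d v) = (\<Sum>v\<in>N. d v) + (\<Sum>v\<in>V - N. d v)"
      using V by (subst add.commute, intro sum.subset_diff) (auto simp: N)
    also have "(\<Sum>v\<in>V - N. d v) = (\<Sum>v\<in>V - N. 2)" by (intro sum.cong) (auto simp: N)
    also have "\<dots> \<le> 2 * n" using card_mono[OF V, of "V - N"] by (simp add: n)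
    finally have "real (\<Sum>v\<in>V. d v) \<le> M + 2 * n" unfolding M by linarith
    also have "\<dots> \<le> M + 2 * (M / \<delta>)" using dM \<delta> by (simp add: field_simps)
    finally show ?thesis by (simp add: algebra_simps)
  qed
  have f4: "real (((k + 2 * r) choose (2 * r)) * fact (2 * r)) \<le> (2 * \<gamma> * n) ^ (2 * r)"
  proof -
    have "real (((k + 2 * r) choose (2 * r)) * fact (2 * r)) \<le> real ((k + 2 * r) ^ (2 * r))"
      by (intro of_nat_mono binomial_fact_pow)
    also have "\<dots> = (real (k + 2 * r)) ^ (2 * r)" by simp
    also have "\<dots> \<le> (2 * \<gamma> * n) ^ (2 * r)" using k_le r(2) by (intro power_mono) auto
    finally show ?thesis .
  qed
  define a where "a = real (card A)"
  define g where "g = real (card (degree_graphs V d))"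
  have nn: "0 \<le> a" "0 \<le> g" by (simp_all add: a_def g_def)
  have "a * ((2 * \<rho> * M) * ((\<rho> * M / 8) ^ r * (real n / 8) ^ r)) \<le>
      a * (real s * (real (e0 - b\<^sup>2 - r * (D + 1)) ^ r * real (o' - r) ^ r))"
    using nn s_ge f1 f2 \<rho> by (intro mult_left_mono mult_mono power_mono) auto
  also have "\<dots> \<le> g * (real (\<Sum>v\<in>V. d v) * real (((k + 2 * r) choose (2 * r)) * fact (2 * r)))"
    using of_nat_mono[OF count, where 'a = real] unfolding a_def g_def of_nat_mult of_nat_power .
  also have "\<dots> \<le> g * (((1 + 2 / \<delta>) * M) * (2 * \<gamma> * n) ^ (2 * r))"
    using nn f3 f4 \<delta> by (intro mult_left_mono mult_mono) auto
  finally have *: "a * ((2 * \<rho> * M) * ((\<rho> * M / 8) ^ r * (real n / 8) ^ r)) \<le>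
    g * (((1 + 2 / \<delta>) * M) * (2 * \<gamma> * n) ^ (2 * r))" .
  have n0: "0 < real n" using n_large r1 by linarith
  define X where "X = (\<rho> * M / 8 * (real n / 8)) ^ r"
  have X0: "0 < X" using \<rho>M n0 by (simp add: X_def)
  \<comment> \<open>The gain of one switching: finding two boundary edges leaves at most half as
    many possibilities as there were choices of an inner and an outer edge.\<close>
  have base: "(2 * \<gamma> * n)\<^sup>2 \<le> 1 / 2 * (\<rho> * M / 8 * (real n / 8))"
  proof -
    have "(2 * \<gamma> * n)\<^sup>2 = (\<rho> * \<delta>) * (\<rho> * (\<delta> * n) * n) / 65536" by (simp add: \<gamma> power2_eq_square)
    also have "\<dots> \<le> 1 * (\<rho> * M * n) / 65536"
      using dM \<rho> \<delta> mult_mono[of \<rho> 1 \<delta> 1] by (intro divide_right_mono mult_mono) auto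
    also have "\<dots> \<le> 1 / 2 * (\<rho> * M / 8 * (real n / 8))"
    proof -
      have "0 \<le> \<rho> * M * n" using \<rho> by simp
      then show ?thesis by simp
    qed
    finally show ?thesis .
  qed
  have "(2 * \<gamma> * n) ^ (2 * r) = ((2 * \<gamma> * n)\<^sup>2) ^ r" by (rule power_mult)
  also have "\<dots> \<le> (1 / 2 * (\<rho> * M / 8 * (real n / 8))) ^ r" by (rule power_mono[OF base]) simp
  also have "\<dots> = (1 / 2) ^ r * X" unfolding X_def by (rule power_mult_distrib)
  finally have pw: "(2 * \<gamma> * n) ^ (2 * r) \<le> (1 / 2) ^ r * X" .
  have "a * ((2 * \<rho> * M) * X) \<le> g * (((1 + 2 / \<delta>) * M) * (2 * \<gamma> * n) ^ (2 * r))"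
    using * unfolding X_def power_mult_distrib .
  also have "\<dots> \<le> g * (((1 + 2 / \<delta>) * M) * ((1 / 2) ^ r * X))"
    using nn \<delta> by (intro mult_left_mono pw) auto
  finally have "a * (2 * \<rho>) * (M * X) \<le> (g * (1 + 2 / \<delta>) * (1 / 2) ^ r) * (M * X)" by (simp only: mult_ac)
  then have "a * (2 * \<rho>) \<le> g * (1 + 2 / \<delta>) * (1 / 2) ^ r"
    by (rule mult_right_le_imp_le[OF _ mult_pos_pos[OF M0 X0]])
  then show ?thesis unfolding a_def[symmetric] g_def[symmetric] using \<rho> by (simp add: field_simps)
qed

text \<open>\<open>r\<close> is at least \<open>\<rho> * M / 16\<close>, so \<open>q\<close> makes
  \<open>M \<le> q * r\<close> and bounds the guesses by \<open>4 ^ (q * r)\<close>. The factor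
  \<open>(1 / 8) ^ q\<close> in \<delta> beats \<open>4 ^ q\<close> in each switching.\<close>

lemma sparse_case:
  fixes V :: "'a set" and d :: "'a \<Rightarrow> nat" and \<rho> \<delta> \<gamma> :: real and q :: nat
  assumes V: "finite V" and pos: "\<And>v. v \<in> V \<Longrightarrow> 0 < d v" and A: "A \<subseteq> degree_graphs V d"
    and N: "N = {v \<in> V. d v \<noteq> 2}" and n: "n = card V" and M: "M = (\<Sum>v\<in>N. d v)"
    and \<rho>: "0 < \<rho>" "\<rho> \<le> 1" and \<delta>: "\<delta> = (1 / 8) ^ q / 4" and q: "16 / \<rho> \<le> real q" and \<gamma>: "0 < \<gamma>" "\<gamma> \<le> \<delta>"
    and comp: "\<And>E. E \<in> A \<Longrightarrow> \<exists>z\<in>V. real (card (component_of E z)) \<le> \<gamma> * n \<and>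
      2 * \<rho> * M \<le> real (\<Sum>v\<in>component_of E z \<inter> N. d v)"
    and Mr: "16 \<le> \<rho> * M" and dM: "M \<le> \<delta> * n"
  shows "real (card A) \<le> (1 / 2) ^ nat \<lfloor>\<rho> * M / 8\<rfloor> * real (card (degree_graphs V d))"
proof -
  define k where "k = nat \<lfloor>\<gamma> * n\<rfloor>"
  \<comment> \<open>\<open>4 * h\<close> is at most the available degree sum
    \<open>2 * \<rho> * M\<close>. With \<open>r\<close> about a quarter of \<open>h\<close>, at
    least \<open>r\<close> inner edges remain at every choice, even after subtracting
    \<open>2 * r\<close>.\<close>
  define h where "h = nat \<lfloor>\<rho> * M / 2\<rfloor>"
  define r where "r = nat \<lfloor>\<rho> * M / 8\<rfloor>"
  have q1: "1 \<le> q"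
  proof -
    have "16 \<le> 16 / \<rho>" using \<rho> by (simp add: field_simps)
    then show ?thesis using q by linarith
  qed
  have \<delta>0: "0 < \<delta>" "\<delta> \<le> 1 / 32"
  proof -
    have "(1 / 8 :: real) ^ q \<le> (1 / 8) ^ 1" using q1 by (intro power_decreasing) auto
    then show "\<delta> \<le> 1 / 32" by (simp add: \<delta>)
  qed (simp add: \<delta>)
  have M_le: "real M \<le> n / 32"
  proof -
    have "\<delta> * n \<le> 1 / 32 * n" using \<delta>0 by (intro mult_right_mono) auto
    then show ?thesis using dM by linarith
  qed
  have \<rho>M_le: "\<rho> * M \<le> M" using \<rho> by (simp add: mult_left_le_one_le)
  have k_le: "real k \<le> \<gamma> * n" using \<gamma> by (simp add: k_def)
  have k32: "real k \<le> n / 32"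
  proof -
    have "\<gamma> * n \<le> 1 / 32 * n" using \<gamma> \<delta>0 by (intro mult_right_mono) auto
    then show ?thesis using k_le by linarith
  qed
  have r_le: "real r \<le> \<rho> * M / 8" unfolding r_def by (rule of_nat_floor) (use Mr in simp)
  have r_ge: "\<rho> * M / 16 \<le> real r"
  proof -
    have "\<rho> * M / 8 - 1 \<le> real r" unfolding r_def by linarith
    then show ?thesis using Mr by linarith
  qed
  have r1: "1 \<le> r"
  proof -
    have "1 \<le> real r" using r_ge Mr by linarith
    then show ?thesis by linarith
  qed
  have h_ge: "3 * r \<le> h"
  proof -
    have "\<rho> * M / 2 - 1 \<le> real h" unfolding h_def by linarith
    then have "3 * real r \<le> real h" using Mr r_le by linarith
    then show ?thesis by linarith
  qed
  have h_le: "real h \<le> \<rho> * M / 2" unfolding h_def by (rule of_nat_floor) (use Mr in simp)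
  have finN: "finite N" using V by (simp add: N)
  have cN: "card N \<le> M"
  proof -
    have "card N = (\<Sum>v\<in>N. 1)" by simp
    also have "\<dots> \<le> (\<Sum>v\<in>N. d v)" using pos by (intro sum_mono) (auto simp: N Suc_leI)
    finally show ?thesis by (simp add: M)
  qed
  \<comment> \<open>The parameter \<open>o'\<close> is taken to be \<open>n\<close>: out of nearly
    \<open>2 * n\<close> oriented edges, the component and the vertices in \<open>N\<close> spoil
    only a small part.\<close>
  have o: "n + (\<Sum>v\<in>N. d v) + 2 * k + 2 * card N \<le> 2 * card V"
  proof -
    have "real n + real M + 2 * real k + 2 * real (card N) \<le> 2 * real n" using M_le k32 cN by linarith
    then show ?thesis unfolding n[symmetric] M[symmetric] by linarith
  qed
  have cmp: "\<exists>z\<in>V. card (component_of E z) \<le> k \<and> 4 * h \<le> (\<Sum>v\<in>component_of E z \<inter> N. d v)" if E: "E \<in> A" for E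
  proof -
    obtain z where z: "z \<in> V" "real (card (component_of E z)) \<le> \<gamma> * n"
      "2 * \<rho> * M \<le> real (\<Sum>v\<in>component_of E z \<inter> N. d v)" using comp[OF E] by blast
    have "4 * real h \<le> real (\<Sum>v\<in>component_of E z \<inter> N. d v)" using z(3)[unfolded mult.assoc] h_le by linarith
    then have "4 * h \<le> (\<Sum>v\<in>component_of E z \<inter> N. d v)" by linarith
    moreover have "card (component_of E z) \<le> k" using z(2) unfolding k_def by linarith
    ultimately show ?thesis using z(1) by blast
  qed
  have h0: "0 < h" using h_ge r1 by linarith
  have count: "card A * ((h - r * 2) ^ r * (n - r * 8) ^ r) \<le>
    card (degree_graphs V d) * (2 ^ card N * (2 ^ (\<Sum>v\<in>N. d v) * (((k + r) choose r) * (fact r * fact r))))"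
    by (rule sparse_switching[OF V N A cmp h0 o])
  define a where "a = real (card A)"
  define g where "g = real (card (degree_graphs V d))"
  have nn: "0 \<le> a" "0 \<le> g" by (simp_all add: a_def g_def)
  have n0: "0 < real n" using M_le Mr \<rho>M_le by linarith
  have f1: "real r \<le> real (h - r * 2)" using h_ge by linarith
  have f2: "real n / 2 \<le> real (n - r * 8)" using r_le \<rho>M_le M_le by linarith
  \<comment> \<open>One factorial turns the binomial coefficient into a power of
    \<open>k + r\<close>. The other is at most \<open>r ^ r\<close> and cancels against the choices
    of inner edges.\<close>
  have f3: "real (((k + r) choose r) * (fact r * fact r)) \<le> (2 * \<delta> * n) ^ r * real r ^ r"
  proof -
    have "((k + r) choose r) * (fact r * fact r) = (((k + r) choose r) * fact r) * fact r" by simp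
    also have "\<dots> \<le> (k + r) ^ r * r ^ r"
      using fact_le_power[of r, where 'a = nat] by (intro mult_mono binomial_fact_pow) auto
    finally have "real (((k + r) choose r) * (fact r * fact r)) \<le> real ((k + r) ^ r * r ^ r)" by (rule of_nat_mono)
    also have "\<dots> = real (k + r) ^ r * real r ^ r" by simp
    also have "\<dots> \<le> (2 * \<delta> * n) ^ r * real r ^ r"
    proof (intro mult_right_mono power_mono)
      have "\<gamma> * n \<le> \<delta> * n" using \<gamma> by (intro mult_right_mono) auto
      moreover have "real r \<le> \<delta> * n" using r_le \<rho>M_le dM Mr by linarith
      ultimately show "real (k + r) \<le> 2 * \<delta> * n" using k_le by simp
    qed auto
    finally show ?thesis .
  qed
  have f4: "real (2 ^ card N * 2 ^ (\<Sum>v\<in>N. d v)) \<le> 4 ^ (q * r)"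
  proof -
    have Mq: "M \<le> q * r"
    proof -
      have "16 \<le> \<rho> * q" using q \<rho> by (simp add: field_simps)
      then have "16 * real M \<le> \<rho> * q * M" by (intro mult_right_mono) auto
      also have "\<dots> = 16 * (q * (\<rho> * M / 16))" by simp
      also have "\<dots> \<le> 16 * (q * real r)" using r_ge by (intro mult_left_mono) auto
      finally have "real M \<le> real (q * r)" by simp
      then show ?thesis by linarith
    qed
    have "2 ^ card N * 2 ^ (\<Sum>v\<in>N. d v) \<le> (2 :: nat) ^ M * 2 ^ M"
      unfolding M[symmetric] using cN by (intro mult_mono power_increasing) auto
    also have "\<dots> = 4 ^ M" by (simp flip: power_mult_distrib)
    also have "\<dots> \<le> 4 ^ (q * r)" using Mq by (intro power_increasing) auto
    finally have "real (2 ^ card N * 2 ^ (\<Sum>v\<in>N. d v)) \<le> real (4 ^ (q * r))" by (rule of_nat_mono)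
    then show ?thesis by simp
  qed
  have "a * (real r ^ r * (real n / 2) ^ r) \<le> a * (real (h - r * 2) ^ r * real (n - r * 8) ^ r)"
    using nn f1 f2 by (intro mult_left_mono mult_mono power_mono) auto
  also have "\<dots> \<le> g * (real (2 ^ card N * 2 ^ (\<Sum>v\<in>N. d v)) * real (((k + r) choose r) * (fact r * fact r)))"
    using of_nat_mono[OF count, where 'a = real] unfolding a_def g_def of_nat_mult of_nat_power mult.assoc .
  also have "\<dots> \<le> g * (4 ^ (q * r) * ((2 * \<delta> * n) ^ r * real r ^ r))"
    using nn f3 f4 by (intro mult_left_mono mult_mono) auto
  finally have *: "a * (real r ^ r * (real n / 2) ^ r) \<le> g * (4 ^ (q * r) * ((2 * \<delta> * n) ^ r * real r ^ r))" .
  have half: "(4 :: real) ^ q * (1 / 8) ^ q = (1 / 2) ^ q" by (simp flip: power_mult_distrib)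
  have "2 * \<delta> * n = (1 / 8) ^ q * (real n / 2)" by (simp add: \<delta>)
  then have "4 ^ (q * r) * (2 * \<delta> * n) ^ r = ((4 ^ q * (1 / 8) ^ q) * (real n / 2)) ^ r"
    by (simp only: power_mult power_mult_distrib mult.assoc)
  also have "\<dots> = ((1 / 2) ^ q * (real n / 2)) ^ r" by (simp only: half)
  also have "\<dots> = ((1 / 2) ^ q) ^ r * (real n / 2) ^ r" by (rule power_mult_distrib)
  also have "\<dots> \<le> (1 / 2) ^ r * (real n / 2) ^ r"
  proof (intro mult_right_mono power_mono)
    have "(1 / 2 :: real) ^ q \<le> (1 / 2) ^ 1" using q1 by (intro power_decreasing) auto
    then show "(1 / 2 :: real) ^ q \<le> 1 / 2" by simp
  qed auto
  finally have p: "4 ^ (q * r) * (2 * \<delta> * n) ^ r \<le> (1 / 2) ^ r * (real n / 2) ^ r" .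
  define X where "X = real r ^ r * (real n / 2) ^ r"
  have X0: "0 < X" using r1 n0 by (simp add: X_def)
  have "a * X \<le> g * ((4 ^ (q * r) * (2 * \<delta> * n) ^ r) * real r ^ r)" using * by (simp only: X_def mult.assoc)
  also have "\<dots> \<le> g * (((1 / 2) ^ r * (real n / 2) ^ r) * real r ^ r)"
    using nn by (intro mult_left_mono mult_right_mono p) auto
  also have "\<dots> = ((1 / 2) ^ r * g) * X" by (simp only: X_def mult_ac)
  finally have "a * X \<le> ((1 / 2) ^ r * g) * X" .
  then have "a \<le> (1 / 2) ^ r * g" by (rule mult_right_le_imp_le[OF _ X0])
  then show ?thesis by (simp add: a_def g_def r_def)
qed

section \<open>Transfer from edge sets to the random graph\<close>

lemma edge_set_bij:
  "bij_betw edge_set (graphs_with_degrees D) (degree_graphs {1..length D} (\<lambda>i. D ! (i - 1)))"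
proof (rule bij_betw_imageI)
  let ?V = "{1..length D}" and ?d = "\<lambda>i. D ! (i - 1)"
  show "inj_on edge_set (graphs_with_degrees D)"
  proof (rule inj_onI)
    fix G G' assume G: "G \<in> graphs_with_degrees D" "G' \<in> graphs_with_degrees D" "edge_set G = edge_set G'"
    then have "simple_graph G" "simple_graph G'" "verts G = verts G'" by (auto simp: graphs_with_degrees_def)
    then have "edges G = edges G'" using simple_edges_eq[of G] simple_edges_eq[of G'] G(3) by simp
    then show "G = G'" using \<open>verts G = verts G'\<close> by (rule multigraph.expand[OF conjI, rotated])
  qed
  show "edge_set ` graphs_with_degrees D = degree_graphs ?V ?d"
  proof
    show "edge_set ` graphs_with_degrees D \<subseteq> degree_graphs ?V ?d"
    proof
      fix E assume "E \<in> edge_set ` graphs_with_degrees D"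
      then obtain G where G: "E = edge_set G" "simple_graph G" "verts G = ?V" "\<forall>i\<in>?V. graph_degree G i = ?d i"
        by (auto simp: graphs_with_degrees_def)
      then show "E \<in> degree_graphs ?V ?d"
        using simple_graph_degree[OF G(2)] by (auto simp: degree_graphs_def simple_graph_def wf_multigraph_def)
    qed
    show "degree_graphs ?V ?d \<subseteq> edge_set ` graphs_with_degrees D"
    proof
      fix E assume E: "E \<in> degree_graphs ?V ?d"
      have fin: "finite E" by (rule finite_degree_graph[OF _ E]) simp
      define G where "G = Multigraph ?V (mset_set E)"
      have eG: "edge_set G = E" using fin by (simp add: G_def)
      have s: "simple_graph G"
        using E fin by (auto simp: simple_graph_def wf_multigraph_def G_def degree_graphs_def)
      have "G \<in> graphs_with_degrees D"
        using s E simple_graph_degree[OF s] unfolding eG by (auto simp: graphs_with_degrees_def G_def degree_graphs_def)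
      then show "E \<in> edge_set ` graphs_with_degrees D" using eG by blast
    qed
  qed
qed

lemma M_deg_sum: "M_deg D = (\<Sum>v\<in>{v \<in> {1..length D}. D ! (v - 1) \<noteq> 2}. D ! (v - 1))"
proof -
  have "M_deg D = (\<Sum>d\<leftarrow>D. if d \<noteq> 2 then d else 0)"
    unfolding M_deg_def by (rule sum_list_map_filter')
  also have "\<dots> = (\<Sum>i<length D. if D ! i \<noteq> 2 then D ! i else 0)"
    by (simp add: sum_list_sum_nth atLeast0LessThan)
  also have "\<dots> = (\<Sum>v\<in>{1..length D}. if D ! (v - 1) \<noteq> 2 then D ! (v - 1) else 0)"
    by (rule sum.reindex_bij_witness[of _ "\<lambda>v. v - 1" Suc]) auto
  also have "\<dots> = (\<Sum>v\<in>{v \<in> {1..length D}. D ! (v - 1) \<noteq> 2}. D ! (v - 1))"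
    by (rule sum.inter_filter[symmetric]) simp
  finally show ?thesis .
qed

text \<open>Translates the event into the hypothesis \<open>comp\<close> of the two counting bounds.
  The factor 2 is that of the handshake lemma in the suppressed graph.\<close>

lemma bad_graph_component:
  fixes \<rho> \<gamma> :: real
  assumes G: "G \<in> graphs_with_degrees D"
    and small: "\<not> (\<exists>K\<in>graph_components G. real (graph_order K) \<ge> \<gamma> * real (length D))"
    and large: "\<exists>K\<in>graph_components (suppressed_graph G). real (graph_size K) \<ge> \<rho> * real (M_deg D)"
  shows "\<exists>z\<in>{1..length D}. real (card (component_of (edge_set G) z)) \<le> \<gamma> * real (length D) \<and>
    2 * \<rho> * real (M_deg D) \<le>
      real (\<Sum>v\<in>component_of (edge_set G) z \<inter> {v \<in> {1..length D}. D ! (v - 1) \<noteq> 2}. D ! (v - 1))"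
proof -
  have s: "simple_graph G" and V: "verts G = {1..length D}"
    and d: "\<And>v. v \<in> {1..length D} \<Longrightarrow> graph_degree G v = D ! (v - 1)"
    using G by (auto simp: graphs_with_degrees_def)
  obtain K where K: "K \<in> graph_components (suppressed_graph G)" "real (graph_size K) \<ge> \<rho> * real (M_deg D)"
    using large by blast
  obtain z where z: "z \<in> verts G"
    "2 * graph_size K \<le> (\<Sum>u | u \<in> verts G \<and> (adjacent G)\<^sup>*\<^sup>* z u \<and> graph_degree G u \<noteq> 2. graph_degree G u)"
    by (rule suppressed_graph_component[OF s K(1)])
  have cmp: "component_of (edge_set G) z = {u. (adjacent G)\<^sup>*\<^sup>* z u}"
    by (simp add: component_of_def adjacent_joined)
  have sub: "component_of (edge_set G) z \<subseteq> verts G"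
    using s z(1) by (intro component_of_subset) (auto simp: simple_graph_def wf_multigraph_def)
  let ?K = "induced_subgraph G {u. (adjacent G)\<^sup>*\<^sup>* z u}"
  have "?K \<in> graph_components G" using z(1) by (simp add: graph_components_def)
  moreover have "verts ?K = component_of (edge_set G) z" using sub unfolding cmp by (auto simp: induced_subgraph_def)
  ultimately have "real (card (component_of (edge_set G) z)) \<le> \<gamma> * real (length D)"
    using small by (metis linorder_le_cases)
  moreover have "2 * graph_size K \<le> (\<Sum>v\<in>component_of (edge_set G) z \<inter> {v \<in> {1..length D}. D ! (v - 1) \<noteq> 2}. D ! (v - 1))"
  proof -
    have "{u. u \<in> verts G \<and> (adjacent G)\<^sup>*\<^sup>* z u \<and> graph_degree G u \<noteq> 2} =
        component_of (edge_set G) z \<inter> {v \<in> {1..length D}. D ! (v - 1) \<noteq> 2}"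
      unfolding cmp V using d by auto
    then show ?thesis using z(2) d by simp
  qed
  then have "2 * real (graph_size K) \<le>
      real (\<Sum>v\<in>component_of (edge_set G) z \<inter> {v \<in> {1..length D}. D ! (v - 1) \<noteq> 2}. D ! (v - 1))"
    using of_nat_mono[where 'a = real] by fastforce
  then have "2 * \<rho> * real (M_deg D) \<le>
      real (\<Sum>v\<in>component_of (edge_set G) z \<inter> {v \<in> {1..length D}. D ! (v - 1) \<noteq> 2}. D ! (v - 1))"
    using K(2) by linarith
  ultimately show ?thesis using z(1) V by blast
qed

theorem theorem5:
  fixes lam :: "nat \<Rightarrow> nat" and \<rho> :: real
  assumes "filterlim lam at_top sequentially" and "\<rho> > 0"
  shows "\<exists>\<gamma>::real. \<gamma> > 0 \<and>
    (\<forall>\<epsilon>::real. \<epsilon> > 0 \<longrightarrow>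
      (\<forall>\<^sub>F n in sequentially. \<forall>D. length D = n \<and> feasible D \<and> well_behaved lam D \<longrightarrow>
        measure_pmf.prob (random_graph D)
          {G. \<not> (\<exists>K\<in>graph_components G. real (graph_order K) \<ge> \<gamma> * real n) \<and>
              (\<exists>K\<in>graph_components (suppressed_graph G). real (graph_size K) \<ge> \<rho> * real (M_deg D))}
        < \<epsilon>))"
proof -
  \<comment> \<open>Lowering \<rho> to at most 1 only enlarges the event.\<close>
  define \<rho>' where "\<rho>' = min \<rho> 1"
  have \<rho>': "0 < \<rho>'" "\<rho>' \<le> 1" "\<rho>' \<le> \<rho>" using assms(2) by (auto simp: \<rho>'_def)
  define q where "q = nat \<lceil>16 / \<rho>'\<rceil>"
  have q: "16 / \<rho>' \<le> real q" unfolding q_def by linarith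
  define \<delta> :: real where "\<delta> = (1 / 8) ^ q / 4"
  have "(1 / 8 :: real) ^ q \<le> 1" by (rule power_le_one) auto
  then have \<delta>: "0 < \<delta>" "\<delta> \<le> 1" by (simp_all add: \<delta>_def)
  define \<gamma> where "\<gamma> = \<rho>' * \<delta> / 512"
  have "\<rho>' * \<delta> \<le> 1 * \<delta>" using \<rho>' \<delta> by (intro mult_right_mono) auto
  then have \<gamma>: "0 < \<gamma>" "\<gamma> \<le> \<delta>" using \<rho>' \<delta> by (auto simp: \<gamma>_def)
  define c where "c = (1 + 2 / \<delta>) / (2 * \<rho>')"
  show ?thesis
  proof (intro exI[of _ \<gamma>] conjI allI impI \<gamma>(1))
    fix \<epsilon> :: real assume \<epsilon>: "\<epsilon> > 0"
    \<comment> \<open>At least 1, so that the same factor also covers the sparse bound, which has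
      none.\<close>
    define c' where "c' = max c 1"
    have c': "0 < c'" "c \<le> c'" "1 \<le> c'" by (auto simp: c'_def)
    obtain r0 where r0: "(1 / 2 :: real) ^ r0 < \<epsilon> / c'"
      using real_arch_pow_inv[of "\<epsilon> / c'" "1 / 2"] \<epsilon> c' by auto
    define r where "r = Suc r0"
    have r1: "1 \<le> r" by (simp add: r_def)
    have "(1 / 2 :: real) ^ r \<le> (1 / 2) ^ r0" unfolding r_def by (intro power_decreasing) auto
    then have "(1 / 2 :: real) ^ r < \<epsilon> / c'" using r0 by (rule le_less_trans)
    then have r: "c' * (1 / 2) ^ r < \<epsilon>" using c'(1) by (simp only: pos_less_divide_eq mult.commute)
    \<comment> \<open>Makes \<open>\<rho>' * M\<close> at least \<open>4000 * r ^ 2 + 16\<close>,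
      enough for both cases. Through \<open>well_behaved\<close> it is a condition on
      \<open>n\<close> alone, hence uniform in \<open>D\<close>.\<close>
    define m0 where "m0 = nat \<lceil>(4000 * (real r)\<^sup>2 + 16) / \<rho>'\<rceil>"
    have "\<forall>\<^sub>F n in sequentially. m0 \<le> lam n" using assms(1) by (simp add: filterlim_at_top)
    moreover have "\<forall>\<^sub>F n in sequentially. nat \<lceil>2 * real r / \<gamma>\<rceil> \<le> n" by (rule eventually_ge_at_top)
    ultimately show "\<forall>\<^sub>F n in sequentially. \<forall>D. length D = n \<and> feasible D \<and> well_behaved lam D \<longrightarrow>
        measure_pmf.prob (random_graph D)
          {G. \<not> (\<exists>K\<in>graph_components G. real (graph_order K) \<ge> \<gamma> * real n) \<and>
              (\<exists>K\<in>graph_components (suppressed_graph G). real (graph_size K) \<ge> \<rho> * real (M_deg D))}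
        < \<epsilon>"
    proof eventually_elim
      case (elim n)
      show ?case
      proof (intro allI impI)
        fix D :: "nat list" assume D: "length D = n \<and> feasible D \<and> well_behaved lam D"
        define B :: "nat multigraph set" where "B = {G. \<not> (\<exists>K\<in>graph_components G. real (graph_order K) \<ge> \<gamma> * real n) \<and>
              (\<exists>K\<in>graph_components (suppressed_graph G). real (graph_size K) \<ge> \<rho> * real (M_deg D))}"
        define S where "S = graphs_with_degrees D"
        define V where "V = {1..length D}"
        define d where "d v = D ! (v - 1)" for v
        define N where "N = {v \<in> V. d v \<noteq> 2}"
        define M where "M = M_deg D"
        have S: "finite S" "S \<noteq> {}" using D by (auto simp: S_def finite_graphs_with_degrees feasible_def)
        have bij: "bij_betw edge_set S (degree_graphs V d)"
          using edge_set_bij[of D] unfolding S_def V_def d_def .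
        define A where "A = edge_set ` (S \<inter> B)"
        have A: "A \<subseteq> degree_graphs V d" using bij by (auto simp: A_def bij_betw_def)
        have cardA: "card A = card (S \<inter> B)"
          unfolding A_def by (intro card_image inj_on_subset[OF bij_betw_imp_inj_on[OF bij]]) simp
        have cardS: "card (degree_graphs V d) = card S" using bij by (metis bij_betw_same_card)
        have S0: "0 < real (card S)" using S by (simp add: card_gt_0_iff)
        have V: "finite V" "n = card V" using D by (auto simp: V_def)
        have pos: "0 < d v" if "v \<in> V" for v
        proof -
          have "D ! (v - 1) \<in> set D" using that by (intro nth_mem) (auto simp: V_def)
          then show ?thesis using D by (auto simp: feasible_def d_def)
        qed
        have M: "M = (\<Sum>v\<in>N. d v)" unfolding M_def M_deg_sum N_def V_def d_def ..
        have comp: "\<exists>z\<in>V. real (card (component_of E z)) \<le> \<gamma> * n \<and>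
            2 * \<rho>' * M \<le> real (\<Sum>v\<in>component_of E z \<inter> N. d v)" if E: "E \<in> A" for E
        proof -
          obtain G where G: "G \<in> S" "G \<in> B" "E = edge_set G" using E by (auto simp: A_def)
          have "\<rho>' * real (M_deg D) \<le> \<rho> * real (M_deg D)" using \<rho>' by (intro mult_right_mono) auto
          then have "\<exists>K\<in>graph_components (suppressed_graph G). real (graph_size K) \<ge> \<rho>' * real (M_deg D)"
            using G(2) unfolding B_def by fastforce
          moreover have "\<not> (\<exists>K\<in>graph_components G. real (graph_order K) \<ge> \<gamma> * real (length D))"
            using G(2) D unfolding B_def by simp
          ultimately show ?thesis
            using bad_graph_component[of G D \<gamma> \<rho>'] G D unfolding S_def V_def N_def M_def d_def by simp
        qed
        have "m0 \<le> M" using elim(1) D unfolding M_def well_behaved_def by auto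
        then have "(4000 * (real r)\<^sup>2 + 16) / \<rho>' \<le> M" unfolding m0_def by linarith
        then have Mr: "4000 * (real r)\<^sup>2 + 16 \<le> \<rho>' * M" using \<rho>'(1) by (simp add: field_simps)
        have "0 \<le> 4000 * (real r)\<^sup>2" by simp
        then have M16: "16 \<le> \<rho>' * M" using Mr by linarith
        have "2 * real r / \<gamma> \<le> n" using elim(2) by linarith
        then have nr: "2 * real r \<le> \<gamma> * n" using \<gamma>(1) by (simp add: field_simps)
        \<comment> \<open>The split depends on \<open>D\<close>, not only on \<open>n\<close>, but
          the bound is the same on both sides. In the sparse case the number of switchings grows
          with \<open>M\<close> and is at least \<open>r\<close>.\<close>
        have "real (card A) \<le> c' * (1 / 2) ^ r * real (card S)"
        proof (cases "\<delta> * n \<le> M")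
          case True
          have "real (card A) \<le> c * (1 / 2) ^ r * real (card (degree_graphs V d))"
            unfolding c_def
            by (rule dense_case[OF V(1) pos A N_def V(2) M \<rho>'(1,2) \<delta> \<gamma>_def comp r1 nr _ True])
              (use Mr in simp_all)
          also have "\<dots> \<le> c' * (1 / 2) ^ r * real (card S)"
            unfolding cardS using c' by (intro mult_right_mono) auto
          finally show ?thesis .
        next
          case False
          have "real (card A) \<le> (1 / 2) ^ nat \<lfloor>\<rho>' * M / 8\<rfloor> * real (card (degree_graphs V d))"
            by (rule sparse_case[OF V(1) pos A N_def V(2) M \<rho>'(1,2) \<delta>_def q \<gamma> comp])
              (use M16 False in auto)
          also have "\<dots> \<le> c' * (1 / 2) ^ r * real (card S)"
            unfolding cardS
          proof (rule mult_right_mono)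
            have "real r \<le> (real r)\<^sup>2" using r1 by (simp add: power2_eq_square)
            then have "8 * real r \<le> \<rho>' * M" using Mr \<open>0 \<le> 4000 * (real r)\<^sup>2\<close> by linarith
            then have "real r \<le> \<rho>' * M / 8" by simp
            then have "r \<le> nat \<lfloor>\<rho>' * M / 8\<rfloor>" by linarith
            then have "(1 / 2 :: real) ^ nat \<lfloor>\<rho>' * M / 8\<rfloor> \<le> (1 / 2) ^ r" by (intro power_decreasing) auto
            also have "\<dots> \<le> c' * (1 / 2) ^ r" using c'(3) by simp
            finally show "(1 / 2 :: real) ^ nat \<lfloor>\<rho>' * M / 8\<rfloor> \<le> c' * (1 / 2) ^ r" .
          qed simp
          finally show ?thesis .
        qed
        also have "\<dots> < \<epsilon> * real (card S)" using r S0 by simp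
        finally have "real (card (S \<inter> B)) / real (card S) < \<epsilon>" using S0 cardA by (simp add: field_simps)
        then show "measure_pmf.prob (random_graph D) B < \<epsilon>"
          unfolding random_graph_def S_def[symmetric] measure_pmf_of_set[OF S(2,1)] .
      qed
    qed
  qed
qed

end
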